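(* Let $\Gamma_1$ and $\Gamma_2$ be graded graphs and let $\varphi\in\mathcal{H}_{ex}(\Gamma_1\times\Gamma_2)$. Then only one of the following situations can occur: 1) There exist $\varphi_1\in\mathcal{H}_{ex}(\Gamma_1)$, $\varphi_2\in\mathcal{H}_{ex}(\Gamma_2)$ and real positive numbers $w_1,w_2$ with $w_1+w_2=1$ such that $$\varphi(\lambda,\mu)=w_1^{|\lambda|}w_2^{|\mu|}\varphi_1(\lambda)\varphi_2(\mu),$$ with the convention $0\cdot(+\infty)=0$. Moreover, these $\varphi_1$ and $\varphi_2$ are defined uniquely up to multiplicative constants. 2) There exist $\varphi_1\in\mathcal{H}_{ex}(\Gamma_1)$ and $\nu_2\in\Gamma_2$ such that $$\varphi(\lambda,\mu)=\begin{cases}0,&\text{if }\mu\not\leq\nu_2,\\ +\infty,&\text{if }\mu<\nu_2,\\ \varphi_1(\lambda),&\text{if }\mu=\nu_2.\end{cases}$$ 3) There exist $\nu_1\in\Gamma_1$ and $\varphi_2\in\mathcal{H}_{ex}(\Gamma_2)$ such that $$\varphi(\lambda,\mu)=\begin{cases}0,&\text{if }\lambda\not\leq\nu_1,\\ +\infty,&\text{if }\lambda<\nu_1,\\ \varphi_2(\mu),&\text{if }\lambda=\nu_1.\end{cases}$$ Furthermore, every harmonic function on $\Gamma_1\times\Gamma_2$ of the form 1), 2) or 3) is finite or semifinite, and indecomposable.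
   Context: A graded graph is a pair $(\Gamma,\varkappa)$, where $\Gamma=\bigsqcup_{n\ge0}\Gamma_n$ is a graded set with all levels $\Gamma_n$ finite and $\varkappa:\Gamma\times\Gamma\to\mathbb{R}_{\ge0}$ satisfies: (i) if $\lambda\in\Gamma_n$, $\mu\in\Gamma_m$ and $m-n\ne1$, then $\varkappa(\lambda,\mu)=0$; (ii) for every $\lambda\in\Gamma_n$ there is $\mu\in\Gamma_{n+1}$ with $\varkappa(\lambda,\mu)\neq0$. For $\lambda\in\Gamma_n$ write $|\lambda|=n$. Write $\lambda\nearrow\mu$ if $|\mu|=|\lambda|+1$ and $\varkappa(\lambda,\mu)\ne0$. Write $\mu<\nu$ if there is a path $\mu=\lambda_0\nearrow\lambda_1\nearrow\cdots\nearrow\lambda_n=\nu$ with $n\ge1$, and $\mu\le\nu$ if $\mu<\nu$ or $\mu=\nu$. The direct product of graded graphs $(\Gamma_1,\varkappa_1)$ and $(\Gamma_2,\varkappa_2)$ is the graded graph with vertex set $\Gamma_1\times\Gamma_2$, grading $|(\lambda,\mu)|=|\lambda|+|\mu|$, and multiplicity function $(\varkappa_1\times\varkappa_2)((\lambda_1,\mu_1);(\lambda_2,\mu_2))$ equal to $\varkappa_1(\lambda_1,\lambda_2)$ if $\mu_1=\mu_2$, to $\varkappa_2(\mu_1,\mu_2)$ if $\lambda_1=\lambda_2$, and to $0$ otherwise. A function $\varphi:\Gamma\to\mathbb{R}_{\ge0}\cup\{+\infty\}$ is harmonic if $\varphi(\lambda)=\sum_{\mu:\lambda\nearrow\mu}\varkappa(\lambda,\mu)\varphi(\mu)$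 for all $\lambda\in\Gamma$. It is finite if it takes no infinite value. Its finiteness ideal is $\{\lambda\in\Gamma:\varphi(\lambda)<+\infty\}$. Let $K_0(\Gamma)$ be the real vector space spanned by the vertices of $\Gamma$ subject to the relations $\lambda=\sum_{\mu:\lambda\nearrow\mu}\varkappa(\lambda,\mu)\,\mu$ for all $\lambda\in\Gamma$, let $K_0^+(\Gamma)$ be the cone of nonnegative linear combinations of vertices, and write $b\le_K a$ if $a-b\in K_0^+(\Gamma)$. A harmonic function $\varphi$ defines an $\mathbb{R}_{\ge0}$-linear map $K_0^+(\Gamma)\to\mathbb{R}_{\ge0}\cup\{+\infty\}$ denoted by the same letter. A harmonic function $\varphi$ is semifinite if it is not finite and for every $a\in K_0^+(\Gamma)$ $$\varphi(a)=\sup\{\varphi(b): b\in K_0^+(\Gamma),\ b\le_K a,\ \varphi(b)<+\infty\}.$$ A finite (not identically zero) or semifinite harmonic function $\varphi$ is indecomposable if for any finite or semifinite harmonic function $\varphi'\le\varphi$ which does not vanish identically on the finiteness ideal of $\varphi$, one has $\varphi'=\mathrm{const}\cdot\varphi$ on the finiteness ideal of $\varphi$. $\mathcal{H}_{ex}(\Gamma)$ denotes the set of all indecomposable finite (not identically zero) and semifinite harmonic functions on $\Gamma$.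
   Formalization: In 2) the value for μ<ν_2 is (+∞)·φ_1(λ) with 0·(+∞)=0, i.e. 0 rather than +∞ where φ_1(λ)=0; likewise in 3) with φ_2(μ). With +∞ throughout, the function is not semifinite once φ_1 has a zero and some μ<ν_2 exists, e.g. Γ_1 two disjoint rays. *)

theory Defs
  imports "HOL-Analysis.Analysis"
begin

section \<open>Graded graphs\<close>

record 'a ggraph =
  verts :: "'a set"
  grade :: "'a \<Rightarrow> nat"
  kappa :: "'a \<Rightarrow> 'a \<Rightarrow> real"

locale graded_graph =
  fixes G :: "'a ggraph"
  assumes finite_level: "finite {v \<in> verts G. grade G v = n}"
    and kappa_nonneg: "\<lbrakk>v \<in> verts G; w \<in> verts G\<rbrakk> \<Longrightarrow> 0 \<le> kappa G v w"
    and kappa_eq_0: "\<lbrakk>v \<in> verts G; w \<in> verts G; grade G w \<noteq> grade G v + 1\<rbrakk> \<Longrightarrow> kappa G v w = 0"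
    and ex_succ: "v \<in> verts G \<Longrightarrow> \<exists>w\<in>verts G. grade G w = grade G v + 1 \<and> kappa G v w \<noteq> 0"

definition edge :: "'a ggraph \<Rightarrow> 'a \<Rightarrow> 'a \<Rightarrow> bool" where
  "edge G v w \<longleftrightarrow> v \<in> verts G \<and> w \<in> verts G \<and> grade G w = grade G v + 1 \<and> kappa G v w \<noteq> 0"

definition below :: "'a ggraph \<Rightarrow> 'a \<Rightarrow> 'a \<Rightarrow> bool" where
  "below G = (edge G)\<^sup>+\<^sup>+"

definition beloweq :: "'a ggraph \<Rightarrow> 'a \<Rightarrow> 'a \<Rightarrow> bool" where
  "beloweq G v w \<longleftrightarrow> below G v w \<or> v = w"

text \<open>If both coordinates agree, the two nonzero clauses of the multiplicity function give
  \<open>kappa G1 l l\<close> and \<open>kappa G2 m m\<close>, which both vanish, so the order of the tests is immaterial.\<close>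

definition ggraph_prod :: "'a ggraph \<Rightarrow> 'b ggraph \<Rightarrow> ('a \<times> 'b) ggraph" where
  "ggraph_prod G1 G2 =
    \<lparr>verts = verts G1 \<times> verts G2,
     grade = (\<lambda>(l, m). grade G1 l + grade G2 m),
     kappa = (\<lambda>(l1, m1) (l2, m2).
       if m1 = m2 then kappa G1 l1 l2 else if l1 = l2 then kappa G2 m1 m2 else 0)\<rparr>"

lemma ggraph_prod_simps [simp]:
  "verts (ggraph_prod G1 G2) = verts G1 \<times> verts G2"
  "grade (ggraph_prod G1 G2) (l, m) = grade G1 l + grade G2 m"
  "kappa (ggraph_prod G1 G2) (l, m) (l', m') =
     (if m = m' then kappa G1 l l' else if l = l' then kappa G2 m m' else 0)"
  by (simp_all add: ggraph_prod_def)


section \<open>Harmonic functions\<close>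

text \<open>Only the values on \<^term>\<open>verts G\<close> matter. In \<^typ>\<open>ennreal\<close> one has \<open>0 * \<infinity> = 0\<close>.\<close>

definition harmonic :: "'a ggraph \<Rightarrow> ('a \<Rightarrow> ennreal) \<Rightarrow> bool" where
  "harmonic G \<phi> \<longleftrightarrow> (\<forall>v\<in>verts G. \<phi> v = (\<Sum>w | edge G v w. ennreal (kappa G v w) * \<phi> w))"

definition finiteness_ideal :: "'a ggraph \<Rightarrow> ('a \<Rightarrow> ennreal) \<Rightarrow> 'a set" where
  "finiteness_ideal G \<phi> = {v \<in> verts G. \<phi> v < \<infinity>}"

definition finite_valued :: "'a ggraph \<Rightarrow> ('a \<Rightarrow> ennreal) \<Rightarrow> bool" where
  "finite_valued G \<phi> \<longleftrightarrow> (\<forall>v\<in>verts G. \<phi> v < \<infinity>)"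


section \<open>The ordered vector space \<open>K\<^sub>0\<close>\<close>

text \<open>\<open>K\<^sub>0(G)\<close> is the quotient of the free vector space \<open>K0_vec G\<close> on the vertices by its subspace
  \<open>K0_null G\<close>, spanned by the vectors \<open>K0_rel G v\<close>. Elements of \<open>K\<^sub>0(G)\<close> are given by
  representatives in \<open>K0_vec G\<close>, and those of the cone by nonnegative representatives, whose set
  is \<open>K0_pos G\<close>. Lemma \<open>K0_ext_cong\<close> below shows that the value \<open>K0_ext G \<phi> a\<close> of a
  harmonic function on a cone element does not depend on the nonnegative representative.\<close>

definition K0_vec :: "'a ggraph \<Rightarrow> ('a \<Rightarrow> real) set" where
  "K0_vec G = {f. finite {v. f v \<noteq> 0} \<and> {v. f v \<noteq> 0} \<subseteq> verts G}"

definition K0_rel :: "'a ggraph \<Rightarrow> 'a \<Rightarrow> 'a \<Rightarrow> real" where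
  "K0_rel G v = (\<lambda>w. of_bool (w = v) - (if edge G v w then kappa G v w else 0))"

definition K0_null :: "'a ggraph \<Rightarrow> ('a \<Rightarrow> real) set" where
  "K0_null G = {(\<lambda>w. \<Sum>v\<in>A. c v * K0_rel G v w) | A c. finite A \<and> A \<subseteq> verts G}"

definition K0_pos :: "'a ggraph \<Rightarrow> ('a \<Rightarrow> real) set" where
  "K0_pos G = {f \<in> K0_vec G. \<forall>v. 0 \<le> f v}"

definition K0_eq :: "'a ggraph \<Rightarrow> ('a \<Rightarrow> real) \<Rightarrow> ('a \<Rightarrow> real) \<Rightarrow> bool" where
  "K0_eq G f g \<longleftrightarrow> (\<lambda>v. f v - g v) \<in> K0_null G"

definition K0_le :: "'a ggraph \<Rightarrow> ('a \<Rightarrow> real) \<Rightarrow> ('a \<Rightarrow> real) \<Rightarrow> bool" where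
  "K0_le G b a \<longleftrightarrow> (\<exists>c\<in>K0_pos G. K0_eq G (\<lambda>v. a v - b v) c)"

definition K0_ext :: "'a ggraph \<Rightarrow> ('a \<Rightarrow> ennreal) \<Rightarrow> ('a \<Rightarrow> real) \<Rightarrow> ennreal" where
  "K0_ext G \<phi> a = (\<Sum>v | a v \<noteq> 0. ennreal (a v) * \<phi> v)"


section \<open>Semifinite and indecomposable harmonic functions\<close>

definition finite_harmonic :: "'a ggraph \<Rightarrow> ('a \<Rightarrow> ennreal) \<Rightarrow> bool" where
  "finite_harmonic G \<phi> \<longleftrightarrow> harmonic G \<phi> \<and> finite_valued G \<phi>"

definition semifinite_harmonic :: "'a ggraph \<Rightarrow> ('a \<Rightarrow> ennreal) \<Rightarrow> bool" where
  "semifinite_harmonic G \<phi> \<longleftrightarrow> harmonic G \<phi> \<and> \<not> finite_valued G \<phi> \<and>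
    (\<forall>a\<in>K0_pos G. K0_ext G \<phi> a =
       Sup {K0_ext G \<phi> b | b. b \<in> K0_pos G \<and> K0_le G b a \<and> K0_ext G \<phi> b < \<infinity>})"

definition indecomposable :: "'a ggraph \<Rightarrow> ('a \<Rightarrow> ennreal) \<Rightarrow> bool" where
  "indecomposable G \<phi> \<longleftrightarrow>
    (\<forall>\<phi>'. (finite_harmonic G \<phi>' \<or> semifinite_harmonic G \<phi>') \<and>
          (\<forall>v\<in>verts G. \<phi>' v \<le> \<phi> v) \<and> (\<exists>v\<in>finiteness_ideal G \<phi>. \<phi>' v \<noteq> 0) \<longrightarrow>
       (\<exists>c::real. 0 \<le> c \<and> (\<forall>v\<in>finiteness_ideal G \<phi>. \<phi>' v = ennreal c * \<phi> v)))"

definition H_ex :: "'a ggraph \<Rightarrow> ('a \<Rightarrow> ennreal) set" where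
  "H_ex G = {\<phi>. ((finite_harmonic G \<phi> \<and> (\<exists>v\<in>verts G. \<phi> v \<noteq> 0)) \<or> semifinite_harmonic G \<phi>) \<and>
    indecomposable G \<phi>}"


section \<open>The three kinds of functions on a direct product\<close>

definition prod_form ::
  "'a ggraph \<Rightarrow> 'b ggraph \<Rightarrow> ('a \<times> 'b \<Rightarrow> ennreal) \<Rightarrow>
    real \<Rightarrow> real \<Rightarrow> ('a \<Rightarrow> ennreal) \<Rightarrow> ('b \<Rightarrow> ennreal) \<Rightarrow> bool" where
  "prod_form G1 G2 \<phi> w1 w2 \<phi>1 \<phi>2 \<longleftrightarrow>
    \<phi>1 \<in> H_ex G1 \<and> \<phi>2 \<in> H_ex G2 \<and> 0 < w1 \<and> 0 < w2 \<and> w1 + w2 = 1 \<and>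
    (\<forall>l\<in>verts G1. \<forall>m\<in>verts G2.
      \<phi> (l, m) = ennreal (w1 ^ grade G1 l * w2 ^ grade G2 m) * \<phi>1 l * \<phi>2 m)"

text \<open>The value at \<open>m < \<nu>\<close> is \<open>\<infinity> * \<phi>1 l\<close> and not \<open>\<infinity>\<close> throughout: it is \<open>\<infinity>\<close> if \<open>\<phi>1 l \<noteq> 0\<close>, and \<open>0\<close> if
  \<open>\<phi>1 l = 0\<close>. At a zero \<open>l\<close> of \<open>\<phi>1\<close> the value \<open>\<infinity>\<close> would destroy semifiniteness, because every
  element of the cone that lies below \<open>(l, m)\<close> and has finite \<open>\<phi>\<close>-value has \<open>\<phi>\<close>-value \<open>0\<close>.\<close>

definition left_form ::
  "'a ggraph \<Rightarrow> 'b ggraph \<Rightarrow> ('a \<times> 'b \<Rightarrow> ennreal) \<Rightarrow> ('a \<Rightarrow> ennreal) \<Rightarrow> 'b \<Rightarrow> bool" where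
  "left_form G1 G2 \<phi> \<phi>1 \<nu> \<longleftrightarrow>
    \<phi>1 \<in> H_ex G1 \<and> \<nu> \<in> verts G2 \<and>
    (\<forall>l\<in>verts G1. \<forall>m\<in>verts G2.
      (\<not> beloweq G2 m \<nu> \<longrightarrow> \<phi> (l, m) = 0) \<and>
      (below G2 m \<nu> \<longrightarrow> \<phi> (l, m) = \<infinity> * \<phi>1 l) \<and>
      (m = \<nu> \<longrightarrow> \<phi> (l, m) = \<phi>1 l))"

definition right_form ::
  "'a ggraph \<Rightarrow> 'b ggraph \<Rightarrow> ('a \<times> 'b \<Rightarrow> ennreal) \<Rightarrow> 'a \<Rightarrow> ('b \<Rightarrow> ennreal) \<Rightarrow> bool" where
  "right_form G1 G2 \<phi> \<nu> \<phi>2 \<longleftrightarrow>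
    \<nu> \<in> verts G1 \<and> \<phi>2 \<in> H_ex G2 \<and>
    (\<forall>l\<in>verts G1. \<forall>m\<in>verts G2.
      (\<not> beloweq G1 l \<nu> \<longrightarrow> \<phi> (l, m) = 0) \<and>
      (below G1 l \<nu> \<longrightarrow> \<phi> (l, m) = \<infinity> * \<phi>2 m) \<and>
      (l = \<nu> \<longrightarrow> \<phi> (l, m) = \<phi>2 m))"


section \<open>Consistency of the definitions\<close>

lemma (in graded_graph) finite_edges: "finite {w. edge G v w}"
  by (rule finite_subset[OF _ finite_level[of "grade G v + 1"]]) (auto simp: edge_def)

lemma graded_graph_prod:
  assumes "graded_graph G1" "graded_graph G2"
  shows "graded_graph (ggraph_prod G1 G2)"
proof -
  interpret A: graded_graph G1 by fact
  interpret B: graded_graph G2 by fact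
  show ?thesis
  proof
    fix n
    have "{v \<in> verts (ggraph_prod G1 G2). grade (ggraph_prod G1 G2) v = n} \<subseteq>
        (\<Union>i\<le>n. {v \<in> verts G1. grade G1 v = i}) \<times> (\<Union>j\<le>n. {v \<in> verts G2. grade G2 v = j})"
      by auto
    moreover have "finite \<dots>"
      by (intro finite_cartesian_product finite_UN_I A.finite_level B.finite_level) auto
    ultimately show "finite {v \<in> verts (ggraph_prod G1 G2). grade (ggraph_prod G1 G2) v = n}"
      by (rule finite_subset)
  next
    fix v w assume "v \<in> verts (ggraph_prod G1 G2)" "w \<in> verts (ggraph_prod G1 G2)"
    then show "0 \<le> kappa (ggraph_prod G1 G2) v w"
      by (cases v; cases w) (auto intro: A.kappa_nonneg B.kappa_nonneg)
  next
    fix v w assume "v \<in> verts (ggraph_prod G1 G2)" "w \<in> verts (ggraph_prod G1 G2)"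
      "grade (ggraph_prod G1 G2) w \<noteq> grade (ggraph_prod G1 G2) v + 1"
    then show "kappa (ggraph_prod G1 G2) v w = 0"
      by (cases v; cases w) (auto intro: A.kappa_eq_0 B.kappa_eq_0)
  next
    fix v assume v: "v \<in> verts (ggraph_prod G1 G2)"
    obtain l m where lm: "v = (l, m)" by (cases v)
    then obtain l' where "l' \<in> verts G1" "grade G1 l' = grade G1 l + 1" "kappa G1 l l' \<noteq> 0"
      using v A.ex_succ[of l] by auto
    then show "\<exists>w\<in>verts (ggraph_prod G1 G2).
        grade (ggraph_prod G1 G2) w = grade (ggraph_prod G1 G2) v + 1 \<and>
        kappa (ggraph_prod G1 G2) v w \<noteq> 0"
      using v lm by (intro bexI[of _ "(l', m)"]) auto
  qed
qed

lemma K0_ext_superset: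
  assumes "finite S" "{v. f v \<noteq> 0} \<subseteq> S"
  shows "K0_ext G \<phi> f = (\<Sum>v\<in>S. ennreal (f v) * \<phi> v)"
  unfolding K0_ext_def using assms by (intro sum.mono_neutral_left) auto

lemma (in graded_graph) K0_push:
  assumes h: "harmonic G \<phi>" and f: "f \<in> K0_pos G" and u: "u \<in> verts G"
  defines "f' \<equiv> \<lambda>w. f w - f u * K0_rel G u w"
  shows "f' \<in> K0_pos G" and "K0_ext G \<phi> f' = K0_ext G \<phi> f"
proof -
  define m where "m = (\<lambda>w. if edge G u w then kappa G u w else 0)"
  define S where "S = {v. f v \<noteq> 0} \<union> {u} \<union> {w. edge G u w}"
  have fin: "finite S" and sub: "S \<subseteq> verts G"
    using f u finite_edges[of u] by (auto simp: S_def K0_pos_def K0_vec_def, auto simp: edge_def)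
  have m0: "0 \<le> m w" for w
    by (auto simp: m_def edge_def intro: kappa_nonneg)
  have mu: "m u = 0" by (simp add: m_def edge_def)
  have f0: "0 \<le> f w" for w using f by (auto simp: K0_pos_def)
  have f'_u: "f' u = 0" and f'_ne: "w \<noteq> u \<Longrightarrow> f' w = f w + f u * m w" for w
    using mu by (auto simp: f'_def K0_rel_def m_def algebra_simps)
  have supp: "{v. f' v \<noteq> 0} \<subseteq> S"
  proof
    fix w assume "w \<in> {v. f' v \<noteq> 0}"
    then show "w \<in> S" using f'_ne[of w] by (cases "w = u") (auto simp: S_def m_def split: if_splits)
  qed
  show "f' \<in> K0_pos G"
    using supp fin sub f'_u f'_ne f0 m0 unfolding K0_pos_def K0_vec_def
    by (auto intro: finite_subset)
       (metis add_nonneg_nonneg mult_nonneg_nonneg order_refl)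
  have uS: "u \<in> S" by (simp add: S_def)
  have "(\<Sum>w\<in>S - {u}. ennreal (m w) * \<phi> w) = (\<Sum>w | edge G u w. ennreal (kappa G u w) * \<phi> w)"
    by (rule sum.mono_neutral_cong_right) (use fin in \<open>auto simp: S_def m_def edge_def\<close>)
  then have mphi: "(\<Sum>w\<in>S - {u}. ennreal (m w) * \<phi> w) = \<phi> u"
    using h u by (simp add: harmonic_def)
  have "K0_ext G \<phi> f' = (\<Sum>w\<in>S. ennreal (f' w) * \<phi> w)"
    by (rule K0_ext_superset[OF fin supp])
  also have "\<dots> = (\<Sum>w\<in>S - {u}. ennreal (f' w) * \<phi> w)"
    using sum.remove[OF fin uS, of "\<lambda>w. ennreal (f' w) * \<phi> w"] f'_u by simp
  also have "\<dots> = (\<Sum>w\<in>S - {u}. ennreal (f w) * \<phi> w + ennreal (f u) * (ennreal (m w) * \<phi> w))"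
    by (rule sum.cong) (auto simp: f'_ne f0 m0 ennreal_mult ennreal_plus distrib_right mult.assoc)
  also have "\<dots> = (\<Sum>w\<in>S - {u}. ennreal (f w) * \<phi> w) + ennreal (f u) * \<phi> u"
    by (simp add: sum.distrib mphi flip: sum_distrib_left)
  also have "\<dots> = (\<Sum>w\<in>S. ennreal (f w) * \<phi> w)"
    using sum.remove[OF fin uS, of "\<lambda>w. ennreal (f w) * \<phi> w"] by (simp add: add.commute)
  also have "\<dots> = K0_ext G \<phi> f"
    by (rule K0_ext_superset[symmetric, OF fin]) (auto simp: S_def)
  finally show "K0_ext G \<phi> f' = K0_ext G \<phi> f" .
qed

lemma (in graded_graph) K0_ext_cong:
  assumes h: "harmonic G \<phi>" and "f \<in> K0_pos G" "g \<in> K0_pos G" "K0_eq G f g"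
  shows "K0_ext G \<phi> f = K0_ext G \<phi> g"
proof -
  obtain A c where A: "finite A" "A \<subseteq> verts G"
    and eq: "(\<lambda>w. f w - g w) = (\<lambda>w. \<Sum>v\<in>A. c v * K0_rel G v w)"
    using assms(4) unfolding K0_eq_def K0_null_def by auto
  have "f w - g w = (\<Sum>v\<in>A. c v * K0_rel G v w)" for w
    using eq by meson
  with A assms(2,3) show ?thesis
  proof (induction "card A" arbitrary: A f g)
    case 0
    then have "f = g" by auto
    then show ?case by simp
  next
    case (Suc n)
    then have "A \<noteq> {}" "finite A" by auto
    then obtain u where u: "u \<in> A" "\<And>v. v \<in> A \<Longrightarrow> grade G u \<le> grade G v"
      by (metis arg_min_if_finite(1) arg_min_least)
    have uG: "u \<in> verts G" using u Suc.prems by auto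
    have "f u - g u = (\<Sum>v\<in>A. c v * K0_rel G v u)" by fact
    also have "\<dots> = (\<Sum>v\<in>A. if v = u then c u else 0)"
      using u(2) by (intro sum.cong) (fastforce simp: K0_rel_def edge_def)+
    also have "\<dots> = c u" using u \<open>finite A\<close> by simp
    finally have cu: "c u = f u - g u" by simp
    define f' where "f' = (\<lambda>w. f w - f u * K0_rel G u w)"
    define g' where "g' = (\<lambda>w. g w - g u * K0_rel G u w)"
    have "f' w - g' w = (\<Sum>v\<in>A - {u}. c v * K0_rel G v w)" for w
      using Suc.prems(5)[of w] sum.remove[OF \<open>finite A\<close> u(1), of "\<lambda>v. c v * K0_rel G v w"] cu
      by (simp add: f'_def g'_def algebra_simps)
    then have "K0_ext G \<phi> f' = K0_ext G \<phi> g'"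
      using Suc.hyps(2) u \<open>finite A\<close> Suc.prems K0_push(1)[OF h _ uG]
      by (intro Suc.hyps(1)[of "A - {u}"]) (auto simp: f'_def g'_def)
    then show ?case
      using K0_push(2)[OF h _ uG] Suc.prems(3,4) by (simp add: f'_def g'_def)
  qed
qed

end

theory Submission
  imports Defs "HOL-Complex_Analysis.Great_Picard"
begin

text \<open>
  A harmonic function on an upward closed set \<open>U\<close> has a least harmonic majorant on the whole graph,
  the limit of the iterates of the one-step operator on its extension by zero. A function is finite or
  semifinite iff it is the extension of its restriction to its finiteness ideal, and it is
  indecomposable iff moreover this restriction is extremal. By extremality the ideal can be shrunk to
  the set of vertices above any single vertex \<open>p\<close> with \<open>0 < \<phi> p < \<infinity>\<close>. On a direct product the set
  above \<open>(p, q)\<close> is a product.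

  The step operator of a product is the sum of the commuting step operators \<open>A1\<close>, \<open>A2\<close> of the factors,
  so an extremal \<open>\<phi>\<close> satisfies \<open>A1 \<phi> = w1 \<phi>\<close> and \<open>A2 \<phi> = w2 \<phi>\<close> with \<open>w1 + w2 = 1\<close>. If \<open>w2 = 0\<close>, then \<open>\<phi>\<close>
  lives over \<open>q\<close> and extends by \<open>\<infinity>\<close> below \<open>q\<close>; symmetrically for \<open>w1 = 0\<close>. Otherwise
  \<open>w1 powr (- |\<lambda>|) * w2 powr (- |\<mu>|) * \<phi>\<close> is harmonic in each variable and extremal among such functions,
  and a compactness argument shows that its sections are extremal, hence proportional. Conversely, a
  variance argument shows that every harmonic function dominated by a product of extremal functions
  is again an eigenfunction of \<open>A1\<close> and \<open>A2\<close>, which yields extremality of the product.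
\<close>

text \<open>Principal up-sets tame the convention \<open>0 * \<infinity> = 0\<close>. The finiteness
  ideal of a product function need not be a rectangle, since a zero of one factor hides an infinite
  value of the other; above a pair of base points both factors are finite, and
  \<open>extension_product\<close> recovers all other values.

  The two directions meet opposite obstacles. To prove sections extremal, a function below one
  section must be lifted to a function harmonic in both variables, because extremality speaks only
  of the latter; hence the compactness argument. To prove a product extremal, a competitor
  \<open>g\<close> below the product \<open>f\<close> is only known to be harmonic for
  \<open>A1 + A2\<close>, whereas extremality of the factors applies to functions harmonic in each
  variable. Probabilistically, in the Doob transform by \<open>f\<close> the first coordinate moves
  with probability \<open>w1\<close> at every step, whatever the position, and \<open>g / f\<close>
  is a bounded martingale. The variance coming from the choice of the coordinate has bounded total,
  while its expected increments do not decrease, so it is zero.\<close>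

definition step :: "'a ggraph \<Rightarrow> ('a \<Rightarrow> ennreal) \<Rightarrow> 'a \<Rightarrow> ennreal" where
  "step G f v = (\<Sum>w | edge G v w. ennreal (kappa G v w) * f w)"

definition upclosed :: "'a ggraph \<Rightarrow> 'a set \<Rightarrow> bool" where
  "upclosed G U \<longleftrightarrow> U \<subseteq> verts G \<and> (\<forall>v\<in>U. \<forall>w. edge G v w \<longrightarrow> w \<in> U)"

definition upset :: "'a ggraph \<Rightarrow> 'a \<Rightarrow> 'a set" where
  "upset G p = {v. (edge G)\<^sup>*\<^sup>* p v}"

definition harmonic_on :: "'a ggraph \<Rightarrow> 'a set \<Rightarrow> ('a \<Rightarrow> ennreal) \<Rightarrow> bool" where
  "harmonic_on G U f \<longleftrightarrow> (\<forall>v\<in>U. step G f v = f v)"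

definition extremal_on :: "'a ggraph \<Rightarrow> 'a set \<Rightarrow> ('a \<Rightarrow> ennreal) \<Rightarrow> bool" where
  "extremal_on G U f \<longleftrightarrow> harmonic_on G U f \<and> (\<forall>v\<in>U. f v < \<infinity>) \<and>
    (\<forall>g. harmonic_on G U g \<and> (\<forall>v\<in>U. g v \<le> f v) \<longrightarrow>
      (\<exists>c\<ge>0. \<forall>v\<in>U. g v = ennreal c * f v))"

definition restr :: "'a set \<Rightarrow> ('a \<Rightarrow> ennreal) \<Rightarrow> 'a \<Rightarrow> ennreal" where
  "restr U f v = (if v \<in> U then f v else 0)"

definition extension :: "'a ggraph \<Rightarrow> 'a set \<Rightarrow> ('a \<Rightarrow> ennreal) \<Rightarrow> 'a \<Rightarrow> ennreal" where
  "extension G U f v = (SUP n. (step G ^^ n) (restr U f) v)"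

text \<open>One condition that stands for both finiteness and semifiniteness and avoids the cone
  \<open>K0_pos\<close>; see \<open>regular_iff\<close>.\<close>

definition regular :: "'a ggraph \<Rightarrow> ('a \<Rightarrow> ennreal) \<Rightarrow> bool" where
  "regular G \<phi> \<longleftrightarrow> harmonic G \<phi> \<and> (\<forall>v\<in>verts G. \<phi> v = extension G (finiteness_ideal G \<phi>) \<phi> v)"

section \<open>Operator calculus and up-closed sets\<close>

lemma harmonic_iff: "harmonic G f \<longleftrightarrow> harmonic_on G (verts G) f"
  by (auto simp: harmonic_def harmonic_on_def step_def)

lemma harmonic_on_subset: "harmonic_on G U f \<Longrightarrow> V \<subseteq> U \<Longrightarrow> harmonic_on G V f"
  by (auto simp: harmonic_on_def)

lemma upclosed_verts: "upclosed G (verts G)"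
  by (auto simp: upclosed_def edge_def)

lemma upclosedD: "upclosed G U \<Longrightarrow> v \<in> U \<Longrightarrow> edge G v w \<Longrightarrow> w \<in> U"
  by (auto simp: upclosed_def)

lemma upclosed_subset: "upclosed G U \<Longrightarrow> U \<subseteq> verts G"
  by (auto simp: upclosed_def)

lemma upset_refl [simp]: "p \<in> upset G p"
  by (simp add: upset_def)

lemma upset_subset:
  assumes "upclosed G U" "p \<in> U" shows "upset G p \<subseteq> U"
proof
  fix v assume "v \<in> upset G p"
  then have "(edge G)\<^sup>*\<^sup>* p v" by (simp add: upset_def)
  then show "v \<in> U" by (induction rule: rtranclp_induct) (use assms upclosedD in fast)+
qed

lemma upclosed_upset: "p \<in> verts G \<Longrightarrow> upclosed G (upset G p)"
  using upset_subset[OF upclosed_verts, of p G]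
  by (auto simp: upclosed_def upset_def intro: rtranclp.rtrancl_into_rtrancl)

lemma beloweq_iff_upset: "beloweq G v w \<longleftrightarrow> w \<in> upset G v"
  by (auto simp: beloweq_def below_def upset_def dest: rtranclpD)

lemma step_mono: "(\<And>w. edge G v w \<Longrightarrow> f w \<le> g w) \<Longrightarrow> step G f v \<le> step G g v"
  unfolding step_def by (intro sum_mono mult_left_mono) auto

lemma step_cong: "(\<And>w. edge G v w \<Longrightarrow> f w = g w) \<Longrightarrow> step G f v = step G g v"
  unfolding step_def by (intro sum.cong) auto

lemma step_add: "step G (\<lambda>w. f w + g w) v = step G f v + step G g v"
  by (simp add: step_def distrib_left sum.distrib)

lemma step_cmult: "step G (\<lambda>w. c * f w) v = c * step G f v"
  unfolding step_def sum_distrib_left by (intro sum.cong) (simp_all add: mult_ac)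

lemma step_cmult_right: "step G (\<lambda>w. f w * c) v = step G f v * c"
  unfolding step_def sum_distrib_right by (intro sum.cong) (simp_all add: mult_ac)

lemma step_zero: "step G (\<lambda>w. 0) v = 0"
  by (simp add: step_def)

lemma step_outside: "v \<notin> verts G \<Longrightarrow> step G f v = 0"
  by (simp add: step_def edge_def)

lemma step_SUP:
  assumes "\<And>w. incseq (\<lambda>n. F n w)"
  shows "step G (\<lambda>w. SUP n. F n w) v = (SUP n. step G (F n) v)"
  unfolding step_def SUP_mult_left_ennreal
  by (rule ennreal_SUP_sum[symmetric])
     (use assms in \<open>auto simp: incseq_def intro!: mult_left_mono\<close>)

lemma (in graded_graph) kappa_pos: "edge G v w \<Longrightarrow> 0 < kappa G v w"
  using kappa_nonneg[of v w] by (auto simp: edge_def)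

lemma (in graded_graph) step_ge:
  assumes "edge G v w" shows "ennreal (kappa G v w) * f w \<le> step G f v"
  unfolding step_def by (rule member_le_sum) (use assms finite_edges in auto)

lemma (in graded_graph) succ_finite:
  assumes "step G f v < \<infinity>" "edge G v w" shows "f w < \<infinity>"
  using step_ge[OF assms(2), of f] assms kappa_pos[OF assms(2)]
  by (auto simp: top_unique less_top[symmetric] ennreal_mult_eq_top_iff ennreal_eq_0_iff)

lemma (in graded_graph) upclosed_finiteness_ideal:
  assumes "harmonic G \<phi>" shows "upclosed G (finiteness_ideal G \<phi>)"
  using assms succ_finite[of \<phi>] 
  by (auto simp: upclosed_def finiteness_ideal_def harmonic_iff harmonic_on_def edge_def)

subsection \<open>Least harmonic majorants\<close>

lemma step_pow_mono: "(\<And>w. f w \<le> g w) \<Longrightarrow> (step G ^^ n) f v \<le> (step G ^^ n) g v"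
  by (induction n arbitrary: v) (auto intro: step_mono)

text \<open>The zero extension of \<open>f\<close> is subharmonic: at points of \<open>U\<close> the
  operator sees only successors in \<open>U\<close>, and elsewhere the left side is 0. This starts
  the monotone iteration.\<close>

lemma restr_le_step:
  assumes "upclosed G U" "harmonic_on G U f"
  shows "restr U f v \<le> step G (restr U f) v"
proof (cases "v \<in> U")
  case True
  then have "step G (restr U f) v = step G f v"
    using upclosedD[OF assms(1)] by (intro step_cong) (auto simp: restr_def)
  then show ?thesis using assms(2) True by (simp add: harmonic_on_def restr_def)
qed (simp add: restr_def)

lemma incseq_step_pow:
  assumes "upclosed G U" "harmonic_on G U f"
  shows "incseq (\<lambda>n. (step G ^^ n) (restr U f) v)"
  using step_pow_mono[OF restr_le_step[OF assms]]
  by (intro incseq_SucI) (simp add: funpow_Suc_right del: funpow.simps)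

lemma step_pow_on:
  assumes "upclosed G U" "harmonic_on G U f" "v \<in> U"
  shows "(step G ^^ n) (restr U f) v = f v"
  using assms(3)
proof (induction n arbitrary: v)
  case 0 then show ?case by (simp add: restr_def)
next
  case (Suc n)
  have "step G ((step G ^^ n) (restr U f)) v = step G f v"
    using Suc upclosedD[OF assms(1) Suc.prems] by (intro step_cong) auto
  then show ?case using assms(2) Suc.prems by (simp add: harmonic_on_def)
qed

lemma extension_on:
  assumes "upclosed G U" "harmonic_on G U f" "v \<in> U"
  shows "extension G U f v = f v"
  by (simp add: extension_def step_pow_on[OF assms])

text \<open>Shifting the index does not change the supremum of an increasing sequence, so the limit
  is a fixed point at every \<open>v\<close>.\<close>

lemma extension_step:
  assumes "upclosed G U" "harmonic_on G U f"
  shows "step G (extension G U f) v = extension G U f v"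
proof -
  have "step G (extension G U f) v = (SUP n. step G ((step G ^^ n) (restr U f)) v)"
    unfolding extension_def by (rule step_SUP) (rule incseq_step_pow[OF assms])
  also have "\<dots> = (SUP n. (step G ^^ Suc n) (restr U f) v)" by simp
  also have "\<dots> = extension G U f v"
    unfolding extension_def
  proof (rule antisym)
    show "(SUP n. (step G ^^ Suc n) (restr U f) v) \<le> (SUP n. (step G ^^ n) (restr U f) v)"
      by (rule SUP_mono) blast
    show "(SUP n. (step G ^^ n) (restr U f) v) \<le> (SUP n. (step G ^^ Suc n) (restr U f) v)"
      using incseq_SucD[OF incseq_step_pow[OF assms, of v]] by (intro SUP_mono) blast
  qed
  finally show ?thesis .
qed

lemma extension_harmonic:
  "upclosed G U \<Longrightarrow> harmonic_on G U f \<Longrightarrow> harmonic_on G V (extension G U f)"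
  by (simp add: harmonic_on_def extension_step)

text \<open>A superharmonic bound \<open>h\<close> survives every iteration. This generality matters
  in \<open>extension_over\<close>, where the section used as \<open>h\<close> is only known to be
  superharmonic.\<close>

lemma extension_least:
  assumes "\<And>v. v \<in> verts G \<Longrightarrow> step G h v \<le> h v" "\<And>v. v \<in> U \<Longrightarrow> f v \<le> h v" "v \<in> verts G"
  shows "extension G U f v \<le> h v"
proof -
  have "(step G ^^ n) (restr U f) v \<le> h v" for n
    using assms(3)
  proof (induction n arbitrary: v)
    case 0 then show ?case using assms(2) by (simp add: restr_def)
  next
    case (Suc n)
    have "step G ((step G ^^ n) (restr U f)) v \<le> step G h v"
      using Suc.IH by (intro step_mono) (auto simp: edge_def)
    then show ?case using assms(1)[OF Suc.prems] by simp
  qed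
  then show ?thesis unfolding extension_def by (rule SUP_least)
qed

lemma extension_least_harmonic:
  assumes "harmonic_on G (verts G) h" "\<And>v. v \<in> U \<Longrightarrow> f v \<le> h v" "v \<in> verts G"
  shows "extension G U f v \<le> h v"
  using assms by (intro extension_least) (auto simp: harmonic_on_def)

lemma extension_cong: "(\<And>v. v \<in> U \<Longrightarrow> f v = g v) \<Longrightarrow> extension G U f v = extension G U g v"
proof -
  assume "\<And>v. v \<in> U \<Longrightarrow> f v = g v"
  then have "restr U f = restr U g" by (auto simp: restr_def)
  then show ?thesis by (simp add: extension_def)
qed

lemma extension_cmult: "extension G U (\<lambda>v. c * f v) v = c * extension G U f v"
proof -
  have "(step G ^^ n) (restr U (\<lambda>v. c * f v)) = (\<lambda>v. c * (step G ^^ n) (restr U f) v)" for n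
    by (induction n) (auto simp: restr_def step_cmult)
  then show ?thesis by (simp add: extension_def SUP_mult_left_ennreal)
qed

subsection \<open>Regular functions and the cone\<close>

lemma K0_posD:
  assumes "a \<in> K0_pos G"
  shows "finite {v. a v \<noteq> 0}" "a v \<noteq> 0 \<Longrightarrow> v \<in> verts G" "0 \<le> a v"
  using assms by (auto simp: K0_pos_def K0_vec_def)

lemma K0_pos_add:
  assumes "a \<in> K0_pos G" "b \<in> K0_pos G" shows "(\<lambda>v. a v + b v) \<in> K0_pos G"
proof -
  have "{v. a v + b v \<noteq> 0} \<subseteq> {v. a v \<noteq> 0} \<union> {v. b v \<noteq> 0}" by auto
  then show ?thesis
    using assms by (auto simp: K0_pos_def K0_vec_def intro: finite_subset)
qed

lemma K0_ext_add:
  assumes "a \<in> K0_pos G" "b \<in> K0_pos G"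
  shows "K0_ext G \<phi> (\<lambda>v. a v + b v) = K0_ext G \<phi> a + K0_ext G \<phi> b"
proof -
  define S where "S = {v. a v \<noteq> 0} \<union> {v. b v \<noteq> 0}"
  have S: "finite S" using assms by (simp add: S_def K0_posD)
  have *: "K0_ext G \<phi> f = (\<Sum>v\<in>S. ennreal (f v) * \<phi> v)" if "{v. f v \<noteq> 0} \<subseteq> S" for f
    using K0_ext_superset[OF S that] .
  show ?thesis
    by (subst (1 2 3) *)
       (auto simp: S_def ennreal_plus K0_posD[OF assms(1)] K0_posD[OF assms(2)] distrib_right sum.distrib)
qed

lemma K0_null_add:
  assumes "f \<in> K0_null G" "g \<in> K0_null G" shows "(\<lambda>w. f w + g w) \<in> K0_null G"
proof -
  obtain A c where A: "finite A" "A \<subseteq> verts G" "f = (\<lambda>w. \<Sum>v\<in>A. c v * K0_rel G v w)"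
    using assms(1) unfolding K0_null_def by blast
  obtain B d where B: "finite B" "B \<subseteq> verts G" "g = (\<lambda>w. \<Sum>v\<in>B. d v * K0_rel G v w)"
    using assms(2) unfolding K0_null_def by blast
  define e where "e v = (if v \<in> A then c v else 0) + (if v \<in> B then d v else 0)" for v
  have f: "f w = (\<Sum>v\<in>A \<union> B. (if v \<in> A then c v else 0) * K0_rel G v w)" for w
    unfolding A(3) using A(1) B(1) by (intro sum.mono_neutral_cong_left) auto
  have g: "g w = (\<Sum>v\<in>A \<union> B. (if v \<in> B then d v else 0) * K0_rel G v w)" for w
    unfolding B(3) using A(1) B(1) by (intro sum.mono_neutral_cong_left) auto
  have "(\<lambda>w. f w + g w) = (\<lambda>w. \<Sum>v\<in>A \<union> B. e v * K0_rel G v w)"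
    by (simp add: f g e_def distrib_right sum.distrib)
  then show ?thesis
    unfolding K0_null_def using A B by blast
qed

lemma K0_null_zero: "(\<lambda>w. 0) \<in> K0_null G"
  unfolding K0_null_def by (rule CollectI, rule exI[of _ "{}"]) auto

text \<open>\<open>K0_ext_cong\<close> allows \<open>a\<close> to be replaced by
  \<open>b + c\<close>, and \<open>K0_ext\<close> is additive.\<close>

lemma (in graded_graph) K0_ext_mono:
  assumes "harmonic G \<phi>" "a \<in> K0_pos G" "b \<in> K0_pos G" "K0_le G b a"
  shows "K0_ext G \<phi> b \<le> K0_ext G \<phi> a"
proof -
  obtain c where c: "c \<in> K0_pos G" "K0_eq G (\<lambda>v. a v - b v) c"
    using assms(4) by (auto simp: K0_le_def)
  have "K0_eq G a (\<lambda>v. b v + c v)"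
    using c(2) by (simp add: K0_eq_def algebra_simps)
  then have "K0_ext G \<phi> a = K0_ext G \<phi> b + K0_ext G \<phi> c"
    using K0_ext_cong[OF assms(1) assms(2) K0_pos_add[OF assms(3) c(1)]]
      K0_ext_add[OF assms(3) c(1)] by simp
  then show ?thesis by simp
qed

text \<open>Replacing all vertices of \<open>a\<close> at once by their successors is the adjoint of
  \<open>step\<close>. The identity is stated for arbitrary \<open>h\<close> because it is applied
  to iterates of a zero extension, which are not harmonic.\<close>

lemma (in graded_graph) K0_push_all:
  assumes "a \<in> K0_pos G"
  obtains a' where "a' \<in> K0_pos G" "K0_eq G a a'" "\<And>h. K0_ext G h a' = K0_ext G (step G h) a"
proof
  define m where "m v w = (if edge G v w then kappa G v w else 0)" for v w
  define A where "A = {v. a v \<noteq> 0}"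
  define S where "S = (\<Union>v\<in>A. {w. edge G v w})"
  define a' where "a' w = (\<Sum>v\<in>A. a v * m v w)" for w
  have A: "finite A" "A \<subseteq> verts G" using K0_posD[OF assms] by (auto simp: A_def)
  have S: "finite S" "S \<subseteq> verts G" using A finite_edges by (auto simp: S_def edge_def)
  have m0: "0 \<le> m v w" for v w using kappa_pos[of v w] by (auto simp: m_def)
  have a0: "0 \<le> a v" for v by (rule K0_posD[OF assms])
  have sub: "{w. a' w \<noteq> 0} \<subseteq> S"
  proof
    fix w assume "w \<in> {w. a' w \<noteq> 0}"
    then obtain v where "v \<in> A" "a v * m v w \<noteq> 0"
      unfolding a'_def by (auto elim: sum.not_neutral_contains_not_neutral)
    then show "w \<in> S" by (auto simp: S_def m_def split: if_splits)
  qed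
  show "a' \<in> K0_pos G"
    using finite_subset[OF sub S(1)] sub S(2) a0 m0
    by (auto simp: K0_pos_def K0_vec_def a'_def intro!: sum_nonneg)
  have "a w - a' w = (\<Sum>v\<in>A. a v * K0_rel G v w)" for w
  proof -
    have "(\<Sum>v\<in>A. a v * of_bool (w = v)) = a w"
      using A(1) by (simp add: A_def sum.delta' of_bool_def if_distrib cong: if_cong)
    then show ?thesis
      by (simp add: K0_rel_def a'_def m_def right_diff_distrib sum_subtractf)
  qed
  then show "K0_eq G a a'"
    unfolding K0_eq_def K0_null_def using A by (intro CollectI exI[of _ A] exI[of _ a]) auto
  fix h
  have inner: "(\<Sum>w\<in>S. ennreal (m v w) * h w) = step G h v" if "v \<in> A" for v
    unfolding step_def using S that
    by (intro sum.mono_neutral_cong_right) (auto simp: S_def m_def)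
  have a'_eq: "ennreal (a' w) = (\<Sum>v\<in>A. ennreal (a v) * ennreal (m v w))" for w
    unfolding a'_def by (subst sum_ennreal[symmetric]) (auto simp: a0 m0 ennreal_mult)
  have "K0_ext G h a' = (\<Sum>w\<in>S. ennreal (a' w) * h w)"
    by (rule K0_ext_superset[OF S(1) sub])
  also have "\<dots> = (\<Sum>w\<in>S. \<Sum>v\<in>A. ennreal (a v) * (ennreal (m v w) * h w))"
    by (simp add: a'_eq sum_distrib_right mult.assoc)
  also have "\<dots> = (\<Sum>v\<in>A. ennreal (a v) * step G h v)"
    by (subst sum.swap) (simp add: inner flip: sum_distrib_left)
  finally show "K0_ext G h a' = K0_ext G (step G h) a"
    by (simp add: K0_ext_def A_def)
qed

text \<open>Push \<open>a\<close> up \<open>n\<close> times, then discard the vertices outside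
  \<open>D\<close>. The iterates that define \<open>extension\<close> are thus values of
  \<open>\<phi>\<close> at cone elements below \<open>a\<close>.\<close>

lemma (in graded_graph) K0_truncation:
  assumes "a \<in> K0_pos G"
  shows "\<exists>b\<in>K0_pos G. K0_le G b a \<and> {v. b v \<noteq> 0} \<subseteq> D \<and>
    K0_ext G \<phi> b = K0_ext G ((step G ^^ n) (restr D \<phi>)) a"
  using assms
proof (induction n arbitrary: a)
  case 0
  define b c where "b v = (if v \<in> D then a v else 0)" and "c v = (if v \<in> D then 0 else a v)" for v
  have "{v. b v \<noteq> 0} \<subseteq> {v. a v \<noteq> 0}" "{v. c v \<noteq> 0} \<subseteq> {v. a v \<noteq> 0}"
    by (auto simp: b_def c_def)
  then have bc: "b \<in> K0_pos G" "c \<in> K0_pos G" and fin: "finite {v. a v \<noteq> 0}"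
    using 0 by (auto simp: K0_pos_def K0_vec_def b_def c_def intro: finite_subset)
  have bD: "{v. b v \<noteq> 0} \<subseteq> D" by (auto simp: b_def split: if_splits)
  have "(\<lambda>v. a v - b v - c v) = (\<lambda>v. 0)" by (auto simp: b_def c_def)
  then have "K0_le G b a"
    unfolding K0_le_def K0_eq_def using bc(2) K0_null_zero by (intro bexI[of _ c]) simp_all
  moreover have "K0_ext G \<phi> b = K0_ext G (restr D \<phi>) a"
    using fin unfolding K0_ext_def
    by (intro sum.mono_neutral_cong_left) (auto simp: b_def restr_def split: if_splits)
  ultimately show ?case
    using bc(1) bD by auto
next
  case (Suc n)
  obtain a' where a': "a' \<in> K0_pos G" "K0_eq G a a'"
    "\<And>h. K0_ext G h a' = K0_ext G (step G h) a"
    using K0_push_all[OF Suc.prems] by blast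
  obtain b c where b: "b \<in> K0_pos G" "{v. b v \<noteq> 0} \<subseteq> D"
    "K0_ext G \<phi> b = K0_ext G ((step G ^^ n) (restr D \<phi>)) a'"
    and c: "c \<in> K0_pos G" "K0_eq G (\<lambda>v. a' v - b v) c"
    using Suc.IH[OF a'(1)] by (auto simp: K0_le_def)
  have "K0_eq G (\<lambda>v. a v - b v) c"
    using K0_null_add[OF a'(2)[unfolded K0_eq_def] c(2)[unfolded K0_eq_def]]
    by (simp add: K0_eq_def algebra_simps)
  then show ?case
    using b c(1) a'(3) by (intro bexI[of _ b]) (auto simp: K0_le_def)
qed

lemma (in graded_graph) K0_ext_extension:
  assumes "upclosed G U" "harmonic_on G U f"
  shows "K0_ext G (extension G U f) a = (SUP n. K0_ext G ((step G ^^ n) (restr U f)) a)"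
  unfolding K0_ext_def extension_def SUP_mult_left_ennreal
  by (rule ennreal_SUP_sum[symmetric])
     (use incseq_step_pow[OF assms] in \<open>auto simp: incseq_def intro!: mult_left_mono\<close>)

lemma K0_ext_vertex: "K0_ext G \<phi> (\<lambda>w. of_bool (w = v)) = \<phi> v"
  by (simp add: K0_ext_def)

lemma K0_pos_vertex: "v \<in> verts G \<Longrightarrow> (\<lambda>w. of_bool (w = v)) \<in> K0_pos G"
  by (auto simp: K0_pos_def K0_vec_def)

lemma (in graded_graph) harmonic_on_ideal:
  "harmonic G \<phi> \<Longrightarrow> harmonic_on G (finiteness_ideal G \<phi>) \<phi>"
  by (simp add: harmonic_iff harmonic_on_def finiteness_ideal_def)

lemma (in graded_graph) extension_ideal_le:
  assumes "harmonic G \<phi>" "v \<in> verts G"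
  shows "extension G (finiteness_ideal G \<phi>) \<phi> v \<le> \<phi> v"
  using assms by (intro extension_least_harmonic) (auto simp: harmonic_iff)

text \<open>Truncated pushes of \<open>a\<close> have finite value and approximate the extension
  from below, so regularity gives the supremum formula. Conversely an element of finite value is
  supported on the ideal, where \<open>\<phi>\<close> and its extension agree, so the formula at a
  single vertex bounds \<open>\<phi>\<close> by the extension.\<close>

lemma (in graded_graph) regular_iff:
  "regular G \<phi> \<longleftrightarrow> finite_harmonic G \<phi> \<or> semifinite_harmonic G \<phi>"
proof
  assume reg: "regular G \<phi>"
  then have h: "harmonic G \<phi>" by (simp add: regular_def)
  define D where "D = finiteness_ideal G \<phi>"
  have D: "upclosed G D" "harmonic_on G D \<phi>"
    unfolding D_def using h upclosed_finiteness_ideal harmonic_on_ideal by auto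
  have "K0_ext G \<phi> a = Sup {K0_ext G \<phi> b | b. b \<in> K0_pos G \<and> K0_le G b a \<and> K0_ext G \<phi> b < \<infinity>}"
    (is "_ = Sup ?S") if a: "a \<in> K0_pos G" for a
  proof (rule antisym)
    have "K0_ext G \<phi> a = K0_ext G (extension G D \<phi>) a"
      unfolding K0_ext_def
      using reg K0_posD[OF a] by (intro sum.cong) (auto simp: regular_def D_def)
    also have "\<dots> = (SUP n. K0_ext G ((step G ^^ n) (restr D \<phi>)) a)"
      by (rule K0_ext_extension[OF D])
    also have "\<dots> \<le> Sup ?S"
    proof (rule SUP_least)
      fix n
      obtain b where b: "b \<in> K0_pos G" "K0_le G b a" "{v. b v \<noteq> 0} \<subseteq> D"
        "K0_ext G \<phi> b = K0_ext G ((step G ^^ n) (restr D \<phi>)) a"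
        using K0_truncation[OF a] by blast
      have "K0_ext G \<phi> b < \<infinity>"
        using K0_posD(1)[OF b(1)] b(3)
        by (auto simp: K0_ext_def D_def finiteness_ideal_def ennreal_mult_less_top)
      with b show "K0_ext G ((step G ^^ n) (restr D \<phi>)) a \<le> Sup ?S"
        by (intro Sup_upper) (metis (mono_tags, lifting) CollectI)
    qed
    finally show "K0_ext G \<phi> a \<le> Sup ?S" .
    show "Sup ?S \<le> K0_ext G \<phi> a"
      using K0_ext_mono[OF h a] by (intro Sup_least) blast
  qed
  with h show "finite_harmonic G \<phi> \<or> semifinite_harmonic G \<phi>"
    by (auto simp: finite_harmonic_def semifinite_harmonic_def)
next
  assume "finite_harmonic G \<phi> \<or> semifinite_harmonic G \<phi>"
  then show "regular G \<phi>"
  proof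
    assume fh: "finite_harmonic G \<phi>"
    then have "finiteness_ideal G \<phi> = verts G"
      by (auto simp: finite_harmonic_def finite_valued_def finiteness_ideal_def)
    with fh show ?thesis
      using extension_on[OF upclosed_verts, of G \<phi>]
      by (auto simp: regular_def finite_harmonic_def harmonic_iff)
  next
    assume sf: "semifinite_harmonic G \<phi>"
    then have h: "harmonic G \<phi>" by (simp add: semifinite_harmonic_def)
    define D where "D = finiteness_ideal G \<phi>"
    have D: "upclosed G D" "harmonic_on G D \<phi>"
      unfolding D_def using h upclosed_finiteness_ideal harmonic_on_ideal by auto
    have "\<phi> v \<le> extension G D \<phi> v" if v: "v \<in> verts G" for v
    proof -
      let ?e = "\<lambda>w. of_bool (w = v) :: real"
      have "\<phi> v = Sup {K0_ext G \<phi> b | b. b \<in> K0_pos G \<and> K0_le G b ?e \<and> K0_ext G \<phi> b < \<infinity>}"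
        using sf K0_pos_vertex[OF v] K0_ext_vertex[of G \<phi> v]
        by (auto simp: semifinite_harmonic_def)
      also have "\<dots> \<le> extension G D \<phi> v"
      proof (rule Sup_least, safe)
        fix b assume b: "b \<in> K0_pos G" "K0_le G b ?e" "K0_ext G \<phi> b < \<infinity>"
        have "K0_ext G \<phi> b = K0_ext G (extension G D \<phi>) b"
          unfolding K0_ext_def
        proof (rule sum.cong)
          fix w assume "w \<in> {v. b v \<noteq> 0}"
          then have w: "w \<in> verts G" "0 < b w"
            using K0_posD[OF b(1)] by (auto simp: less_le)
          have "ennreal (b w) * \<phi> w \<le> K0_ext G \<phi> b"
            unfolding K0_ext_def using w K0_posD(1)[OF b(1)] by (intro member_le_sum) auto
          then have "ennreal (b w) * \<phi> w < \<infinity>" using b(3) by (rule le_less_trans)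
          then have "w \<in> D"
            using w by (auto simp: D_def finiteness_ideal_def ennreal_mult_less_top)
          then show "ennreal (b w) * \<phi> w = ennreal (b w) * extension G D \<phi> w"
            by (simp add: extension_on[OF D])
        qed simp
        also have "\<dots> \<le> K0_ext G (extension G D \<phi>) ?e"
          using K0_pos_vertex[OF v] b extension_harmonic[OF D]
          by (intro K0_ext_mono) (auto simp: harmonic_iff)
        finally show "K0_ext G \<phi> b \<le> extension G D \<phi> v" by (simp add: K0_ext_vertex)
      qed
      finally show ?thesis .
    qed
    then show ?thesis
      unfolding regular_def D_def using h extension_ideal_le[OF h] by (auto intro: antisym)
  qed
qed

subsection \<open>Indecomposable functions\<close>

text \<open>The finiteness ideal of the extension may be larger than \<open>D\<close>; as it
  contains \<open>D\<close>, minimality of the extension from \<open>D\<close> gives the nontrivial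
  inequality.\<close>

lemma (in graded_graph) regular_extension:
  assumes "upclosed G D" "harmonic_on G D g" "\<And>v. v \<in> D \<Longrightarrow> g v < \<infinity>"
  shows "regular G (extension G D g)"
proof -
  let ?e = "extension G D g"
  have h: "harmonic G ?e" using extension_harmonic[OF assms(1,2)] by (simp add: harmonic_iff)
  have "?e v = extension G (finiteness_ideal G ?e) ?e v" if v: "v \<in> verts G" for v
  proof (rule antisym)
    have "g w \<le> extension G (finiteness_ideal G ?e) ?e w" if "w \<in> D" for w
    proof -
      have "w \<in> finiteness_ideal G ?e"
        using that assms(3) upclosed_subset[OF assms(1)] extension_on[OF assms(1,2)]
        by (auto simp: finiteness_ideal_def)
      then show ?thesis
        using that extension_on[OF assms(1,2)]
          extension_on[OF upclosed_finiteness_ideal[OF h] harmonic_on_ideal[OF h]] by simp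
    qed
    then show "?e v \<le> extension G (finiteness_ideal G ?e) ?e v"
      using v extension_harmonic[OF upclosed_finiteness_ideal[OF h] harmonic_on_ideal[OF h]]
      by (intro extension_least_harmonic)
  qed (use extension_ideal_le[OF h v] in simp)
  with h show ?thesis by (simp add: regular_def)
qed

text \<open>A competitor \<open>g\<close> that lives only on the ideal becomes a regular one by
  extension, and it stays below \<open>\<phi>\<close> because the extension is least. Competitors
  vanishing on the ideal, which \<open>indecomposable\<close> leaves out, get the constant
  0.\<close>

lemma (in graded_graph) indecomposable_iff:
  assumes reg: "regular G \<phi>"
  shows "indecomposable G \<phi> \<longleftrightarrow> extremal_on G (finiteness_ideal G \<phi>) \<phi>"
proof -
  define D where "D = finiteness_ideal G \<phi>"
  have h: "harmonic G \<phi>" using reg by (simp add: regular_def)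
  have D: "upclosed G D" "harmonic_on G D \<phi>" and Dfin: "v \<in> D \<Longrightarrow> \<phi> v < \<infinity>" for v
    unfolding D_def using h upclosed_finiteness_ideal harmonic_on_ideal
    by (auto simp: finiteness_ideal_def)
  have "indecomposable G \<phi> \<longleftrightarrow> (\<forall>\<phi>'. regular G \<phi>' \<and> (\<forall>v\<in>verts G. \<phi>' v \<le> \<phi> v) \<and> (\<exists>v\<in>D. \<phi>' v \<noteq> 0)
      \<longrightarrow> (\<exists>c\<ge>0. \<forall>v\<in>D. \<phi>' v = ennreal c * \<phi> v))"
    by (simp add: indecomposable_def regular_iff D_def)
  also have "\<dots> \<longleftrightarrow> extremal_on G D \<phi>"
  proof
    assume *: "\<forall>\<phi>'. regular G \<phi>' \<and> (\<forall>v\<in>verts G. \<phi>' v \<le> \<phi> v) \<and> (\<exists>v\<in>D. \<phi>' v \<noteq> 0)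
      \<longrightarrow> (\<exists>c\<ge>0. \<forall>v\<in>D. \<phi>' v = ennreal c * \<phi> v)"
    show "extremal_on G D \<phi>"
      unfolding extremal_on_def
    proof (intro conjI allI impI)
      fix g assume g: "harmonic_on G D g \<and> (\<forall>v\<in>D. g v \<le> \<phi> v)"
      show "\<exists>c\<ge>0. \<forall>v\<in>D. g v = ennreal c * \<phi> v"
      proof (cases "\<forall>v\<in>D. g v = 0")
        case True then show ?thesis by (intro exI[of _ 0]) auto
      next
        case False
        have eq: "extension G D g v = g v" if "v \<in> D" for v using extension_on[OF D(1), of g v] g that by simp
        have "regular G (extension G D g)"
          using D(1) g Dfin by (intro regular_extension) (auto intro: le_less_trans)
        moreover have "\<forall>v\<in>verts G. extension G D g v \<le> \<phi> v"
          using g h by (auto intro!: extension_least_harmonic simp: harmonic_iff)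
        ultimately show ?thesis
          using *[rule_format, of "extension G D g"] False eq by simp
      qed
    qed (use D Dfin in auto)
  next
    assume ex: "extremal_on G D \<phi>"
    show "\<forall>\<phi>'. regular G \<phi>' \<and> (\<forall>v\<in>verts G. \<phi>' v \<le> \<phi> v) \<and> (\<exists>v\<in>D. \<phi>' v \<noteq> 0)
      \<longrightarrow> (\<exists>c\<ge>0. \<forall>v\<in>D. \<phi>' v = ennreal c * \<phi> v)"
    proof (intro allI impI, elim conjE)
      fix \<phi>' assume "regular G \<phi>'" and le: "\<forall>v\<in>verts G. \<phi>' v \<le> \<phi> v"
      then have "harmonic_on G (verts G) \<phi>'" by (simp add: regular_def harmonic_iff)
      then have "harmonic_on G D \<phi>'" by (rule harmonic_on_subset[OF _ upclosed_subset[OF D(1)]])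
      then show "\<exists>c\<ge>0. \<forall>v\<in>D. \<phi>' v = ennreal c * \<phi> v"
        using ex le upclosed_subset[OF D(1)] unfolding extremal_on_def by (meson subsetD)
    qed
  qed
  finally show ?thesis by (simp add: D_def)
qed

text \<open>Working form of membership in \<open>H_ex\<close>: all data sit on one principal up-set,
  and on a product such a set is again a product. Finiteness of \<open>\<phi> p\<close> is contained
  in \<open>extremal_on\<close>.\<close>

definition determined_by :: "'a ggraph \<Rightarrow> ('a \<Rightarrow> ennreal) \<Rightarrow> 'a \<Rightarrow> bool" where
  "determined_by G \<phi> p \<longleftrightarrow> p \<in> verts G \<and> 0 < \<phi> p \<and> extremal_on G (upset G p) \<phi> \<and>
    (\<forall>v\<in>verts G. \<phi> v = extension G (upset G p) \<phi> v)"

text \<open>The delicate point is to pass from extremality on \<open>U\<close> to the larger ideal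
  \<open>D\<close>. A competitor \<open>g\<close> need not be the extension of its restriction to
  \<open>U\<close>, so only \<open>c * \<phi> \<le> g\<close> is immediate; the same argument for
  \<open>\<phi> - g\<close> with \<open>1 - c\<close> supplies the opposite inequality.\<close>

lemma (in graded_graph) determined_by_imp:
  assumes "determined_by G \<phi> p" 
  shows "regular G \<phi>" "indecomposable G \<phi>" "\<phi> \<in> H_ex G"
proof -
  define U where "U = upset G p"
  have p: "p \<in> verts G" "0 < \<phi> p" "p \<in> U" and ex: "extremal_on G U \<phi>"
    and eq: "\<And>v. v \<in> verts G \<Longrightarrow> \<phi> v = extension G U \<phi> v"
    using assms by (auto simp: determined_by_def U_def)
  have U: "upclosed G U" "harmonic_on G U \<phi>" "\<And>v. v \<in> U \<Longrightarrow> \<phi> v < \<infinity>"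
    using ex p upclosed_upset by (auto simp: extremal_on_def U_def)
  have h: "harmonic G \<phi>"
    unfolding harmonic_iff harmonic_on_def
  proof
    fix v assume v: "v \<in> verts G"
    have "step G \<phi> v = step G (extension G U \<phi>) v" by (intro step_cong eq) (auto simp: edge_def)
    then show "step G \<phi> v = \<phi> v" using extension_step[OF U(1,2)] eq v by simp
  qed
  define D where "D = finiteness_ideal G \<phi>"
  have D: "upclosed G D" "harmonic_on G D \<phi>" and Dfin: "v \<in> D \<Longrightarrow> \<phi> v < \<infinity>" for v
    unfolding D_def using h upclosed_finiteness_ideal harmonic_on_ideal
    by (auto simp: finiteness_ideal_def)
  have UD: "U \<subseteq> D"
    using U upclosed_subset[OF U(1)] by (auto simp: D_def finiteness_ideal_def)
  have DV: "D \<subseteq> verts G" using D(1) upclosed_subset by blast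
  have "\<phi> v \<le> extension G D \<phi> v" if "v \<in> verts G" for v
    unfolding eq[OF that]
    using UD extension_on[OF D] extension_harmonic[OF D] that by (intro extension_least_harmonic) auto
  with h extension_ideal_le[OF h] show reg: "regular G \<phi>"
    by (auto simp: regular_def D_def intro: antisym)
  \<comment> \<open>Lower bounds by a multiple of \<open>\<phi>\<close> spread from \<open>U\<close>
    to \<open>D\<close>, because \<open>\<phi>\<close> is the least harmonic function with its
    values on \<open>U\<close>.\<close>
  have lower: "ennreal c * \<phi> v \<le> g v"
    if "harmonic_on G D g" "v \<in> D" "\<And>w. w \<in> U \<Longrightarrow> ennreal c * \<phi> w \<le> g w" for c g v
  proof -
    have "ennreal c * \<phi> v = extension G U (\<lambda>w. ennreal c * \<phi> w) v"
      using eq[of v] that DV by (auto simp: extension_cmult)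
    also have "\<dots> \<le> extension G D g v"
      using that DV UD extension_on[OF D(1) that(1)] extension_harmonic[OF D(1) that(1)]
      by (intro extension_least_harmonic) auto
    also have "\<dots> = g v" using extension_on[OF D(1) that(1)] that by simp
    finally show ?thesis .
  qed
  have "extremal_on G D \<phi>"
    unfolding extremal_on_def
  proof (intro conjI allI impI)
    fix g assume g: "harmonic_on G D g \<and> (\<forall>v\<in>D. g v \<le> \<phi> v)"
    then have gfin: "g v < \<infinity>" if "v \<in> D" for v using Dfin that by (auto intro: le_less_trans)
    obtain c where c: "c \<ge> 0" "\<And>v. v \<in> U \<Longrightarrow> g v = ennreal c * \<phi> v"
      using ex g UD harmonic_on_subset[of G D g U] unfolding extremal_on_def by (metis subsetD)
    \<comment> \<open>Since \<open>0 < \<phi> p < \<infinity>\<close>, the value at \<open>p\<close>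
      can be cancelled; the bound makes \<open>1 - c\<close> a legitimate coefficient.\<close>
    have c1: "c \<le> 1"
    proof -
      have "ennreal c * \<phi> p \<le> 1 * \<phi> p" using c(2)[of p] g p subsetD[OF UD p(3)] by fastforce
      then have "ennreal c \<le> 1" using p U(3)[of p]
        by (metis ennreal_mult_le_mult_iff infinity_ennreal_def less_irrefl mult.commute)
      then show ?thesis using c(1) by simp
    qed
    have split: "ennreal c * x + ennreal (1 - c) * x = x" for x
      using c(1) c1 by (simp flip: distrib_right ennreal_plus)
    define g' where "g' v = \<phi> v - g v" for v
    have sum: "g v + g' v = \<phi> v" if "v \<in> D" for v
      using g that by (simp add: g'_def add_diff_inverse_ennreal)
    have "harmonic_on G D g'"
      unfolding harmonic_on_def
    proof
      fix v assume v: "v \<in> D"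
      have "step G g v + step G g' v = step G \<phi> v"
        unfolding step_add[symmetric] using sum upclosedD[OF D(1) v] by (intro step_cong) auto
      then have "g v + step G g' v = g v + g' v"
        using D(2) g v sum by (simp add: harmonic_on_def)
      then show "step G g' v = g' v"
        using gfin[OF v] by (auto simp: ennreal_add_left_cancel)
    qed
    moreover have "ennreal (1 - c) * \<phi> w \<le> g' w" if "w \<in> U" for w
    proof -
      have "ennreal c * \<phi> w + ennreal (1 - c) * \<phi> w = g w + g' w"
        using sum[of w] that UD by (auto simp: split)
      also have "\<dots> = ennreal c * \<phi> w + g' w" using c that by simp
      finally show ?thesis
        using gfin[of w] c that UD by (auto simp: ennreal_add_left_cancel)
    qed
    ultimately have g': "ennreal (1 - c) * \<phi> v \<le> g' v" if "v \<in> D" for v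
      using lower that by blast
    have "g v = ennreal c * \<phi> v" if v: "v \<in> D" for v
    proof (rule antisym)
      show "ennreal c * \<phi> v \<le> g v" using lower[of g v c] g v c by auto
      have "g v + ennreal (1 - c) * \<phi> v \<le> g v + g' v" using g'[OF v] by (rule add_left_mono)
      also have "\<dots> = ennreal c * \<phi> v + ennreal (1 - c) * \<phi> v"
        using sum[OF v] by (simp add: split)
      finally have "ennreal (1 - c) * \<phi> v + g v \<le> ennreal (1 - c) * \<phi> v + ennreal c * \<phi> v"
        by (simp add: add.commute)
      then show "g v \<le> ennreal c * \<phi> v"
        using Dfin[OF v] by (auto simp: ennreal_add_left_cancel_le ennreal_mult_eq_top_iff)
    qed
    with c(1) show "\<exists>c\<ge>0. \<forall>v\<in>D. g v = ennreal c * \<phi> v" by blast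
  qed (use D Dfin in auto)
  then show ind: "indecomposable G \<phi>" using indecomposable_iff[OF reg] by (simp add: D_def)
  show "\<phi> \<in> H_ex G"
    using reg ind p unfolding H_ex_def regular_iff by (auto intro!: bexI[of _ p])
qed

text \<open>Any vertex of the ideal where \<open>\<phi>\<close> is nonzero serves as
  \<open>p\<close>; one exists because a regular function vanishing on its ideal is zero. The
  extension of \<open>\<phi>\<close> from the up-set of \<open>p\<close> is a competitor to
  \<open>\<phi>\<close>, hence a multiple of it on the ideal, and the value at \<open>p\<close>
  shows the factor to be 1.\<close>

lemma (in graded_graph) H_ex_determined_by:
  assumes "\<phi> \<in> H_ex G"
  obtains p where "determined_by G \<phi> p"
proof -
  have reg: "regular G \<phi>" and ind: "indecomposable G \<phi>"
    using assms by (auto simp: H_ex_def regular_iff)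
  define D where "D = finiteness_ideal G \<phi>"
  have h: "harmonic G \<phi>" using reg by (simp add: regular_def)
  have D: "upclosed G D" "harmonic_on G D \<phi>" and Dfin: "v \<in> D \<Longrightarrow> \<phi> v < \<infinity>" for v
    unfolding D_def using h upclosed_finiteness_ideal harmonic_on_ideal
    by (auto simp: finiteness_ideal_def)
  have ex: "extremal_on G D \<phi>" using indecomposable_iff[OF reg] ind by (simp add: D_def)
  have eqD: "\<phi> v = extension G D \<phi> v" if "v \<in> verts G" for v
    using reg that by (simp add: regular_def D_def)
  have "\<exists>p\<in>D. \<phi> p \<noteq> 0"
  proof (rule ccontr)
    assume "\<not> ?thesis"
    then have "\<phi> v \<le> 0" if "v \<in> verts G" for v
      unfolding eqD[OF that] using that by (intro extension_least) (auto simp: step_zero)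
    then show False
      using assms by (auto simp: H_ex_def semifinite_harmonic_def finite_valued_def)
  qed
  then obtain p where p: "p \<in> D" "\<phi> p \<noteq> 0" by blast
  define U where "U = upset G p"
  have DV: "D \<subseteq> verts G" using D(1) upclosed_subset by blast
  have UD: "U \<subseteq> D" unfolding U_def by (rule upset_subset[OF D(1) p(1)])
  have pU: "p \<in> U" by (simp add: U_def)
  have U: "upclosed G U" "harmonic_on G U \<phi>"
    using upclosed_upset[of p G] p DV harmonic_on_subset[OF D(2) UD] by (auto simp: U_def)
  have below: "extension G U g v \<le> \<phi> v" if "\<And>w. w \<in> U \<Longrightarrow> g w \<le> \<phi> w" "v \<in> verts G" for g v
    using h that by (intro extension_least_harmonic) (auto simp: harmonic_iff)
  have proportional: "\<exists>c\<ge>0. \<forall>v\<in>D. extension G U g v = ennreal c * \<phi> v"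
    if "harmonic_on G U g" "\<And>w. w \<in> U \<Longrightarrow> g w \<le> \<phi> w" for g
    using ex extension_harmonic[OF U(1) that(1)] below[OF that(2)] DV
    unfolding extremal_on_def by (metis subsetD)
  obtain c where c: "c \<ge> 0" "\<And>v. v \<in> D \<Longrightarrow> extension G U \<phi> v = ennreal c * \<phi> v"
    using proportional[OF U(2)] by auto
  have "\<phi> p * ennreal c = \<phi> p * 1"
    using c(2)[OF p(1)] extension_on[OF U pU] by (simp add: mult.commute)
  then have "ennreal c = 1"
    using p(2) Dfin[OF p(1)] unfolding ennreal_mult_cancel_left by auto
  then have eq: "extension G U \<phi> v = \<phi> v" if "v \<in> D" for v
    using c(2)[OF that] by simp
  have "\<phi> v \<le> extension G U \<phi> v" if "v \<in> verts G" for v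
    unfolding eqD[OF that] using eq extension_harmonic[OF U] that by (intro extension_least_harmonic) auto
  then have "\<forall>v\<in>verts G. \<phi> v = extension G U \<phi> v"
    using below[of \<phi>] by (auto intro: antisym)
  moreover have "extremal_on G U \<phi>"
    unfolding extremal_on_def
  proof (intro conjI allI impI)
    fix g assume g: "harmonic_on G U g \<and> (\<forall>v\<in>U. g v \<le> \<phi> v)"
    then obtain c where c: "c \<ge> 0" "\<And>v. v \<in> D \<Longrightarrow> extension G U g v = ennreal c * \<phi> v"
      using proportional[of g] by auto
    have "g v = ennreal c * \<phi> v" if "v \<in> U" for v
      using that UD extension_on[OF U(1), of g v] g c(2)[of v] by auto
    with c(1) show "\<exists>c\<ge>0. \<forall>v\<in>U. g v = ennreal c * \<phi> v" by blast
  qed (use U UD Dfin in auto)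
  ultimately show thesis
    using p DV that[of p] by (auto simp: determined_by_def U_def zero_less_iff_neq_zero)
qed

lemma (in graded_graph) H_ex_harmonic: "\<phi> \<in> H_ex G \<Longrightarrow> harmonic G \<phi>"
  by (auto simp: H_ex_def finite_harmonic_def semifinite_harmonic_def)

subsection \<open>Direct products\<close>

definition step1 :: "'a ggraph \<Rightarrow> ('a \<times> 'b \<Rightarrow> ennreal) \<Rightarrow> 'a \<times> 'b \<Rightarrow> ennreal" where
  "step1 G f v = step G (\<lambda>l. f (l, snd v)) (fst v)"

definition step2 :: "'b ggraph \<Rightarrow> ('a \<times> 'b \<Rightarrow> ennreal) \<Rightarrow> 'a \<times> 'b \<Rightarrow> ennreal" where
  "step2 G f v = step G (\<lambda>m. f (fst v, m)) (snd v)"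

text \<open>The weight that translates between functions harmonic in each variable and joint
  eigenfunctions of \<open>step1\<close> and \<open>step2\<close>; the weight with
  \<open>1 / a\<close> and \<open>1 / b\<close> undoes it.\<close>

definition tilt :: "'a ggraph \<Rightarrow> 'b ggraph \<Rightarrow> real \<Rightarrow> real \<Rightarrow> 'a \<times> 'b \<Rightarrow> ennreal" where
  "tilt G1 G2 a b v = ennreal (a ^ grade G1 (fst v) * b ^ grade G2 (snd v))"

definition biharmonic_on :: "'a ggraph \<Rightarrow> 'b ggraph \<Rightarrow> ('a \<times> 'b) set \<Rightarrow> ('a \<times> 'b \<Rightarrow> ennreal) \<Rightarrow> bool" where
  "biharmonic_on G1 G2 U F \<longleftrightarrow> (\<forall>v\<in>U. step1 G1 F v = F v \<and> step2 G2 F v = F v)"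

definition biextremal_on :: "'a ggraph \<Rightarrow> 'b ggraph \<Rightarrow> ('a \<times> 'b) set \<Rightarrow> ('a \<times> 'b \<Rightarrow> ennreal) \<Rightarrow> bool" where
  "biextremal_on G1 G2 U F \<longleftrightarrow> biharmonic_on G1 G2 U F \<and> (\<forall>v\<in>U. F v < \<infinity>) \<and>
    (\<forall>H. biharmonic_on G1 G2 U H \<and> (\<forall>v\<in>U. H v \<le> F v) \<longrightarrow>
      (\<exists>c\<ge>0. \<forall>v\<in>U. H v = ennreal c * F v))"

lemma edge_prod:
  "edge (ggraph_prod G1 G2) (l, m) (l', m') \<longleftrightarrow>
    edge G1 l l' \<and> m' = m \<and> m \<in> verts G2 \<or> l' = l \<and> l \<in> verts G1 \<and> edge G2 m m'"
  by (auto simp: edge_def)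

lemma upclosed_prod:
  "upclosed G1 U1 \<Longrightarrow> upclosed G2 U2 \<Longrightarrow> upclosed (ggraph_prod G1 G2) (U1 \<times> U2)"
  by (auto simp: upclosed_def edge_prod)

text \<open>A path can first bring the first coordinate to its goal and then the second.\<close>

lemma upset_prod:
  assumes "p \<in> verts G1" "q \<in> verts G2"
  shows "upset (ggraph_prod G1 G2) (p, q) = upset G1 p \<times> upset G2 q"
proof
  show "upset (ggraph_prod G1 G2) (p, q) \<subseteq> upset G1 p \<times> upset G2 q"
    using assms by (intro upset_subset upclosed_prod upclosed_upset) auto
  have 1: "(edge (ggraph_prod G1 G2))\<^sup>*\<^sup>* (p, q) (l, q)" if "(edge G1)\<^sup>*\<^sup>* p l" for l
    using that
    by (induction rule: rtranclp_induct)
       (blast, erule rtranclp.rtrancl_into_rtrancl, simp add: edge_prod assms)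
  have 2: "(edge (ggraph_prod G1 G2))\<^sup>*\<^sup>* (l, q) (l, m)" if "(edge G2)\<^sup>*\<^sup>* q m" "l \<in> verts G1" for l m
    using that(1)
    by (induction rule: rtranclp_induct)
       (blast, erule rtranclp.rtrancl_into_rtrancl, simp add: edge_prod that(2))
  show "upset G1 p \<times> upset G2 q \<subseteq> upset (ggraph_prod G1 G2) (p, q)"
  proof safe
    fix l m assume "l \<in> upset G1 p" "m \<in> upset G2 q"
    moreover have "l \<in> verts G1"
      using upclosed_subset[OF upclosed_upset[OF assms(1)]] \<open>l \<in> upset G1 p\<close> by auto
    ultimately show "(l, m) \<in> upset (ggraph_prod G1 G2) (p, q)"
      using 1[of l] 2[of m l] by (auto simp: upset_def)
  qed
qed

lemma step_commute: "step1 G1 (step2 G2 f) v = step2 G2 (step1 G1 f) v"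
proof -
  have "step1 G1 (step2 G2 f) v = (\<Sum>l | edge G1 (fst v) l. \<Sum>m | edge G2 (snd v) m.
      ennreal (kappa G1 (fst v) l) * (ennreal (kappa G2 (snd v) m) * f (l, m)))"
    by (simp add: step1_def step2_def step_def sum_distrib_left)
  also have "\<dots> = (\<Sum>m | edge G2 (snd v) m. \<Sum>l | edge G1 (fst v) l.
      ennreal (kappa G2 (snd v) m) * (ennreal (kappa G1 (fst v) l) * f (l, m)))"
    by (subst sum.swap) (simp add: mult.left_commute)
  also have "\<dots> = step2 G2 (step1 G1 f) v"
    by (simp add: step1_def step2_def step_def sum_distrib_left)
  finally show ?thesis .
qed

lemma step1_cong: "(\<And>l. edge G (fst v) l \<Longrightarrow> f (l, snd v) = g (l, snd v)) \<Longrightarrow> step1 G f v = step1 G g v"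
  unfolding step1_def by (rule step_cong)

lemma step2_cong: "(\<And>m. edge G (snd v) m \<Longrightarrow> f (fst v, m) = g (fst v, m)) \<Longrightarrow> step2 G f v = step2 G g v"
  unfolding step2_def by (rule step_cong)

text \<open>Each edge of \<open>G1\<close> raises the grade by one and so contributes exactly one
  factor \<open>a\<close>.\<close>

lemma step1_tilt:
  assumes "0 \<le> a" "0 \<le> b"
  shows "step1 G1 (\<lambda>v. tilt G1 G2 a b v * F v) v = ennreal a * (tilt G1 G2 a b v * step1 G1 F v)"
proof -
  have "step1 G1 (\<lambda>v. tilt G1 G2 a b v * F v) v = step1 G1 (\<lambda>w. (ennreal a * tilt G1 G2 a b v) * F w) v"
    using assms by (intro step1_cong) (auto simp: tilt_def edge_def mult_ac simp flip: ennreal_mult)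
  then show ?thesis by (simp add: step1_def step_cmult mult.assoc)
qed

lemma step2_tilt:
  assumes "0 \<le> a" "0 \<le> b"
  shows "step2 G2 (\<lambda>v. tilt G1 G2 a b v * F v) v = ennreal b * (tilt G1 G2 a b v * step2 G2 F v)"
proof -
  have "step2 G2 (\<lambda>v. tilt G1 G2 a b v * F v) v = step2 G2 (\<lambda>w. (ennreal b * tilt G1 G2 a b v) * F w) v"
    using assms by (intro step2_cong) (auto simp: tilt_def edge_def mult_ac simp flip: ennreal_mult)
  then show ?thesis by (simp add: step2_def step_cmult mult.assoc)
qed

lemma tilt_pos_finite:
  assumes "0 < a" "0 < b" shows "tilt G1 G2 a b v \<noteq> 0" "tilt G1 G2 a b v \<noteq> top"
  using assms by (auto simp: tilt_def)

lemma tilt_inverse: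
  assumes "0 < a" "0 < b"
  shows "tilt G1 G2 a b v * (tilt G1 G2 (1 / a) (1 / b) v * x) = x"
proof -
  have "tilt G1 G2 a b v * tilt G1 G2 (1 / a) (1 / b) v = 1"
    using assms by (simp add: tilt_def power_divide flip: ennreal_mult)
  then show ?thesis by (simp flip: mult.assoc)
qed

text \<open>The degenerate quotients \<open>0 / 0\<close> and \<open>top / top\<close> are both
  0.\<close>

lemma ennreal_divide_le_1:
  fixes x y :: ennreal assumes "x \<le> y" shows "x / y \<le> 1"
  by (metis assms divide_le_posI_ennreal ennreal_zero_divide le_numeral_extra(1) le_zero_eq
      linorder_cases mult.right_neutral not_less_zero)

lemma ennreal_times_divide_cancel:
  fixes x y :: ennreal assumes "x \<le> y" "y \<noteq> top" shows "y * (x / y) = x"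
  by (metis assms ennreal_times_divide mult.commute mult_divide_eq_ennreal ennreal_divide_eq_0_iff
      le_zero_eq)

lemma step_tendsto:
  assumes "\<And>w. edge G v w \<Longrightarrow> (\<lambda>n. f n w) \<longlonglongrightarrow> h w"
  shows "(\<lambda>n. step G (f n) v) \<longlonglongrightarrow> step G h v"
  unfolding step_def by (intro tendsto_sum ennreal_tendsto_cmult assms) simp_all

lemma (in graded_graph) countable_verts: "countable (verts G)"
proof -
  have "verts G = (\<Union>n. {v \<in> verts G. grade G v = n})" by auto
  moreover have "countable \<dots>" by (rule countable_UN) (auto intro: countable_finite finite_level)
  ultimately show ?thesis by simp
qed

section \<open>Joint eigenfunctions on a product and their sections\<close>

locale graph_pair = A: graded_graph G1 + B: graded_graph G2
  for G1 :: "'a ggraph" and G2 :: "'b ggraph"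
begin

abbreviation "P \<equiv> ggraph_prod G1 G2"

sublocale P: graded_graph P
  by (rule graded_graph_prod) unfold_locales

lemma step_prod:
  assumes "v \<in> verts P" shows "step P f v = step1 G1 f v + step2 G2 f v"
proof -
  obtain l m where v: "v = (l, m)" by (cases v)
  have fin: "finite {w. edge G1 l w}" "finite {w. edge G2 m w}"
    using A.finite_edges B.finite_edges by auto
  have "{w. edge P v w} = (\<lambda>l'. (l', m)) ` {l'. edge G1 l l'} \<union> Pair l ` {m'. edge G2 m m'}"
    using assms v by (auto simp: edge_prod)
  \<comment> \<open>A common element would be an edge from a vertex to itself, against the
    grading.\<close>
  moreover have "(\<lambda>l'. (l', m)) ` {l'. edge G1 l l'} \<inter> Pair l ` {m'. edge G2 m m'} = {}"
    by (auto simp: edge_def)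
  ultimately have "step P f v = (\<Sum>w\<in>(\<lambda>l'. (l', m)) ` {l'. edge G1 l l'}. ennreal (kappa P v w) * f w)
      + (\<Sum>w\<in>Pair l ` {m'. edge G2 m m'}. ennreal (kappa P v w) * f w)"
    using fin by (simp add: step_def sum.union_disjoint)
  also have "(\<Sum>w\<in>(\<lambda>l'. (l', m)) ` {l'. edge G1 l l'}. ennreal (kappa P v w) * f w) = step1 G1 f v"
    by (subst sum.reindex) (auto simp: inj_on_def step1_def step_def v)
  also have "(\<Sum>w\<in>Pair l ` {m'. edge G2 m m'}. ennreal (kappa P v w) * f w) = step2 G2 f v"
    by (subst sum.reindex) (auto simp: inj_on_def step2_def step_def v edge_def intro!: sum.cong)
  finally show ?thesis .
qed

lemma step1_step:
  assumes "v \<in> verts P" shows "step1 G1 (step P f) v = step P (step1 G1 f) v"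
proof -
  have "step1 G1 (step P f) v = step1 G1 (\<lambda>w. step1 G1 f w + step2 G2 f w) v"
    using assms by (intro step1_cong step_prod) (auto simp: edge_def)
  also have "\<dots> = step1 G1 (step1 G1 f) v + step1 G1 (step2 G2 f) v"
    by (simp add: step1_def[of G1 "\<lambda>w. _ w + _ w"] step_add step1_def[of _ "step1 G1 f"] step1_def[of _ "step2 G2 f"])
  finally show ?thesis by (simp add: step_prod[OF assms] step_commute)
qed

lemma step2_step:
  assumes "v \<in> verts P" shows "step2 G2 (step P f) v = step P (step2 G2 f) v"
proof -
  have "step2 G2 (step P f) v = step2 G2 (\<lambda>w. step1 G1 f w + step2 G2 f w) v"
    using assms by (intro step2_cong step_prod) (auto simp: edge_def)
  also have "\<dots> = step2 G2 (step1 G1 f) v + step2 G2 (step2 G2 f) v"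
    by (simp add: step2_def[of G2 "\<lambda>w. _ w + _ w"] step_add step2_def[of _ "step1 G1 f"] step2_def[of _ "step2 G2 f"])
  finally show ?thesis by (simp add: step_prod[OF assms] step_commute)
qed

lemma eigen_harmonic_on:
  assumes "U \<subseteq> verts P" "0 \<le> w1" "0 \<le> w2" "w1 + w2 = 1"
    and "\<And>v. v \<in> U \<Longrightarrow> step1 G1 f v = ennreal w1 * f v"
    and "\<And>v. v \<in> U \<Longrightarrow> step2 G2 f v = ennreal w2 * f v"
  shows "harmonic_on P U f"
  unfolding harmonic_on_def
proof
  fix v assume v: "v \<in> U"
  have "step P f v = (ennreal w1 + ennreal w2) * f v"
    using step_prod[of v f] v assms(1,5,6) by (auto simp: distrib_right)
  then show "step P f v = f v" using assms(2-4) by (simp flip: ennreal_plus)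
qed

text \<open>Both partial steps of the extension are harmonic, so minimality bounds them below by
  \<open>w1\<close> and \<open>w2\<close> times the extension. The two bounds add up to an equality,
  hence each is an equality where the extension is finite; at infinite values positivity of the
  weights makes all sides infinite.\<close>

lemma extension_eigen:
  assumes U: "upclosed P U" and w: "0 < w1" "0 < w2" "w1 + w2 = 1"
    and f1: "\<And>v. v \<in> U \<Longrightarrow> step1 G1 f v = ennreal w1 * f v"
    and f2: "\<And>v. v \<in> U \<Longrightarrow> step2 G2 f v = ennreal w2 * f v"
    and v: "v \<in> verts P"
  shows "step1 G1 (extension P U f) v = ennreal w1 * extension P U f v"
    and "step2 G2 (extension P U f) v = ennreal w2 * extension P U f v"
proof -
  let ?e = "extension P U f"
  have h: "harmonic_on P U f"
    using w f1 f2 upclosed_subset[OF U] by (intro eigen_harmonic_on[of U w1 w2]) auto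
  have eq: "?e w = f w" if "w \<in> U" for w by (rule extension_on[OF U h that])
  have up1: "(l, snd w) \<in> U" if "w \<in> U" "edge G1 (fst w) l" for w l
    using upclosedD[OF U that(1), of "(l, snd w)"] that upclosed_subset[OF U]
    by (cases w) (auto simp: edge_prod)
  have up2: "(fst w, m) \<in> U" if "w \<in> U" "edge G2 (snd w) m" for w m
    using upclosedD[OF U that(1), of "(fst w, m)"] that upclosed_subset[OF U]
    by (cases w) (auto simp: edge_prod)
  have "harmonic_on P (verts P) (step1 G1 ?e)"
    unfolding harmonic_on_def using extension_step[OF U h]
    by (auto simp: step1_step[symmetric] intro: step1_cong)
  moreover have "ennreal w1 * f w \<le> step1 G1 ?e w" if "w \<in> U" for w
    using f1[OF that] up1[OF that] eq by (auto intro!: eq_refl step1_cong simp flip: f1[OF that])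
  ultimately have le1: "ennreal w1 * ?e v \<le> step1 G1 ?e v"
    unfolding extension_cmult[symmetric] using v by (intro extension_least_harmonic)
  have "harmonic_on P (verts P) (step2 G2 ?e)"
    unfolding harmonic_on_def using extension_step[OF U h]
    by (auto simp: step2_step[symmetric] intro: step2_cong)
  moreover have "ennreal w2 * f w \<le> step2 G2 ?e w" if "w \<in> U" for w
    using f2[OF that] up2[OF that] eq by (auto intro!: eq_refl step2_cong simp flip: f2[OF that])
  ultimately have le2: "ennreal w2 * ?e v \<le> step2 G2 ?e v"
    unfolding extension_cmult[symmetric] using v by (intro extension_least_harmonic)
  have sum: "step1 G1 ?e v + step2 G2 ?e v = ennreal w1 * ?e v + ennreal w2 * ?e v"
    using step_prod[OF v, of ?e] extension_step[OF U h, of v] w by (simp flip: distrib_right ennreal_plus)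
  show "step1 G1 ?e v = ennreal w1 * ?e v" "step2 G2 ?e v = ennreal w2 * ?e v"
  proof -
    have "step1 G1 ?e v = ennreal w1 * ?e v \<and> step2 G2 ?e v = ennreal w2 * ?e v"
    proof (cases "?e v = top")
      case True
      then show ?thesis using le1 le2 w by (auto simp: ennreal_mult_top top_unique)
    next
      case False
      then have fin: "ennreal w1 * ?e v \<noteq> top" "ennreal w2 * ?e v \<noteq> top"
        by (auto simp: ennreal_mult_eq_top_iff)
      have "step1 G1 ?e v + ennreal w2 * ?e v \<le> ennreal w1 * ?e v + ennreal w2 * ?e v"
        using add_left_mono[OF le2] sum by metis
      moreover have "ennreal w1 * ?e v + step2 G2 ?e v \<le> ennreal w1 * ?e v + ennreal w2 * ?e v"
        using add_right_mono[OF le1] sum by metis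
      ultimately show ?thesis
        using fin le1 le2
        by (auto simp: ennreal_add_left_cancel_le add.commute[of _ "ennreal w2 * ?e v"] intro: antisym)
    qed
    then show "step1 G1 ?e v = ennreal w1 * ?e v" "step2 G2 ?e v = ennreal w2 * ?e v" by auto
  qed
qed

text \<open>If \<open>g\<close> is harmonic below the section at \<open>l0\<close>, reweighting the second coordinate of \<open>F\<close> at level
  \<open>n\<close> by the density \<open>g / F (l0, _)\<close> and letting \<open>n\<close> tend to infinity along a subsequence gives a
  function which is harmonic in both variables, below \<open>F\<close>, and equal to \<open>g\<close> in the section at \<open>l0\<close>.\<close>

lemma biextremal_section:
  assumes U1: "upclosed G1 U1" and U2: "upclosed G2 U2"
    and extension: "biextremal_on G1 G2 (U1 \<times> U2) F" and l0: "l0 \<in> U1"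
  shows "extremal_on G2 U2 (\<lambda>m. F (l0, m))"
proof -
  have F1: "step1 G1 F (l, m) = F (l, m)" and F2: "step2 G2 F (l, m) = F (l, m)"
    and Ffin: "F (l, m) \<noteq> top" if "l \<in> U1" "m \<in> U2" for l m
    using extension that by (auto simp: biextremal_on_def biharmonic_on_def less_top)
  have up1: "edge G1 l l' \<Longrightarrow> l' \<in> U1" if "l \<in> U1" for l l' using upclosedD[OF U1 that] .
  have up2: "edge G2 m m' \<Longrightarrow> m' \<in> U2" if "m \<in> U2" for m m' using upclosedD[OF U2 that] .
  have "\<exists>c\<ge>0. \<forall>m\<in>U2. g m = ennreal c * F (l0, m)"
    if g: "harmonic_on G2 U2 g" and gF: "\<And>m. m \<in> U2 \<Longrightarrow> g m \<le> F (l0, m)" for g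
  proof -
    define \<rho> where "\<rho> m = g m / F (l0, m)" for m
    have \<rho>1: "\<rho> m \<le> 1" and \<rho>g: "F (l0, m) * \<rho> m = g m" if "m \<in> U2" for m
      using gF[OF that] Ffin[OF l0 that]
      by (simp_all add: \<rho>_def ennreal_divide_le_1 ennreal_times_divide_cancel)
    define K where "K n = (step2 G2 ^^ n) (\<lambda>v. F v * \<rho> (snd v))" for n
    have K_Suc: "K (Suc n) = step2 G2 (K n)" for n by (simp add: K_def)
    have K_le: "K n (l, m) \<le> F (l, m)" if "l \<in> U1" "m \<in> U2" for n l m
      using that(2)
    proof (induction n arbitrary: m)
      case 0
      then show ?case using mult_left_mono[OF \<rho>1[OF 0], of "F (l, m)"] by (simp add: K_def)
    next
      case (Suc n)
      have "K (Suc n) (l, m) \<le> step2 G2 F (l, m)"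
        unfolding K_Suc step2_def using Suc.IH up2[OF Suc.prems] by (intro step_mono) auto
      then show ?case using F2 that Suc.prems by simp
    qed
    have K_g: "K n (l0, m) = g m" if "m \<in> U2" for n m
      using that
    proof (induction n arbitrary: m)
      case 0 then show ?case by (simp add: K_def \<rho>g)
    next
      case (Suc n)
      have "K (Suc n) (l0, m) = step G2 g m"
        unfolding K_Suc step2_def fst_conv snd_conv
        using Suc.IH up2[OF Suc.prems] by (intro step_cong) auto
      then show ?case using g Suc.prems by (simp add: harmonic_on_def)
    qed
    \<comment> \<open>The density depends on the second coordinate only, so the initial function
      inherits harmonicity in the first, and \<open>step2\<close> preserves it by
      commutation.\<close>
    have K1: "step1 G1 (K n) (l, m) = K n (l, m)" if "l \<in> U1" "m \<in> U2" for n l m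
      using that(2)
    proof (induction n arbitrary: m)
      case 0
      then show ?case
        using F1[OF that(1) 0] by (simp add: K_def step1_def step_cmult_right)
    next
      case (Suc n)
      have "step1 G1 (K (Suc n)) (l, m) = step2 G2 (step1 G1 (K n)) (l, m)"
        unfolding K_Suc by (rule step_commute)
      also have "\<dots> = step2 G2 (K n) (l, m)"
        using Suc.IH up2[OF Suc.prems] by (intro step2_cong) auto
      finally show ?case by (simp add: K_Suc)
    qed
    \<comment> \<open>Reindexing by the grade makes \<open>L n\<close> stationary under
      \<open>step2\<close>: going up one grade lowers the iteration count by one, and applying
      \<open>step2\<close> restores it. Truncated subtraction limits this to grades below
      \<open>n\<close>.\<close>
    define L where "L n v = K (n - grade G2 (snd v)) v" for n v
    have L1: "step1 G1 (L n) (l, m) = L n (l, m)" if "l \<in> U1" "m \<in> U2" for n l m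
      using K1[OF that, of "n - grade G2 m"] by (simp add: L_def step1_def)
    have L2: "step2 G2 (L n) (l, m) = L n (l, m)" if less: "grade G2 m < n" for n l m
    proof -
      obtain j where j: "n - grade G2 m = Suc j" using Suc_diff_Suc[OF less] by metis
      then have j': "n - Suc (grade G2 m) = j" by simp
      have "step2 G2 (L n) (l, m) = step2 G2 (K j) (l, m)"
        using j j' by (intro step2_cong) (auto simp: L_def edge_def)
      then show ?thesis by (simp add: L_def j K_Suc)
    qed
    \<comment> \<open>The ratios to \<open>F\<close> are reals in [0, 1], so on the countable set
      \<open>U1 \<times> U2\<close> one subsequence converges at every vertex.\<close>
    define q where "q n v = enn2real (L n v / F v)" for n v
    have q: "L n v = ennreal (q n v) * F v" "norm (q n v) \<le> 1" if v: "v \<in> U1 \<times> U2" for n v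
    proof -
      have le: "L n v \<le> F v" and fin: "F v \<noteq> top"
        using v K_le Ffin by (auto simp: L_def)
      then have "L n v / F v \<le> 1"
        by (simp add: ennreal_divide_le_1)
      then have eq: "ennreal (q n v) = L n v / F v" and "L n v / F v \<le> 1"
        unfolding q_def by (auto simp: ennreal_enn2real_if top_unique)
      then have "ennreal (q n v) \<le> 1" by simp
      then show "norm (q n v) \<le> 1" by (simp add: q_def)
      show "L n v = ennreal (q n v) * F v"
        unfolding eq using ennreal_times_divide_cancel[OF le fin] by (simp add: mult.commute)
    qed
    have "countable (U1 \<times> U2)"
      using countable_subset[OF upclosed_subset[OF U1] A.countable_verts]
        countable_subset[OF upclosed_subset[OF U2] B.countable_verts] by (rule countable_SIGMA)
    then obtain k where k: "strict_mono (k :: nat \<Rightarrow> nat)"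
      and conv: "\<And>v. v \<in> U1 \<times> U2 \<Longrightarrow> \<exists>x. (\<lambda>n. q (k n) v) \<longlonglongrightarrow> x"
      using function_convergent_subsequence[of "U1 \<times> U2" q 1] q(2) by blast
    define H where "H v = ennreal (lim (\<lambda>n. q (k n) v)) * F v" for v
    have LH: "(\<lambda>n. L (k n) (l, m)) \<longlonglongrightarrow> H (l, m)" if "l \<in> U1" "m \<in> U2" for l m
    proof -
      have "(\<lambda>n. q (k n) (l, m)) \<longlonglongrightarrow> lim (\<lambda>n. q (k n) (l, m))"
        using conv[of "(l, m)"] that limI by fastforce
      then have "(\<lambda>n. F (l, m) * ennreal (q (k n) (l, m))) \<longlonglongrightarrow> F (l, m) * ennreal (lim (\<lambda>n. q (k n) (l, m)))"
        using Ffin[OF that] by (intro ennreal_tendsto_cmult tendsto_ennrealI) (simp_all add: less_top)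
      then show ?thesis using q(1)[of "(l, m)"] that by (simp add: H_def mult.commute)
    qed
    have "step1 G1 H v = H v \<and> step2 G2 H v = H v \<and> H v \<le> F v" if vU: "v \<in> U1 \<times> U2" for v
    proof -
      obtain l m where v: "v = (l, m)" and l: "l \<in> U1" and m: "m \<in> U2" using vU by auto
      have "(\<lambda>n. step1 G1 (L (k n)) (l, m)) \<longlonglongrightarrow> step1 G1 H (l, m)"
        unfolding step1_def by (rule step_tendsto) (use LH up1[OF l] m in auto)
      then have 1: "step1 G1 H (l, m) = H (l, m)"
        unfolding L1[OF l m] using LH[OF l m] by (rule LIMSEQ_unique)
      have "(\<lambda>n. step2 G2 (L (k n)) (l, m)) \<longlonglongrightarrow> step2 G2 H (l, m)"
        unfolding step2_def by (rule step_tendsto) (use LH up2[OF m] l in auto)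
      \<comment> \<open>The equation for \<open>step2\<close> holds along the subsequence once
        \<open>n\<close> exceeds the grade of \<open>m\<close>, since
        \<open>n \<le> k n\<close>.\<close>
      moreover have "eventually (\<lambda>n. step2 G2 (L (k n)) (l, m) = L (k n) (l, m)) sequentially"
        using eventually_gt_at_top[of "grade G2 m"]
        by eventually_elim (rule L2, use seq_suble[OF k] in \<open>auto intro: less_le_trans\<close>)
      ultimately have "(\<lambda>n. L (k n) (l, m)) \<longlonglongrightarrow> step2 G2 H (l, m)"
        by (rule Lim_transform_eventually)
      then have 2: "step2 G2 H (l, m) = H (l, m)"
        using LH[OF l m] by (rule LIMSEQ_unique)
      have "H (l, m) \<le> F (l, m)"
        using LH[OF l m] by (rule LIMSEQ_le_const2) (use K_le[OF l m] in \<open>auto simp: L_def\<close>)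
      with 1 2 v show ?thesis by simp
    qed
    then have "biharmonic_on G1 G2 (U1 \<times> U2) H \<and> (\<forall>v\<in>U1 \<times> U2. H v \<le> F v)"
      unfolding biharmonic_on_def by blast
    then obtain c where c: "c \<ge> 0" "\<And>v. v \<in> U1 \<times> U2 \<Longrightarrow> H v = ennreal c * F v"
      using extension unfolding biextremal_on_def by meson
    \<comment> \<open>At \<open>l0\<close> every iterate equals \<open>g\<close>, so the limit does
      too, and \<open>c\<close> is the desired constant.\<close>
    have "g m = H (l0, m)" if "m \<in> U2" for m
      using LH[OF l0 that] K_g[OF that] by (simp add: L_def LIMSEQ_const_iff)
    then show ?thesis using c l0 by auto
  qed
  then show ?thesis
    unfolding extremal_on_def harmonic_on_def
    using F2[OF l0] Ffin[OF l0] by (auto simp: step2_def less_top)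
qed

end

section \<open>Extremality under change of representative and of scale\<close>

lemma extremal_on_cong:
  assumes "upclosed G U" "\<And>v. v \<in> U \<Longrightarrow> f v = g v"
  shows "extremal_on G U f \<longleftrightarrow> extremal_on G U g"
proof -
  have "harmonic_on G U f \<longleftrightarrow> harmonic_on G U g"
    unfolding harmonic_on_def using assms upclosedD[OF assms(1)]
    by (intro ball_cong refl) (auto intro!: arg_cong2[where f="(=)"] step_cong)
  then show ?thesis using assms(2) by (simp add: extremal_on_def)
qed

text \<open>Extremality only tests functions below \<open>f\<close> itself; division by
  \<open>r\<close> reduces to that case.\<close>

lemma extremal_on_dominated:
  assumes ex: "extremal_on G U f" and g: "harmonic_on G U g"
    and r: "0 \<le> r" "\<And>v. v \<in> U \<Longrightarrow> g v \<le> ennreal r * f v"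
  shows "\<exists>c\<ge>0. \<forall>v\<in>U. g v = ennreal c * f v"
proof (cases "r = 0")
  case True
  then show ?thesis using r by (intro exI[of _ 0]) auto
next
  case False
  define g' where "g' = (\<lambda>v. ennreal (1 / r) * g v)"
  have inv: "ennreal r * (ennreal (1 / r) * x) = x" "ennreal (1 / r) * (ennreal r * x) = x" for x
    using False r(1) by (simp_all flip: mult.assoc ennreal_mult)
  have "harmonic_on G U g'"
    using g by (simp add: harmonic_on_def g'_def step_cmult)
  moreover have "g' v \<le> f v" if "v \<in> U" for v
    using mult_left_mono[OF r(2)[OF that], of "ennreal (1 / r)"] by (simp add: g'_def inv)
  ultimately obtain c where c: "c \<ge> 0" "\<And>v. v \<in> U \<Longrightarrow> g' v = ennreal c * f v"
    using ex unfolding extremal_on_def by metis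
  have "g v = ennreal (r * c) * f v" if "v \<in> U" for v
    using c(2)[OF that] inv(1)[of "g v"] r(1) c(1) by (simp add: g'_def ennreal_mult mult.assoc)
  then show ?thesis using r(1) c(1) by (intro exI[of _ "r * c"]) auto
qed

text \<open>Lets \<open>\<phi>\<close> be specified by a function \<open>f\<close> that may differ
  from \<open>\<phi>\<close> off the up-set, as \<open>over\<close> does.\<close>

lemma (in graded_graph) determined_byI:
  assumes p: "p \<in> verts G" "0 < f p" "extremal_on G (upset G p) f"
    and \<phi>: "\<And>v. v \<in> verts G \<Longrightarrow> \<phi> v = extension G (upset G p) f v"
  shows "determined_by G \<phi> p"
proof -
  have U: "upclosed G (upset G p)" by (rule upclosed_upset[OF p(1)])
  have eq: "\<phi> v = f v" if "v \<in> upset G p" for v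
    using p(3) that \<phi>[of v] upclosed_subset[OF U] extension_on[OF U] by (auto simp: extremal_on_def)
  have "extension G (upset G p) \<phi> v = extension G (upset G p) f v" for v
    by (rule extension_cong) (rule eq)
  moreover have "extremal_on G (upset G p) \<phi>"
    using extremal_on_cong[OF U, of \<phi> f] eq p(3) by blast
  ultimately show ?thesis
    unfolding determined_by_def using p eq[of p] \<phi> by auto
qed

lemma (in graded_graph) determined_by_extension:
  assumes "p \<in> verts G" "0 < f p" "extremal_on G (upset G p) f"
  shows "determined_by G (extension G (upset G p) f) p"
  using assms by (rule determined_byI) simp

lemma determined_by_point:
  assumes "determined_by G \<phi> p"
  shows "p \<in> verts G" "\<phi> p \<noteq> 0" "\<phi> p \<noteq> top"
  using assms upset_refl[of p G] by (auto simp: determined_by_def extremal_on_def simp del: upset_refl)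

section \<open>Symmetry under exchange of the two factors\<close>

lemma step1_swap: "step1 G (\<lambda>v. F (prod.swap v)) v = step2 G F (prod.swap v)"
  by (simp add: step1_def step2_def)

lemma step2_swap: "step2 G (\<lambda>v. F (prod.swap v)) v = step1 G F (prod.swap v)"
  by (simp add: step1_def step2_def)

lemma biharmonic_on_swap:
  assumes "biharmonic_on G1 G2 (U1 \<times> U2) F"
  shows "biharmonic_on G2 G1 (U2 \<times> U1) (\<lambda>v. F (prod.swap v))"
  using assms by (auto simp: biharmonic_on_def step1_swap step2_swap)

lemma biextremal_on_swap:
  assumes "biextremal_on G1 G2 (U1 \<times> U2) F"
  shows "biextremal_on G2 G1 (U2 \<times> U1) (\<lambda>v. F (prod.swap v))"
  unfolding biextremal_on_def
proof (intro conjI allI impI)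
  show "biharmonic_on G2 G1 (U2 \<times> U1) (\<lambda>v. F (prod.swap v))"
    using assms biharmonic_on_swap by (auto simp: biextremal_on_def)
  show "\<forall>v\<in>U2 \<times> U1. F (prod.swap v) < \<infinity>" using assms by (auto simp: biextremal_on_def)
  fix H assume H: "biharmonic_on G2 G1 (U2 \<times> U1) H \<and> (\<forall>v\<in>U2 \<times> U1. H v \<le> F (prod.swap v))"
  then have "biharmonic_on G1 G2 (U1 \<times> U2) (\<lambda>v. H (prod.swap v))"
    using biharmonic_on_swap by blast
  moreover have "\<forall>v\<in>U1 \<times> U2. H (prod.swap v) \<le> F v" using H by auto
  ultimately obtain c where c: "c \<ge> 0" "\<forall>v\<in>U1 \<times> U2. H (prod.swap v) = ennreal c * F v"
    using assms unfolding biextremal_on_def by (elim conjE allE[of _ "\<lambda>v. H (prod.swap v)"]) auto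
  then show "\<exists>c\<ge>0. \<forall>v\<in>U2 \<times> U1. H v = ennreal c * F (prod.swap v)"
    by (intro exI[of _ c]) force
qed

context graph_pair
begin

lemma step_swap:
  "step (ggraph_prod G2 G1) (\<lambda>v. F (prod.swap v)) v = step P F (prod.swap v)"
proof -
  interpret S: graph_pair G2 G1 by unfold_locales
  show ?thesis
  proof (cases "v \<in> verts S.P")
    case True
    then have "prod.swap v \<in> verts P" by auto
    then show ?thesis
      using True by (simp add: step_prod S.step_prod step1_swap step2_swap add.commute)
  next
    case False
    then have "prod.swap v \<notin> verts P" by (cases v) auto
    with False show ?thesis by (simp add: step_outside)
  qed
qed

lemma extension_swap:
  "extension (ggraph_prod G2 G1) (U2 \<times> U1) (\<lambda>v. F (prod.swap v)) v = extension P (U1 \<times> U2) F (prod.swap v)"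
proof -
  have "(step (ggraph_prod G2 G1) ^^ n) (restr (U2 \<times> U1) (\<lambda>v. F (prod.swap v))) =
      (\<lambda>v. (step P ^^ n) (restr (U1 \<times> U2) F) (prod.swap v))" for n
  proof (induction n)
    case 0 show ?case by (auto simp: restr_def)
  next
    case (Suc n) then show ?case by (simp add: step_swap)
  qed
  then show ?thesis by (simp add: extension_def)
qed

lemma harmonic_on_swap:
  "harmonic_on (ggraph_prod G2 G1) (U2 \<times> U1) (\<lambda>v. F (prod.swap v)) \<longleftrightarrow> harmonic_on P (U1 \<times> U2) F"
  by (auto simp: harmonic_on_def step_swap)

lemma extremal_on_swap:
  assumes "extremal_on P (U1 \<times> U2) F"
  shows "extremal_on (ggraph_prod G2 G1) (U2 \<times> U1) (\<lambda>v. F (prod.swap v))"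
  unfolding extremal_on_def
proof (intro conjI allI impI)
  show "harmonic_on (ggraph_prod G2 G1) (U2 \<times> U1) (\<lambda>v. F (prod.swap v))"
    using assms harmonic_on_swap by (auto simp: extremal_on_def)
  show "\<forall>v\<in>U2 \<times> U1. F (prod.swap v) < \<infinity>" using assms by (auto simp: extremal_on_def)
  fix H assume H: "harmonic_on (ggraph_prod G2 G1) (U2 \<times> U1) H \<and> (\<forall>v\<in>U2 \<times> U1. H v \<le> F (prod.swap v))"
  then have "harmonic_on P (U1 \<times> U2) (\<lambda>v. H (prod.swap v))"
    using harmonic_on_swap[of U2 U1 "\<lambda>v. H (prod.swap v)"] by simp
  moreover have "\<forall>v\<in>U1 \<times> U2. H (prod.swap v) \<le> F v" using H by auto
  ultimately obtain c where c: "c \<ge> 0" "\<forall>v\<in>U1 \<times> U2. H (prod.swap v) = ennreal c * F v"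
    using assms unfolding extremal_on_def by (elim conjE allE[of _ "\<lambda>v. H (prod.swap v)"]) auto
  then show "\<exists>c\<ge>0. \<forall>v\<in>U2 \<times> U1. H v = ennreal c * F (prod.swap v)"
    by (intro exI[of _ c]) force
qed

lemma determined_by_swap:
  assumes "determined_by P \<phi> (p, q)"
  shows "determined_by (ggraph_prod G2 G1) (\<lambda>v. \<phi> (prod.swap v)) (q, p)"
  using assms extremal_on_swap[of "upset G1 p" "upset G2 q" \<phi>]
  by (auto simp: determined_by_def upset_prod extension_swap)

section \<open>Extensions of product functions\<close>

lemma step1_product: "step1 G1 (\<lambda>v. f1 (fst v) * f2 (snd v)) v = step G1 f1 (fst v) * f2 (snd v)"
  by (simp add: step1_def step_cmult_right)

lemma step2_product: "step2 G2 (\<lambda>v. f1 (fst v) * f2 (snd v)) v = f1 (fst v) * step G2 f2 (snd v)"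
  by (simp add: step2_def step_cmult)

lemma product_eigen:
  assumes "0 < w1" "0 < w2" "harmonic_on G1 U1 f1" "harmonic_on G2 U2 f2" "v \<in> U1 \<times> U2"
  shows "step1 G1 (\<lambda>v. tilt G1 G2 w1 w2 v * (f1 (fst v) * f2 (snd v))) v =
      ennreal w1 * (tilt G1 G2 w1 w2 v * (f1 (fst v) * f2 (snd v)))"
    and "step2 G2 (\<lambda>v. tilt G1 G2 w1 w2 v * (f1 (fst v) * f2 (snd v))) v =
      ennreal w2 * (tilt G1 G2 w1 w2 v * (f1 (fst v) * f2 (snd v)))"
  using assms by (auto simp: step1_tilt step2_tilt step1_product step2_product harmonic_on_def)

lemma tilt_inverse':
  assumes "0 < w1" "0 < w2"
  shows "tilt G1 G2 (1 / w1) (1 / w2) v * (tilt G1 G2 w1 w2 v * x) = x"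
  using tilt_inverse[of w1 w2 G1 G2 v x] assms by (simp add: mult.left_commute)

lemma biharmonic_untilt:
  assumes w: "0 < w1" "0 < w2"
    and "\<And>v. v \<in> U \<Longrightarrow> step1 G1 f v = ennreal w1 * f v"
    and "\<And>v. v \<in> U \<Longrightarrow> step2 G2 f v = ennreal w2 * f v"
  shows "biharmonic_on G1 G2 U (\<lambda>v. tilt G1 G2 (1 / w1) (1 / w2) v * f v)"
proof -
  have inv: "ennreal (1 / w1) * (x * (ennreal w1 * y)) = x * y"
    "ennreal (1 / w2) * (x * (ennreal w2 * y)) = x * y" for x y
  proof -
    have 1: "ennreal (1 / w1) * ennreal w1 = 1" "ennreal (1 / w2) * ennreal w2 = 1"
      using w by (simp_all flip: ennreal_mult)
    show "ennreal (1 / w1) * (x * (ennreal w1 * y)) = x * y"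
      "ennreal (1 / w2) * (x * (ennreal w2 * y)) = x * y"
      using arg_cong[OF 1(1), of "\<lambda>z. z * (x * y)"] arg_cong[OF 1(2), of "\<lambda>z. z * (x * y)"]
      by (simp_all add: mult_ac)
  qed
  show ?thesis
    using assms by (auto simp: biharmonic_on_def step1_tilt step2_tilt inv)
qed

text \<open>The product of the extensions is harmonic with the right values on the rectangle, so it
  dominates. For the reverse, \<open>extension_eigen\<close> makes the untilted extension harmonic
  in each variable, and minimality applies in one variable at a time.\<close>

lemma extension_product:
  assumes U1: "upclosed G1 U1" and U2: "upclosed G2 U2"
    and w: "0 < w1" "0 < w2" "w1 + w2 = 1"
    and f1: "harmonic_on G1 U1 f1" and f2: "harmonic_on G2 U2 f2"
    and v: "v \<in> verts P"
  shows "extension P (U1 \<times> U2) (\<lambda>v. tilt G1 G2 w1 w2 v * (f1 (fst v) * f2 (snd v))) v =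
    tilt G1 G2 w1 w2 v * (extension G1 U1 f1 (fst v) * extension G2 U2 f2 (snd v))"
proof (rule antisym)
  let ?f = "\<lambda>v. tilt G1 G2 w1 w2 v * (f1 (fst v) * f2 (snd v))"
  let ?h = "\<lambda>v. tilt G1 G2 w1 w2 v * (extension G1 U1 f1 (fst v) * extension G2 U2 f2 (snd v))"
  have U: "upclosed P (U1 \<times> U2)" by (rule upclosed_prod[OF U1 U2])
  have sub: "U1 \<subseteq> verts G1" "U2 \<subseteq> verts G2" using U1 U2 upclosed_subset by blast+
  have "harmonic_on P (verts G1 \<times> verts G2) ?h"
    by (rule eigen_harmonic_on[of _ w1 w2])
       (use w in \<open>simp_all add: product_eigen[OF w(1,2) extension_harmonic[OF U1 f1] extension_harmonic[OF U2 f2]]\<close>)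
  then show "extension P (U1 \<times> U2) ?f v \<le> ?h v"
    using v by (intro extension_least_harmonic) (auto simp: extension_on[OF U1 f1] extension_on[OF U2 f2])
  define \<Phi> where "\<Phi> = extension P (U1 \<times> U2) ?f"
  define \<psi> where "\<psi> v = tilt G1 G2 (1 / w1) (1 / w2) v * \<Phi> v" for v
  have eig: "step1 G1 ?f v = ennreal w1 * ?f v" "step2 G2 ?f v = ennreal w2 * ?f v"
    if "v \<in> U1 \<times> U2" for v
    using product_eigen[OF w(1,2) f1 f2 that] .
  have "harmonic_on P (U1 \<times> U2) ?f"
    using sub w eig by (intro eigen_harmonic_on[of _ w1 w2]) auto
  then have \<Phi>U: "\<Phi> v = ?f v" if "v \<in> U1 \<times> U2" for v
    unfolding \<Phi>_def using that by (intro extension_on[OF U])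
  have bih: "biharmonic_on G1 G2 (verts P) \<psi>"
    unfolding \<psi>_def \<Phi>_def using extension_eigen[OF U w eig] by (intro biharmonic_untilt[OF w(1,2)])
  have \<psi>1: "harmonic_on G1 (verts G1) (\<lambda>l. \<psi> (l, m))" if "m \<in> verts G2" for m
    using bih that by (auto simp: biharmonic_on_def harmonic_on_def step1_def)
  have \<psi>2: "harmonic_on G2 (verts G2) (\<lambda>m. \<psi> (l, m))" if "l \<in> verts G1" for l
    using bih that by (auto simp: biharmonic_on_def harmonic_on_def step2_def)
  \<comment> \<open>Minimality in \<open>l\<close> for fixed \<open>m\<close> in \<open>U2\<close>;
    the bound then holds for all \<open>l\<close> and is the input for minimality in
    \<open>m\<close>.\<close>
  have 1: "f2 m * extension G1 U1 f1 l \<le> \<psi> (l, m)" if "m \<in> U2" "l \<in> verts G1" for l m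
    unfolding extension_cmult[symmetric]
    using that sub \<psi>1[of m] \<Phi>U tilt_inverse'[OF w(1,2)]
    by (intro extension_least_harmonic[where h="\<lambda>l. \<psi> (l, m)"]) (auto simp: \<psi>_def mult.commute[of "f2 m"])
  have "extension G1 U1 f1 l * extension G2 U2 f2 m \<le> \<psi> (l, m)" if "m \<in> verts G2" "l \<in> verts G1" for l m
    unfolding extension_cmult[symmetric]
    using that sub \<psi>2[of l] 1
    by (intro extension_least_harmonic[where h="\<lambda>m. \<psi> (l, m)"]) (auto simp: mult.commute)
  then have "extension G1 U1 f1 (fst v) * extension G2 U2 f2 (snd v) \<le> \<psi> v"
    using v by (cases v) auto
  then have "?h v \<le> tilt G1 G2 w1 w2 v * \<psi> v" by (intro mult_left_mono) auto
  also have "\<dots> = \<Phi> v" unfolding \<psi>_def by (rule tilt_inverse[OF w(1,2)])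
  finally show "?h v \<le> extension P (U1 \<times> U2) ?f v" by (simp add: \<Phi>_def)
qed

end

subsection \<open>Extremality of products\<close>

text \<open>Serves the two places where an increment is collected again and again: in
  \<open>eigen_dominated\<close> it has to vanish, in \<open>extension_over\<close> it creates the
  value \<open>\<infinity>\<close>.\<close>

lemma ennreal_top_mult_le:
  fixes x y :: ennreal
  assumes "\<And>n. of_nat n * x \<le> y" shows "\<infinity> * x \<le> y"
proof -
  have "\<infinity> * x = (SUP n. of_nat n * x)"
    by (simp add: ennreal_SUP_of_nat_eq_top flip: SUP_mult_right_ennreal)
  also have "\<dots> \<le> y" using assms by (rule SUP_least)
  finally show ?thesis .
qed

text \<open>Cauchy--Schwarz; a term with \<open>y i = 0\<close> contributes \<open>0 / 0 = 0\<close>.\<close>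

lemma sum_square_divide_le:
  fixes k x y :: "'a \<Rightarrow> real"
  assumes "\<And>i. i \<in> I \<Longrightarrow> 0 \<le> k i" "\<And>i. i \<in> I \<Longrightarrow> 0 \<le> y i"
    and "\<And>i. i \<in> I \<Longrightarrow> y i = 0 \<Longrightarrow> x i = 0"
  shows "(\<Sum>i\<in>I. k i * x i)\<^sup>2 / (\<Sum>i\<in>I. k i * y i) \<le> (\<Sum>i\<in>I. k i * ((x i)\<^sup>2 / y i))"
proof -
  define a b where "a i = sqrt (k i * y i)" and "b i = sqrt (k i) * (x i / sqrt (y i))" for i
  have ab: "k i * x i = a i * b i" "k i * y i = (a i)\<^sup>2" "k i * ((x i)\<^sup>2 / y i) = (b i)\<^sup>2" if "i \<in> I" for i
    using assms[OF that]
    by (auto simp: a_def b_def real_sqrt_mult power_mult_distrib power_divide)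
  have "(\<Sum>i\<in>I. k i * x i)\<^sup>2 \<le> (\<Sum>i\<in>I. k i * y i) * (\<Sum>i\<in>I. k i * ((x i)\<^sup>2 / y i))"
    using Cauchy_Schwarz_ineq_sum[of a b I] by (simp only: ab cong: sum.cong)
  moreover have "0 \<le> (\<Sum>i\<in>I. k i * y i)" "0 \<le> (\<Sum>i\<in>I. k i * ((x i)\<^sup>2 / y i))"
    using assms by (auto intro!: sum_nonneg mult_nonneg_nonneg divide_nonneg_nonneg)
  ultimately show ?thesis
    by (cases "(\<Sum>i\<in>I. k i * y i) = 0") (auto simp: divide_le_eq mult.commute)
qed

text \<open>Real version of \<open>step\<close>: the function \<open>d\<close> in
  \<open>eigen_dominated\<close> may change sign.\<close>

definition rstep :: "'a ggraph \<Rightarrow> ('a \<Rightarrow> real) \<Rightarrow> 'a \<Rightarrow> real" where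
  "rstep G x v = (\<Sum>w | edge G v w. kappa G v w * x w)"

context graded_graph
begin

lemma step_ennreal:
  assumes "\<And>w. edge G v w \<Longrightarrow> 0 \<le> x w"
  shows "step G (\<lambda>w. ennreal (x w)) v = ennreal (rstep G x v)"
proof -
  have "step G (\<lambda>w. ennreal (x w)) v = (\<Sum>w | edge G v w. ennreal (kappa G v w * x w))"
    unfolding step_def using assms kappa_pos by (intro sum.cong) (auto simp: ennreal_mult less_imp_le)
  also have "\<dots> = ennreal (rstep G x v)"
    unfolding rstep_def using assms kappa_pos by (intro sum_ennreal) (auto intro!: mult_nonneg_nonneg intro: less_imp_le)
  finally show ?thesis .
qed

lemma enn2real_step:
  assumes "\<And>w. edge G v w \<Longrightarrow> f w < \<infinity>"
  shows "enn2real (step G f v) = rstep G (\<lambda>w. enn2real (f w)) v"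
proof -
  have "step G f v = step G (\<lambda>w. ennreal (enn2real (f w))) v"
    using assms by (intro step_cong) (simp add: ennreal_enn2real)
  also have "\<dots> = ennreal (rstep G (\<lambda>w. enn2real (f w)) v)" by (rule step_ennreal) simp
  finally have "step G f v = ennreal (rstep G (\<lambda>w. enn2real (f w)) v)" .
  moreover have "0 \<le> rstep G (\<lambda>w. enn2real (f w)) v"
    unfolding rstep_def using kappa_pos by (intro sum_nonneg mult_nonneg_nonneg) (auto intro: less_imp_le)
  ultimately show ?thesis by simp
qed

text \<open>Convexity and homogeneity of \<open>x\<^sup>2 / y\<close>. Zeros of \<open>y\<close>
  have to be zeros of \<open>x\<close> because division by 0 yields 0.\<close>

lemma step_square_divide:
  assumes "\<And>w. edge G v w \<Longrightarrow> 0 \<le> y w" "\<And>w. edge G v w \<Longrightarrow> y w = 0 \<Longrightarrow> x w = 0"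
  shows "ennreal ((rstep G x v)\<^sup>2 / rstep G y v) \<le> step G (\<lambda>w. ennreal ((x w)\<^sup>2 / y w)) v"
proof -
  have "(rstep G x v)\<^sup>2 / rstep G y v \<le> rstep G (\<lambda>w. (x w)\<^sup>2 / y w) v"
    unfolding rstep_def using assms kappa_pos
    by (intro sum_square_divide_le) (auto intro: less_imp_le)
  then show ?thesis using assms by (subst step_ennreal) (auto intro: ennreal_leI)
qed

text \<open>A Harnack inequality: an edge from \<open>l\<close> to \<open>l'\<close> gives
  \<open>kappa G l l' * h l' \<le> h l\<close>, so the inverse multiplicities along a path from
  \<open>p\<close> multiply to a constant independent of \<open>h\<close>.\<close>

lemma upset_bound:
  assumes "l \<in> upset G p"
  shows "\<exists>r\<ge>0. \<forall>h. harmonic_on G (upset G p) h \<longrightarrow> h l \<le> ennreal r * h p"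
proof -
  have "(edge G)\<^sup>*\<^sup>* p l" using assms by (simp add: upset_def)
  then show ?thesis
  proof (induction rule: rtranclp_induct)
    case base show ?case by (intro exI[of _ 1]) auto
  next
    case (step l l')
    then obtain r where r: "r \<ge> 0" "\<And>h. harmonic_on G (upset G p) h \<Longrightarrow> h l \<le> ennreal r * h p"
      by blast
    define k where "k = kappa G l l'"
    have k: "0 < k" using kappa_pos[OF step.hyps(2)] by (simp add: k_def)
    have "h l' \<le> ennreal (r / k) * h p" if h: "harmonic_on G (upset G p) h" for h
    proof -
      have "h l' = ennreal (1 / k) * (ennreal k * h l')"
        using k by (simp flip: mult.assoc ennreal_mult)
      also have "ennreal k * h l' \<le> h l"
        using step_ge[OF step.hyps(2), of h] h step.hyps(1)
        by (simp add: k_def harmonic_on_def upset_def)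
      also have "h l \<le> ennreal r * h p" by (rule r(2)[OF h])
      finally show ?thesis
        using k r(1) by (simp add: mult_left_mono flip: mult.assoc ennreal_mult)
    qed
    then show ?case using k r(1) by (intro exI[of _ "r / k"]) auto
  qed
qed

end

context graph_pair
begin

lemma step1_le: "v \<in> verts P \<Longrightarrow> step1 G1 f v \<le> step P f v"
  by (simp add: step_prod)

lemma step2_le: "v \<in> verts P \<Longrightarrow> step2 G2 f v \<le> step P f v"
  by (simp add: step_prod)

lemma step1_harmonic_on:
  assumes "upclosed P U" "harmonic_on P U f" shows "harmonic_on P U (step1 G1 f)"
  unfolding harmonic_on_def
proof
  fix v assume v: "v \<in> U"
  then have vP: "v \<in> verts P" using upclosed_subset[OF assms(1)] by auto
  have "step1 G1 (step P f) v = step1 G1 f v"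
    using assms(2) upclosedD[OF assms(1) v] vP
    by (intro step1_cong) (cases v, auto simp: harmonic_on_def edge_prod)
  then show "step P (step1 G1 f) v = step1 G1 f v" by (simp add: step1_step[OF vP])
qed

lemma step2_harmonic_on:
  assumes "upclosed P U" "harmonic_on P U f" shows "harmonic_on P U (step2 G2 f)"
  unfolding harmonic_on_def
proof
  fix v assume v: "v \<in> U"
  then have vP: "v \<in> verts P" using upclosed_subset[OF assms(1)] by auto
  have "step2 G2 (step P f) v = step2 G2 f v"
    using assms(2) upclosedD[OF assms(1) v] vP
    by (intro step2_cong) (cases v, auto simp: harmonic_on_def edge_prod)
  then show "step P (step2 G2 f) v = step2 G2 f v" by (simp add: step2_step[OF vP])
qed

text \<open>With \<open>a = step1 G1 g\<close>, \<open>b = step2 G2 g\<close> and \<open>d = w2 * a - w1 * b\<close>, the function \<open>d\<^sup>2 / f\<close> is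
  subharmonic and the step operator raises \<open>g\<^sup>2 / f \<le> f\<close> by at least \<open>d\<^sup>2 / (w1 * w2 * f)\<close>.
  Iterating, all multiples of the latter stay below \<open>f\<close>, so \<open>d = 0\<close>.\<close>

lemma eigen_dominated:
  assumes U: "upclosed P U" and w: "0 < w1" "0 < w2" "w1 + w2 = 1"
    and f1: "\<And>v. v \<in> U \<Longrightarrow> step1 G1 f v = ennreal w1 * f v"
    and f2: "\<And>v. v \<in> U \<Longrightarrow> step2 G2 f v = ennreal w2 * f v"
    and fin: "\<And>v. v \<in> U \<Longrightarrow> f v < \<infinity>"
    and g: "harmonic_on P U g" and gf: "\<And>v. v \<in> U \<Longrightarrow> g v \<le> f v"
    and v: "v \<in> U"
  shows "step1 G1 g v = ennreal w1 * g v" "step2 G2 g v = ennreal w2 * g v"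
proof -
  have UP: "U \<subseteq> verts P" by (rule upclosed_subset[OF U])
  have f: "harmonic_on P U f"
    using w f1 f2 UP by (intro eigen_harmonic_on[of U w1 w2]) auto
  have up1: "(l, snd u) \<in> U" if "u \<in> U" "edge G1 (fst u) l" for u l
    using upclosedD[OF U that(1), of "(l, snd u)"] that UP by (cases u) (auto simp: edge_prod)
  have up2: "(fst u, m) \<in> U" if "u \<in> U" "edge G2 (snd u) m" for u m
    using upclosedD[OF U that(1), of "(fst u, m)"] that UP by (cases u) (auto simp: edge_prod)
  have le1: "step1 G1 g u \<le> g u" and le2: "step2 G2 g u \<le> g u"
    and sum: "step1 G1 g u + step2 G2 g u = g u" if "u \<in> U" for u
    using that UP g step1_le[of u g] step2_le[of u g] step_prod[of u g]
    by (auto simp: harmonic_on_def)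
  have gfin: "g u < \<infinity>" if "u \<in> U" for u using gf[OF that] fin[OF that] by (rule le_less_trans)
  have fin1: "step1 G1 g u < \<infinity>" and fin2: "step2 G2 g u < \<infinity>" if "u \<in> U" for u
    using le1[OF that] le2[OF that] gfin[OF that] by (auto intro: le_less_trans)
  define x y a b where "x u = enn2real (f u)" and "y u = enn2real (g u)"
    and "a u = enn2real (step1 G1 g u)" and "b u = enn2real (step2 G2 g u)" for u
  define d where "d u = w2 * a u - w1 * b u" for u
  have x0: "0 \<le> x u" and y0: "0 \<le> y u" for u by (simp_all add: x_def y_def)
  have yab: "y u = a u + b u" if "u \<in> U" for u
    using sum[OF that] fin1[OF that] fin2[OF that] by (auto simp: y_def a_def b_def simp flip: enn2real_plus)
  have yx: "y u \<le> x u" if "u \<in> U" for u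
    using gf[OF that] fin[OF that] by (simp add: x_def y_def enn2real_mono)
  have ab0: "0 \<le> a u" "0 \<le> b u" for u by (simp_all add: a_def b_def)
  \<comment> \<open>Where \<open>f\<close> vanishes, so do \<open>g\<close> and both its partial
    steps; hence the convention for division by 0 does no harm below.\<close>
  have d_0: "d u = 0" if "u \<in> U" "x u = 0" for u
  proof -
    have "a u = 0" "b u = 0" using yx[OF that(1)] yab[OF that(1)] ab0[of u] that(2) by linarith+
    then show ?thesis by (simp add: d_def)
  qed
  have ra: "rstep G1 (\<lambda>l. y (l, snd u)) (fst u) = a u"
    and rx1: "rstep G1 (\<lambda>l. x (l, snd u)) (fst u) = w1 * x u" if "u \<in> U" for u
    using A.enn2real_step[of "fst u" "\<lambda>l. g (l, snd u)"] A.enn2real_step[of "fst u" "\<lambda>l. f (l, snd u)"]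
      up1[OF that] gfin fin f1[OF that] w by (auto simp: a_def x_def y_def step1_def enn2real_mult)
  have rb: "rstep G2 (\<lambda>m. y (fst u, m)) (snd u) = b u"
    and rx2: "rstep G2 (\<lambda>m. x (fst u, m)) (snd u) = w2 * x u" if "u \<in> U" for u
    using B.enn2real_step[of "snd u" "\<lambda>m. g (fst u, m)"] B.enn2real_step[of "snd u" "\<lambda>m. f (fst u, m)"]
      up2[OF that] gfin fin f2[OF that] w by (auto simp: b_def x_def y_def step2_def enn2real_mult)
  have rd: "rstep P d u = d u" and rx: "rstep P x u = x u" if "u \<in> U" for u
  proof -
    have succ: "w \<in> U" if "edge P u w" for w using upclosedD[OF U \<open>u \<in> U\<close> that] .
    have "rstep P a u = a u" "rstep P b u = b u"
      using P.enn2real_step[of u "step1 G1 g"] P.enn2real_step[of u "step2 G2 g"] succ fin1 fin2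
        step1_harmonic_on[OF U g] step2_harmonic_on[OF U g] that
      by (auto simp: a_def[abs_def] b_def[abs_def] harmonic_on_def)
    moreover have "rstep P d u = w2 * rstep P a u - w1 * rstep P b u"
      by (simp add: rstep_def d_def right_diff_distrib sum_subtractf sum_distrib_left mult.left_commute)
    ultimately show "rstep P d u = d u" by (simp add: d_def)
    show "rstep P x u = x u"
      using P.enn2real_step[of u f] succ fin f that by (auto simp: x_def[abs_def] harmonic_on_def)
  qed
  define Q E where "Q u = ennreal ((y u)\<^sup>2 / x u)" and "E u = ennreal ((d u)\<^sup>2 / x u)" for u
  define c where "c = ennreal (1 / (w1 * w2))"
  have E: "E u \<le> step P E u" if "u \<in> U" for u
    using P.step_square_divide[of u x d] x0 d_0 upclosedD[OF U that] rd[OF that] rx[OF that]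
    by (auto simp: E_def[abs_def])
  have Q: "Q u + c * E u \<le> step P Q u" if "u \<in> U" for u
  proof -
    have y_0: "y u = 0" if "u \<in> U" "x u = 0" for u using yx[OF that(1)] y0[of u] that(2) by simp
    have 1: "ennreal ((a u)\<^sup>2 / (w1 * x u)) \<le> step1 G1 Q u"
      using A.step_square_divide[of "fst u" "\<lambda>l. x (l, snd u)" "\<lambda>l. y (l, snd u)"]
        x0 y_0 up1[OF that] ra[OF that] rx1[OF that] by (simp add: step1_def Q_def)
    have 2: "ennreal ((b u)\<^sup>2 / (w2 * x u)) \<le> step2 G2 Q u"
      using B.step_square_divide[of "snd u" "\<lambda>m. x (fst u, m)" "\<lambda>m. y (fst u, m)"]
        x0 y_0 up2[OF that] rb[OF that] rx2[OF that] by (simp add: step2_def Q_def)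
    \<comment> \<open>Variance identity: with weights \<open>w1\<close> and \<open>w2\<close>, the
      numbers \<open>a / w1\<close> and \<open>b / w2\<close> have mean \<open>y\<close> and
      variance \<open>d\<^sup>2 / (w1 * w2)\<close>.\<close>
    have "(a u)\<^sup>2 / w1 + (b u)\<^sup>2 / w2 = (y u)\<^sup>2 + (d u)\<^sup>2 / (w1 * w2)"
    proof -
      have w2: "w2 = 1 - w1" using w(3) by simp
      have "(a u)\<^sup>2 * w2 + (b u)\<^sup>2 * w1 = w1 * w2 * (y u)\<^sup>2 + (d u)\<^sup>2"
        unfolding yab[OF that] d_def w2 by (simp add: algebra_simps power2_eq_square)
      then have "((a u)\<^sup>2 * w2 + (b u)\<^sup>2 * w1) / (w1 * w2) = (w1 * w2 * (y u)\<^sup>2 + (d u)\<^sup>2) / (w1 * w2)"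
        by simp
      then show ?thesis using w(1,2) by (simp add: add_divide_distrib)
    qed
    then have "((a u)\<^sup>2 / w1 + (b u)\<^sup>2 / w2) / x u = ((y u)\<^sup>2 + (d u)\<^sup>2 / (w1 * w2)) / x u"
      by simp
    then have eq: "(a u)\<^sup>2 / (w1 * x u) + (b u)\<^sup>2 / (w2 * x u) = (y u)\<^sup>2 / x u + 1 / (w1 * w2) * ((d u)\<^sup>2 / x u)"
      by (simp add: add_divide_distrib)
    have "Q u + c * E u = ennreal ((y u)\<^sup>2 / x u + 1 / (w1 * w2) * ((d u)\<^sup>2 / x u))"
      using w x0 by (simp add: Q_def E_def c_def ennreal_plus ennreal_mult[symmetric])
    also have "\<dots> = ennreal ((a u)\<^sup>2 / (w1 * x u)) + ennreal ((b u)\<^sup>2 / (w2 * x u))"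
      unfolding eq[symmetric] using w x0 by (simp add: ennreal_plus)
    also have "\<dots> \<le> step P Q u"
      using add_mono[OF 1 2] step_prod[of u Q] that UP by auto
    finally show ?thesis .
  qed
  \<comment> \<open>Each application of \<open>step P\<close> releases one more
    \<open>c * E u\<close>, and those already collected survive because
    \<open>E \<le> step P E\<close> on \<open>U\<close>.\<close>
  have main: "Q u + of_nat n * (c * E u) \<le> f u" if "u \<in> U" for n u
    using that
  proof (induction n arbitrary: u)
    case 0
    have "(y u)\<^sup>2 / x u \<le> x u"
      using yx[OF 0] y0[of u] x0[of u]
      by (cases "x u = 0") (auto simp: divide_le_eq power2_eq_square intro: mult_mono)
    then have "Q u \<le> ennreal (x u)" unfolding Q_def by (rule ennreal_leI)
    also have "\<dots> = f u" using fin[OF 0] by (simp add: x_def ennreal_enn2real)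
    finally show ?case by simp
  next
    case (Suc n)
    have "Q u + of_nat (Suc n) * (c * E u) = Q u + c * E u + of_nat n * (c * E u)"
      by (simp add: distrib_right add.assoc)
    also have "\<dots> \<le> step P Q u + of_nat n * (c * step P E u)"
      using Q E Suc.prems by (intro add_mono mult_left_mono) auto
    also have "\<dots> = step P (\<lambda>w. Q w + of_nat n * (c * E w)) u"
      by (simp add: step_add step_cmult)
    also have "\<dots> \<le> step P f u"
      using Suc.IH upclosedD[OF U Suc.prems] by (intro step_mono) auto
    also have "\<dots> = f u" using f Suc.prems by (simp add: harmonic_on_def)
    finally show ?case .
  qed
  have "of_nat n * (c * E v) \<le> f v" for n
    using main[OF v, of n] by (rule order_trans[rotated]) simp
  then have "\<infinity> * (c * E v) \<le> f v" by (rule ennreal_top_mult_le)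
  then have "c * E v = 0" using fin[OF v] by (auto simp: ennreal_top_mult top_unique split: if_splits)
  then have "E v = 0" using mult_pos_pos[OF w(1,2)] by (auto simp: c_def ennreal_eq_0_iff)
  then have "(d v)\<^sup>2 / x v \<le> 0" by (simp add: E_def ennreal_eq_0_iff)
  moreover have "0 \<le> (d v)\<^sup>2 / x v" using x0 by simp
  ultimately have "(d v)\<^sup>2 / x v = 0" by (rule antisym)
  then have "d v = 0" using d_0[OF v] by auto
  then have eq: "w2 * a v = w1 * b v" by (simp add: d_def)
  \<comment> \<open>Substituting \<open>w2 * a v = w1 * b v\<close> turns the right sides into
    \<open>w1 * y v\<close> and \<open>w2 * y v\<close>.\<close>
  have "a v = w1 * a v + w2 * a v" "b v = w1 * b v + w2 * b v"
    using w(3) by (metis distrib_right mult_1)+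
  then have "a v = w1 * y v" "b v = w2 * y v"
    unfolding yab[OF v] distrib_left using eq by simp_all
  then have "ennreal (a v) = ennreal w1 * ennreal (y v)" "ennreal (b v) = ennreal w2 * ennreal (y v)"
    using w y0[of v] by (simp_all add: ennreal_mult)
  then show "step1 G1 g v = ennreal w1 * g v" "step2 G2 g v = ennreal w2 * g v"
    using fin1[OF v] fin2[OF v] gfin[OF v] by (simp_all add: a_def b_def y_def)
qed

end

lemma extremal_on_scale:
  assumes "extremal_on G U f" "0 < c"
  shows "extremal_on G U (\<lambda>v. ennreal c * f v)"
  unfolding extremal_on_def
proof (intro conjI allI impI)
  show "harmonic_on G U (\<lambda>v. ennreal c * f v)" "\<forall>v\<in>U. ennreal c * f v < \<infinity>"
    using assms by (auto simp: extremal_on_def harmonic_on_def step_cmult ennreal_mult_less_top)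
  fix g assume "harmonic_on G U g \<and> (\<forall>v\<in>U. g v \<le> ennreal c * f v)"
  then obtain c' where c': "c' \<ge> 0" "\<And>v. v \<in> U \<Longrightarrow> g v = ennreal c' * f v"
    using extremal_on_dominated[OF assms(1), of g c] assms(2) by auto
  have "g v = ennreal (c' / c) * (ennreal c * f v)" if "v \<in> U" for v
    using c'(2)[OF that] assms(2) c'(1) by (simp flip: mult.assoc ennreal_mult)
  then show "\<exists>c'\<ge>0. \<forall>v\<in>U. g v = ennreal c' * (ennreal c * f v)"
    using c'(1) assms(2) by (intro exI[of _ "c' / c"]) auto
qed

lemma (in graded_graph) below_grade: "below G v w \<Longrightarrow> grade G v < grade G w"
  unfolding below_def by (induction rule: tranclp_induct) (auto simp: edge_def)

lemma beloweq_edge: "edge G v w \<Longrightarrow> beloweq G w u \<Longrightarrow> below G v u"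
  by (auto simp: beloweq_def below_def)

lemma ennreal_proportional:
  fixes x y a b :: ennreal
  assumes "a \<noteq> 0" "a \<noteq> top" "b \<noteq> top" "x * a = y * b"
  shows "x = ennreal (enn2real b / enn2real a) * y"
proof -
  obtain a' where a': "a = ennreal a'" "0 < a'" using assms(1,2) by (cases a) (auto simp: less_le)
  obtain b' where b': "b = ennreal b'" "0 \<le> b'" using assms(3) by (cases b) auto
  have "x = (x * a) * ennreal (1 / a')"
    using a' by (simp add: mult.assoc flip: ennreal_mult)
  also have "\<dots> = y * (b * ennreal (1 / a'))" by (simp add: assms(4) mult.assoc)
  also have "\<dots> = ennreal (b' / a') * y"
    using a' b' by (simp add: mult.commute flip: ennreal_mult)
  finally show ?thesis using a' b' by simp
qed

context graph_pair
begin

text \<open>By \<open>eigen_dominated\<close> a competitor is a joint eigenfunction, so its untilted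
  form \<open>H\<close> is harmonic in each variable. Then every section of \<open>H\<close> in
  \<open>l\<close> is a multiple of \<open>f1\<close>, and the section at \<open>p\<close> is a
  multiple of \<open>f2\<close>; as \<open>f1 p\<close> is nonzero, this fixes how the multiples
  depend on \<open>m\<close>.\<close>

lemma extremal_on_product:
  assumes U1: "upclosed G1 U1" and U2: "upclosed G2 U2"
    and w: "0 < w1" "0 < w2" "w1 + w2 = 1"
    and f1: "extremal_on G1 U1 f1" and f2: "extremal_on G2 U2 f2"
    and p: "p \<in> U1" "f1 p \<noteq> 0"
  shows "extremal_on P (U1 \<times> U2) (\<lambda>v. tilt G1 G2 w1 w2 v * (f1 (fst v) * f2 (snd v)))"
    (is "extremal_on P ?U ?f")
  unfolding extremal_on_def
proof (intro conjI allI impI)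
  have U: "upclosed P ?U" by (rule upclosed_prod[OF U1 U2])
  have h: "harmonic_on G1 U1 f1" "harmonic_on G2 U2 f2"
    using f1 f2 by (auto simp: extremal_on_def)
  have fin1: "f1 l < \<infinity>" and fin2: "f2 m < \<infinity>" if "l \<in> U1" "m \<in> U2" for l m
    using f1 f2 that by (auto simp: extremal_on_def)
  have eig: "step1 G1 ?f v = ennreal w1 * ?f v" "step2 G2 ?f v = ennreal w2 * ?f v" if "v \<in> ?U" for v
    using product_eigen[OF w(1,2) h that] .
  show "harmonic_on P ?U ?f"
    using w eig upclosed_subset[OF U] by (intro eigen_harmonic_on[of _ w1 w2]) auto
  have fin: "?f v < \<infinity>" if "v \<in> ?U" for v
    using that fin1[of "fst v" "snd v"] fin2[of "fst v" "snd v"]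
    by (auto simp: ennreal_mult_less_top tilt_def)
  then show "\<forall>v\<in>?U. ?f v < \<infinity>" by blast
  fix g assume g: "harmonic_on P ?U g \<and> (\<forall>v\<in>?U. g v \<le> ?f v)"
  define H where "H v = tilt G1 G2 (1 / w1) (1 / w2) v * g v" for v
  have "step1 G1 g v = ennreal w1 * g v" "step2 G2 g v = ennreal w2 * g v" if "v \<in> ?U" for v
    using eigen_dominated[OF U w eig fin conjunct1[OF g] _ that] g by auto
  then have bih: "biharmonic_on G1 G2 ?U H"
    unfolding H_def by (intro biharmonic_untilt[OF w(1,2)])
  have gH: "g v = tilt G1 G2 w1 w2 v * H v" for v
    unfolding H_def by (rule tilt_inverse[symmetric, OF w(1,2)])
  have Hle: "H (l, m) \<le> f1 l * f2 m" if "l \<in> U1" "m \<in> U2" for l m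
    using g that mult_left_mono[of "g (l, m)" "?f (l, m)" "tilt G1 G2 (1 / w1) (1 / w2) (l, m)"]
    by (simp add: H_def tilt_inverse'[OF w(1,2)])
  have "\<exists>c\<ge>0. \<forall>l\<in>U1. H (l, m) = ennreal c * f1 l" if m: "m \<in> U2" for m
  proof (rule extremal_on_dominated[OF f1])
    show "harmonic_on G1 U1 (\<lambda>l. H (l, m))"
      using bih m by (auto simp: biharmonic_on_def harmonic_on_def step1_def)
    show "H (l, m) \<le> ennreal (enn2real (f2 m)) * f1 l" if "l \<in> U1" for l
      using Hle[OF that m] fin2[OF that m] by (simp add: ennreal_enn2real mult.commute)
  qed simp
  then obtain c where c: "\<And>m. m \<in> U2 \<Longrightarrow> c m \<ge> 0" "\<And>m l. m \<in> U2 \<Longrightarrow> l \<in> U1 \<Longrightarrow> H (l, m) = ennreal (c m) * f1 l"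
    by metis
  have "\<exists>c\<ge>0. \<forall>m\<in>U2. H (p, m) = ennreal c * f2 m"
  proof (rule extremal_on_dominated[OF f2])
    show "harmonic_on G2 U2 (\<lambda>m. H (p, m))"
      using bih p by (auto simp: biharmonic_on_def harmonic_on_def step2_def)
    show "H (p, m) \<le> ennreal (enn2real (f1 p)) * f2 m" if "m \<in> U2" for m
      using Hle[OF p(1) that] fin1[OF p(1) that] by (simp add: ennreal_enn2real)
  qed simp
  then obtain c' where c': "c' \<ge> 0" "\<And>m. m \<in> U2 \<Longrightarrow> H (p, m) = ennreal c' * f2 m" by auto
  \<comment> \<open>At \<open>l = p\<close> the two proportionalities give
    \<open>c m * f1 p = c' * f2 m\<close>, which determines \<open>c m\<close>.\<close>
  define r where "r = c' / enn2real (f1 p)"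
  have "g v = ennreal r * ?f v" if "v \<in> ?U" for v
  proof -
    obtain l m where v: "v = (l, m)" "l \<in> U1" "m \<in> U2" using \<open>v \<in> ?U\<close> by auto
    have "ennreal (c m) = ennreal (enn2real (ennreal c') / enn2real (f1 p)) * f2 m"
      using c(2)[OF v(3) p(1)] c'(2)[OF v(3)] p(2) fin1[OF p(1) v(3)]
      by (intro ennreal_proportional) (auto simp: mult.commute)
    then have "ennreal (c m) = ennreal r * f2 m" using c'(1) by (simp add: r_def)
    then have "H v = ennreal r * (f1 l * f2 m)"
      using c(2)[OF v(3,2)] v(1) by (simp add: mult_ac)
    then show ?thesis by (simp add: gH v(1) mult.left_commute)
  qed
  then show "\<exists>c\<ge>0. \<forall>v\<in>?U. g v = ennreal c * ?f v"
    using c'(1) by (intro exI[of _ r]) (auto simp: r_def)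
qed

lemma determined_by_prod_form:
  assumes "prod_form G1 G2 \<phi> w1 w2 \<phi>1 \<phi>2"
  shows "\<exists>v. determined_by P \<phi> v"
proof -
  have w: "0 < w1" "0 < w2" "w1 + w2 = 1"
    and eq: "\<And>v. v \<in> verts P \<Longrightarrow> \<phi> v = tilt G1 G2 w1 w2 v * (\<phi>1 (fst v) * \<phi>2 (snd v))"
    using assms by (auto simp: prod_form_def tilt_def mult.assoc)
  obtain p q where p: "determined_by G1 \<phi>1 p" and q: "determined_by G2 \<phi>2 q"
    using assms A.H_ex_determined_by B.H_ex_determined_by by (metis prod_form_def)
  have pv: "p \<in> verts G1" "q \<in> verts G2"
    and extension: "extremal_on G1 (upset G1 p) \<phi>1" "extremal_on G2 (upset G2 q) \<phi>2"
    and U: "upclosed G1 (upset G1 p)" "upclosed G2 (upset G2 q)"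
    using p q upclosed_upset by (auto simp: determined_by_def)
  have "determined_by P \<phi> (p, q)"
  proof (rule P.determined_byI)
    let ?f = "\<lambda>v. tilt G1 G2 w1 w2 v * (\<phi>1 (fst v) * \<phi>2 (snd v))"
    show "(p, q) \<in> verts P" using pv by simp
    show "0 < ?f (p, q)"
      using determined_by_point(2)[OF p] determined_by_point(2)[OF q]
        tilt_pos_finite(1)[OF w(1,2), of G1 G2 "(p, q)"]
      by (simp add: zero_less_iff_neq_zero)
    show "extremal_on P (upset P (p, q)) ?f"
      unfolding upset_prod[OF pv] using determined_by_point(2)[OF p]
      by (intro extremal_on_product[OF U w extension upset_refl])
    show "\<phi> v = extension P (upset P (p, q)) ?f v" if "v \<in> verts P" for v
      unfolding upset_prod[OF pv]
      using extension_product[OF U w, of \<phi>1 \<phi>2 v] extension that eq[OF that] p q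
      by (auto simp: extremal_on_def determined_by_def)
  qed
  then show ?thesis by blast
qed

subsection \<open>Functions concentrated over one vertex\<close>

definition over :: "('a \<Rightarrow> ennreal) \<Rightarrow> 'b \<Rightarrow> 'a \<times> 'b \<Rightarrow> ennreal" where
  "over f q v = (if snd v = q then f (fst v) else 0)"

text \<open>The cases of \<open>left_form\<close> as one total function; by
  \<open>extension_over\<close> it is the closed form of the extension of
  \<open>over\<close>.\<close>

definition spread :: "('a \<Rightarrow> ennreal) \<Rightarrow> 'b \<Rightarrow> 'a \<times> 'b \<Rightarrow> ennreal" where
  "spread f q v = (if snd v = q then f (fst v) else if below G2 (snd v) q then \<infinity> * f (fst v) else 0)"

lemma left_form_iff:
  "left_form G1 G2 \<phi> \<phi>1 q \<longleftrightarrow> \<phi>1 \<in> H_ex G1 \<and> q \<in> verts G2 \<and> (\<forall>v\<in>verts P. \<phi> v = spread \<phi>1 q v)"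
  using B.below_grade[of q q] by (auto simp: left_form_def spread_def beloweq_def)

lemma step1_spread:
  "step1 G1 (spread f q) (l, m) = (if m = q then step G1 f l else if below G2 m q then \<infinity> * step G1 f l else 0)"
  by (auto simp: step1_def spread_def step_cmult step_zero)

lemma step2_spread_q: "\<not> below G2 m q \<Longrightarrow> step2 G2 (spread f q) (l, m) = 0"
proof -
  assume *: "\<not> below G2 m q"
  have "step2 G2 (spread f q) (l, m) = step2 G2 (\<lambda>v. 0 :: ennreal) (l, m)"
    using * beloweq_edge[of G2 m _ q] by (intro step2_cong) (auto simp: spread_def beloweq_def)
  then show ?thesis by (simp add: step2_def step_zero)
qed

text \<open>Off the vertices below \<open>q\<close>, no successor in the second coordinate reaches
  \<open>q\<close>, so \<open>step2\<close> contributes nothing. Below \<open>q\<close>,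
  \<open>step1\<close> alone already yields \<open>\<infinity>\<close> if \<open>f l\<close> is
  nonzero, and if \<open>f l = 0\<close> everything over \<open>l\<close> vanishes.\<close>

lemma spread_harmonic:
  assumes f: "harmonic_on G1 (verts G1) f"
  shows "harmonic_on P (verts P) (spread f q)"
  unfolding harmonic_on_def
proof
  fix v assume v: "v \<in> verts P"
  obtain l m where lm: "v = (l, m)" "l \<in> verts G1" using v by (cases v) auto
  have fl: "step G1 f l = f l" using f lm by (simp add: harmonic_on_def)
  have not: "\<not> below G2 q q" using B.below_grade[of q q] by auto
  consider "\<not> below G2 m q" | "below G2 m q" "m \<noteq> q" using not by auto
  then show "step P (spread f q) v = spread f q v"
  proof cases
    case 1
    then show ?thesis
      using fl step_prod[OF v, of "spread f q"] unfolding lm(1) step1_spread step2_spread_q[OF 1]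
      by (auto simp: spread_def)
  next
    case 2
    have "step2 G2 (spread f q) (l, m) = 0" if "f l = 0"
      using that by (simp add: step2_def spread_def step_zero cong: if_cong)
    with 2 show ?thesis
      using fl step_prod[OF v, of "spread f q"] unfolding lm(1) step1_spread
      by (cases "f l = 0") (auto simp: spread_def ennreal_top_mult)
  qed
qed

lemma spread_eq_over:
  assumes "m \<in> upset G2 q" shows "spread f q (l, m) = over f q (l, m)"
proof -
  have "\<not> below G2 m q"
    using assms B.below_grade[of m q] B.below_grade[of q m]
    by (auto simp: beloweq_def simp flip: beloweq_iff_upset)
  then show ?thesis by (simp add: spread_def over_def)
qed

text \<open>Within the up-set of \<open>q\<close> no edge leads back to \<open>q\<close>, so
  \<open>step2\<close> sees only zeros.\<close>

lemma over_harmonic_on: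
  assumes U1: "upclosed G1 U1" and q: "q \<in> verts G2" and f: "harmonic_on G1 U1 f"
  shows "harmonic_on P (U1 \<times> upset G2 q) (over f q)"
  unfolding harmonic_on_def
proof
  fix v assume "v \<in> U1 \<times> upset G2 q"
  then obtain l m where v: "v = (l, m)" "l \<in> U1" "m \<in> upset G2 q" by auto
  have vP: "v \<in> verts P"
    using v upclosed_subset[OF U1] upclosed_subset[OF upclosed_upset[OF q]] by auto
  have "step2 G2 (over f q) v = step2 G2 (\<lambda>v. 0 :: ennreal) v"
    using v B.below_grade[of m q] beloweq_iff_upset[of G2 q m] B.below_grade[of q m]
    by (intro step2_cong) (auto simp: over_def beloweq_def edge_def)
  then have "step P (over f q) v = step1 G1 (over f q) v"
    using step_prod[OF vP] by (simp add: step2_def step_zero)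
  also have "\<dots> = over f q v"
    using f v by (auto simp: step1_def over_def harmonic_on_def step_zero)
  finally show "step P (over f q) v = over f q v" .
qed

text \<open>The value \<open>\<infinity>\<close> is forced: over a vertex with an edge to
  \<open>q\<close>, the harmonic equation makes \<open>\<Phi>\<close> at least its own
  \<open>step1\<close> plus a positive multiple of \<open>\<phi>1\<close>. Since
  \<open>step1\<close> reproduces what has been collected so far, every multiple of
  \<open>\<phi>1\<close> lies below \<open>\<phi>\<close>'s extension \<open>\<Phi>\<close>. The
  claim descends edge by edge from \<open>q\<close>.\<close>

lemma extension_over:
  assumes U1: "upclosed G1 U1" and q: "q \<in> verts G2" and f: "harmonic_on G1 U1 f" and v: "v \<in> verts P"
  shows "extension P (U1 \<times> upset G2 q) (over f q) v = spread (extension G1 U1 f) q v"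
proof (rule antisym)
  have U2: "upclosed G2 (upset G2 q)" by (rule upclosed_upset[OF q])
  have U: "upclosed P (U1 \<times> upset G2 q)" by (rule upclosed_prod[OF U1 U2])
  have h: "harmonic_on P (U1 \<times> upset G2 q) (over f q)" by (rule over_harmonic_on[OF U1 q f])
  have "over f q u \<le> spread (extension G1 U1 f) q u" if "u \<in> U1 \<times> upset G2 q" for u
    using that extension_on[OF U1 f] by (cases u) (auto simp: spread_eq_over, auto simp: over_def)
  then show "extension P (U1 \<times> upset G2 q) (over f q) v \<le> spread (extension G1 U1 f) q v"
    using v extension_harmonic[OF U1 f] by (intro extension_least_harmonic spread_harmonic)
  define \<Phi> where "\<Phi> = extension P (U1 \<times> upset G2 q) (over f q)"
  define \<phi>1 where "\<phi>1 = extension G1 U1 f"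
  have \<phi>1: "step G1 \<phi>1 l = \<phi>1 l" for l unfolding \<phi>1_def by (rule extension_step[OF U1 f])
  have \<Phi>: "step1 G1 \<Phi> u + step2 G2 \<Phi> u = \<Phi> u" if "u \<in> verts P" for u
    using step_prod[OF that, of \<Phi>] extension_step[OF U h, of u] by (simp add: \<Phi>_def)
  \<comment> \<open>Dropping the nonnegative \<open>step2\<close> term leaves a superharmonic
    section, which is what \<open>extension_least\<close> asks for.\<close>
  have base: "\<phi>1 l \<le> \<Phi> (l, q)" if "l \<in> verts G1" for l
    unfolding \<phi>1_def
  proof (rule extension_least[OF _ _ that])
    fix l assume "l \<in> verts G1"
    then have "step1 G1 \<Phi> (l, q) + step2 G2 \<Phi> (l, q) = \<Phi> (l, q)" using \<Phi> q by simp
    then show "step G1 (\<lambda>l. \<Phi> (l, q)) l \<le> \<Phi> (l, q)"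
      by (metis step1_def fst_conv snd_conv le_iff_add)
  next
    fix l assume "l \<in> U1"
    then show "f l \<le> \<Phi> (l, q)"
      using extension_on[OF U h, of "(l, q)"] by (simp add: \<Phi>_def over_def)
  qed
  have up: "\<infinity> * \<phi>1 l \<le> \<Phi> (l, m)"
    if e: "edge G2 m m'" and le: "\<And>l. l \<in> verts G1 \<Longrightarrow> \<phi>1 l \<le> \<Phi> (l, m')" and l: "l \<in> verts G1" for l m m'
  proof -
    define k where "k = ennreal (kappa G2 m m')"
    have k: "k \<noteq> 0" using B.kappa_pos[OF e] by (simp add: k_def ennreal_eq_0_iff)
    have mv: "m \<in> verts G2" using e by (simp add: edge_def)
    have "of_nat n * (k * \<phi>1 l) \<le> \<Phi> (l, m)" for n
      using l
    proof (induction n arbitrary: l)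
      case 0 show ?case by simp
    next
      case (Suc n)
      have "of_nat n * (k * \<phi>1 l) = step G1 (\<lambda>l. of_nat n * (k * \<phi>1 l)) l"
        by (simp add: step_cmult \<phi>1)
      also have "\<dots> \<le> step1 G1 \<Phi> (l, m)"
        unfolding step1_def fst_conv snd_conv using Suc.IH by (intro step_mono) (auto simp: edge_def)
      finally have 1: "of_nat n * (k * \<phi>1 l) \<le> step1 G1 \<Phi> (l, m)" .
      have "k * \<phi>1 l \<le> k * \<Phi> (l, m')" using le[OF Suc.prems] by (rule mult_left_mono) simp
      also have "\<dots> \<le> step2 G2 \<Phi> (l, m)"
        using B.step_ge[OF e, of "\<lambda>m. \<Phi> (l, m)"] by (simp add: step2_def k_def)
      finally have "of_nat n * (k * \<phi>1 l) + k * \<phi>1 l \<le> step1 G1 \<Phi> (l, m) + step2 G2 \<Phi> (l, m)"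
        by (rule add_mono[OF 1])
      then show ?case
        using \<Phi>[of "(l, m)"] Suc.prems mv by (simp add: distrib_right add.commute)
    qed
    then have "\<infinity> * (k * \<phi>1 l) \<le> \<Phi> (l, m)" by (rule ennreal_top_mult_le)
    then show ?thesis using k by (simp add: ennreal_top_mult split: if_splits)
  qed
  have below: "\<infinity> * \<phi>1 l \<le> \<Phi> (l, m)" if "below G2 m q" "l \<in> verts G1" for l m
    using that unfolding below_def
  proof (induction arbitrary: l rule: converse_tranclp_induct)
    case (base m)
    show ?case by (rule up[OF base(1) \<open>\<And>l. l \<in> verts G1 \<Longrightarrow> \<phi>1 l \<le> \<Phi> (l, q)\<close> base(2)])
  next
    case (step m m')
    have "\<phi>1 l \<le> \<Phi> (l, m')" if "l \<in> verts G1" for l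
      using step.IH[OF that] by (rule order_trans[rotated]) (auto simp: ennreal_top_mult)
    then show ?case by (rule up[OF step.hyps(1) _ step.prems])
  qed
  show "spread (extension G1 U1 f) q v \<le> extension P (U1 \<times> upset G2 q) (over f q) v"
    using v base below by (cases v) (auto simp: spread_def simp flip: \<Phi>_def \<phi>1_def)
qed

text \<open>A competitor below \<open>over f q\<close> also lives over \<open>q\<close>, where its
  \<open>step2\<close> vanishes; its section there is a competitor to \<open>f\<close>.\<close>

lemma extremal_on_over:
  assumes U1: "upclosed G1 U1" and q: "q \<in> verts G2" and f: "extremal_on G1 U1 f"
  shows "extremal_on P (U1 \<times> upset G2 q) (over f q)"
  unfolding extremal_on_def
proof (intro conjI allI impI)
  show "harmonic_on P (U1 \<times> upset G2 q) (over f q)"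
    using f by (intro over_harmonic_on[OF U1 q]) (auto simp: extremal_on_def)
  show "\<forall>v\<in>U1 \<times> upset G2 q. over f q v < \<infinity>"
    using f by (auto simp: extremal_on_def over_def)
  fix g assume g: "harmonic_on P (U1 \<times> upset G2 q) g \<and> (\<forall>v\<in>U1 \<times> upset G2 q. g v \<le> over f q v)"
  have U2: "upclosed G2 (upset G2 q)" by (rule upclosed_upset[OF q])
  have g0: "g (l, m) = 0" if "l \<in> U1" "m \<in> upset G2 q" "m \<noteq> q" for l m
    using g that by (force simp: over_def)
  have "harmonic_on G1 U1 (\<lambda>l. g (l, q))"
    unfolding harmonic_on_def
  proof
    fix l assume l: "l \<in> U1"
    then have vP: "(l, q) \<in> verts P" using q upclosed_subset[OF U1] by auto
    have "g (l, m) = 0" if "edge G2 q m" for m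
      using g0[OF l upclosedD[OF U2 upset_refl that]] that by (cases "m = q") (auto simp: edge_def)
    then have "step2 G2 g (l, q) = step2 G2 (\<lambda>v. 0 :: ennreal) (l, q)"
      by (intro step2_cong) auto
    then have "step P g (l, q) = step G1 (\<lambda>l. g (l, q)) l"
      using step_prod[OF vP, of g] by (simp add: step1_def step2_def step_zero)
    then show "step G1 (\<lambda>l. g (l, q)) l = g (l, q)"
      using g l by (auto simp: harmonic_on_def)
  qed
  moreover have "\<forall>l\<in>U1. g (l, q) \<le> f l"
  proof
    fix l assume "l \<in> U1"
    then have "g (l, q) \<le> over f q (l, q)"
      using g[THEN conjunct2, rule_format, of "(l, q)"] by simp
    then show "g (l, q) \<le> f l" by (simp add: over_def)
  qed
  ultimately obtain c where c: "c \<ge> 0" "\<And>l. l \<in> U1 \<Longrightarrow> g (l, q) = ennreal c * f l"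
    using f unfolding extremal_on_def by meson
  have "g v = ennreal c * over f q v" if "v \<in> U1 \<times> upset G2 q" for v
    using that c(2) g0 by (auto simp: over_def)
  with c(1) show "\<exists>c\<ge>0. \<forall>v\<in>U1 \<times> upset G2 q. g v = ennreal c * over f q v" by blast
qed

lemma determined_by_left_form:
  assumes "left_form G1 G2 \<phi> \<phi>1 q"
  shows "\<exists>p. determined_by P \<phi> (p, q)"
proof -
  have q: "q \<in> verts G2" and eq: "\<And>v. v \<in> verts P \<Longrightarrow> \<phi> v = spread \<phi>1 q v"
    using assms by (auto simp: left_form_iff)
  obtain p where p: "determined_by G1 \<phi>1 p"
    using assms A.H_ex_determined_by by (metis left_form_iff)
  have pv: "p \<in> verts G1" and ex: "extremal_on G1 (upset G1 p) \<phi>1"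
    and U: "upclosed G1 (upset G1 p)"
    using p upclosed_upset by (auto simp: determined_by_def)
  have "determined_by P \<phi> (p, q)"
  proof (rule P.determined_byI)
    show "(p, q) \<in> verts P" using pv q by simp
    show "0 < over \<phi>1 q (p, q)" using determined_by_point(2)[OF p] by (simp add: over_def zero_less_iff_neq_zero)
    show "extremal_on P (upset P (p, q)) (over \<phi>1 q)"
      unfolding upset_prod[OF pv q] by (rule extremal_on_over[OF U q ex])
    show "\<phi> v = extension P (upset P (p, q)) (over \<phi>1 q) v" if "v \<in> verts P" for v
      unfolding upset_prod[OF pv q]
      using extension_over[OF U q, of \<phi>1 v] ex that eq[OF that] p
      by (auto simp: extremal_on_def determined_by_def spread_def)
  qed
  then show ?thesis by blast
qed

end

context graph_pair
begin

subsection \<open>Classification\<close>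

text \<open>The partial steps commute with the full one, so both images of \<open>\<phi>\<close> are
  harmonic; they lie below \<open>\<phi>\<close>, and extremality makes them multiples of it.
  Cancelling \<open>\<phi> v0\<close> in their sum gives \<open>w1 + w2 = 1\<close>.\<close>

lemma determined_eigen:
  assumes d: "determined_by P \<phi> v0"
  obtains w1 w2 where "0 \<le> w1" "0 \<le> w2" "w1 + w2 = 1"
    "\<And>v. v \<in> upset P v0 \<Longrightarrow> step1 G1 \<phi> v = ennreal w1 * \<phi> v"
    "\<And>v. v \<in> upset P v0 \<Longrightarrow> step2 G2 \<phi> v = ennreal w2 * \<phi> v"
proof -
  let ?U = "upset P v0"
  have U: "upclosed P ?U" using upclosed_upset[OF determined_by_point(1)[OF d]] .
  have ex: "extremal_on P ?U \<phi>" using d by (auto simp: determined_by_def)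
  then have h: "harmonic_on P ?U \<phi>" by (auto simp: extremal_on_def)
  have le: "step1 G1 \<phi> v \<le> \<phi> v" "step2 G2 \<phi> v \<le> \<phi> v" if "v \<in> ?U" for v
    using step1_le[of v \<phi>] step2_le[of v \<phi>] h that upclosed_subset[OF U] by (auto simp: harmonic_on_def)
  obtain w1 where w1: "w1 \<ge> 0" "\<And>v. v \<in> ?U \<Longrightarrow> step1 G1 \<phi> v = ennreal w1 * \<phi> v"
    using ex step1_harmonic_on[OF U h] le(1) unfolding extremal_on_def by meson
  obtain w2 where w2: "w2 \<ge> 0" "\<And>v. v \<in> ?U \<Longrightarrow> step2 G2 \<phi> v = ennreal w2 * \<phi> v"
    using ex step2_harmonic_on[OF U h] le(2) unfolding extremal_on_def by meson
  have "\<phi> v0 * (ennreal w1 + ennreal w2) = \<phi> v0 * 1"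
    using step_prod[of v0 \<phi>] w1(2) w2(2) h determined_by_point(1)[OF d]
    by (simp add: harmonic_on_def distrib_left mult.commute)
  then have "ennreal w1 + ennreal w2 = 1"
    using determined_by_point(2,3)[OF d] unfolding ennreal_mult_cancel_left by auto
  then have "w1 + w2 = 1" using w1(1) w2(1) by (simp flip: ennreal_plus)
  then show thesis using that w1 w2 by blast
qed

text \<open>Tilting turns a competitor harmonic in each variable into a harmonic competitor below
  \<open>\<phi>\<close>.\<close>

lemma biextremal_untilt:
  assumes w: "0 < w1" "0 < w2" "w1 + w2 = 1" and U: "U \<subseteq> verts P"
    and ex: "extremal_on P U \<phi>"
    and 1: "\<And>v. v \<in> U \<Longrightarrow> step1 G1 \<phi> v = ennreal w1 * \<phi> v"
    and 2: "\<And>v. v \<in> U \<Longrightarrow> step2 G2 \<phi> v = ennreal w2 * \<phi> v"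
  shows "biextremal_on G1 G2 U (\<lambda>v. tilt G1 G2 (1 / w1) (1 / w2) v * \<phi> v)"
    (is "biextremal_on G1 G2 U ?F")
  unfolding biextremal_on_def
proof (intro conjI allI impI)
  show "biharmonic_on G1 G2 U ?F" using 1 2 by (rule biharmonic_untilt[OF w(1,2)])
  show "\<forall>v\<in>U. ?F v < \<infinity>"
    using ex by (auto simp: extremal_on_def ennreal_mult_less_top tilt_def)
  fix H assume H: "biharmonic_on G1 G2 U H \<and> (\<forall>v\<in>U. H v \<le> ?F v)"
  define g where "g = (\<lambda>v. tilt G1 G2 w1 w2 v * H v)"
  have "harmonic_on P U g"
    using w U H unfolding g_def
    by (intro eigen_harmonic_on[of U w1 w2]) (auto simp: step1_tilt step2_tilt biharmonic_on_def)
  moreover have "g v \<le> \<phi> v" if "v \<in> U" for v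
  proof -
    have "g v \<le> tilt G1 G2 w1 w2 v * ?F v"
      unfolding g_def using H that by (intro mult_left_mono) auto
    then show ?thesis by (simp only: tilt_inverse[OF w(1,2)])
  qed
  ultimately obtain c where c: "c \<ge> 0" "\<And>v. v \<in> U \<Longrightarrow> g v = ennreal c * \<phi> v"
    using ex unfolding extremal_on_def by meson
  have "H v = ennreal c * ?F v" if "v \<in> U" for v
  proof -
    have "H v = tilt G1 G2 (1 / w1) (1 / w2) v * g v"
      unfolding g_def by (rule tilt_inverse'[symmetric, OF w(1,2)])
    then show ?thesis using c(2)[OF that] by (simp add: mult.left_commute)
  qed
  with c(1) show "\<exists>c\<ge>0. \<forall>v\<in>U. H v = ennreal c * ?F v" by blast
qed

text \<open>By \<open>upset_bound\<close> in the first variable, each section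
  \<open>F (l, _)\<close> is dominated by a multiple of \<open>F (p, _)\<close>. The latter is
  extremal by \<open>biextremal_section\<close>, so all these sections are proportional.\<close>

lemma biextremal_product:
  assumes p: "p \<in> verts G1" and q: "q \<in> verts G2"
    and F: "biextremal_on G1 G2 (upset G1 p \<times> upset G2 q) F" and F0: "F (p, q) \<noteq> 0"
  obtains f1 f2 where "extremal_on G1 (upset G1 p) f1" "extremal_on G2 (upset G2 q) f2"
    "f1 p \<noteq> 0" "f2 q \<noteq> 0"
    "\<And>v. v \<in> upset G1 p \<times> upset G2 q \<Longrightarrow> F v = f1 (fst v) * f2 (snd v)"
proof -
  interpret S: graph_pair G2 G1 by unfold_locales
  have U: "upclosed G1 (upset G1 p)" "upclosed G2 (upset G2 q)"
    using upclosed_upset[OF p] upclosed_upset[OF q] by simp_all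
  have ex2: "extremal_on G2 (upset G2 q) (\<lambda>m. F (p, m))"
    by (rule biextremal_section[OF U F upset_refl])
  have ex1: "extremal_on G1 (upset G1 p) (\<lambda>l. F (l, q))"
    using S.biextremal_section[OF U(2,1) biextremal_on_swap[OF F] upset_refl] by simp
  have h1: "harmonic_on G1 (upset G1 p) (\<lambda>l. F (l, m))" if "m \<in> upset G2 q" for m
    using F that by (auto simp: biextremal_on_def biharmonic_on_def harmonic_on_def step1_def)
  have h2: "harmonic_on G2 (upset G2 q) (\<lambda>m. F (l, m))" if "l \<in> upset G1 p" for l
    using F that by (auto simp: biextremal_on_def biharmonic_on_def harmonic_on_def step2_def)
  have Ffin: "F (p, q) < \<infinity>" using F by (auto simp: biextremal_on_def)
  then obtain r where r: "F (p, q) = ennreal r" "0 < r"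
    using F0 by (cases "F (p, q)") (auto simp: less_le)
  \<comment> \<open>The factors are the two sections through \<open>(p, q)\<close>; the common value
    \<open>F (p, q) = r\<close> must be divided out once.\<close>
  define f2 where "f2 m = ennreal (1 / r) * F (p, m)" for m
  have "F (l, m) = F (l, q) * f2 m" if l: "l \<in> upset G1 p" and m: "m \<in> upset G2 q" for l m
  proof -
    obtain s where s: "s \<ge> 0" "\<And>h. harmonic_on G1 (upset G1 p) h \<Longrightarrow> h l \<le> ennreal s * h p"
      using A.upset_bound[OF l] by blast
    have "\<exists>c\<ge>0. \<forall>m\<in>upset G2 q. F (l, m) = ennreal c * F (p, m)"
      by (rule extremal_on_dominated[OF ex2 h2[OF l] s(1) s(2)[OF h1]])
    then obtain c where c: "\<And>m. m \<in> upset G2 q \<Longrightarrow> F (l, m) = ennreal c * F (p, m)" by auto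
    have "F (l, q) * ennreal (1 / r) = ennreal c"
      using c[OF upset_refl] r by (simp add: mult.assoc flip: ennreal_mult)
    then show ?thesis using c[OF m] by (simp add: f2_def flip: mult.assoc)
  qed
  then have "F v = F (fst v, q) * f2 (snd v)" if "v \<in> upset G1 p \<times> upset G2 q" for v
    using that by (metis mem_Times_iff prod.collapse)
  moreover have "extremal_on G2 (upset G2 q) f2"
    unfolding f2_def using r by (intro extremal_on_scale[OF ex2]) simp
  moreover have "f2 q \<noteq> 0" using r by (simp add: f2_def flip: ennreal_mult)
  ultimately show thesis using F0 by (intro that[OF ex1])
qed

text \<open>The up-set is settled by \<open>biextremal_product\<close>; all other values follow
  because both sides extend the same function.\<close>

lemma prod_form_if_determined:
  assumes d: "determined_by P \<phi> (p, q)" and w: "0 < w1" "0 < w2" "w1 + w2 = 1"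
    and 1: "\<And>v. v \<in> upset P (p, q) \<Longrightarrow> step1 G1 \<phi> v = ennreal w1 * \<phi> v"
    and 2: "\<And>v. v \<in> upset P (p, q) \<Longrightarrow> step2 G2 \<phi> v = ennreal w2 * \<phi> v"
  shows "\<exists>\<phi>1 \<phi>2. prod_form G1 G2 \<phi> w1 w2 \<phi>1 \<phi>2"
proof -
  have p: "p \<in> verts G1" and q: "q \<in> verts G2" using d by (auto simp: determined_by_def)
  define U where "U = upset G1 p \<times> upset G2 q"
  have up: "upset P (p, q) = U" unfolding U_def by (rule upset_prod[OF p q])
  have U12: "upclosed G1 (upset G1 p)" "upclosed G2 (upset G2 q)" using upclosed_upset[OF p] upclosed_upset[OF q] by simp_all
  have U: "upclosed P U" unfolding U_def by (rule upclosed_prod[OF U12])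
  define F where "F = (\<lambda>v. tilt G1 G2 (1 / w1) (1 / w2) v * \<phi> v)"
  have F: "biextremal_on G1 G2 (upset G1 p \<times> upset G2 q) F"
    unfolding F_def U_def[symmetric]
    using w upclosed_subset[OF U] d 1 2
    by (intro biextremal_untilt) (auto simp: determined_by_def up)
  have "F (p, q) \<noteq> 0"
    using determined_by_point(2)[OF d] w by (simp add: F_def tilt_pos_finite)
  then obtain f1 f2 where ex: "extremal_on G1 (upset G1 p) f1" "extremal_on G2 (upset G2 q) f2"
    and nz: "f1 p \<noteq> 0" "f2 q \<noteq> 0" and Feq: "\<And>v. v \<in> U \<Longrightarrow> F v = f1 (fst v) * f2 (snd v)"
    unfolding U_def using biextremal_product[OF p q F] by metis
  define \<phi>1 \<phi>2 where "\<phi>1 = extension G1 (upset G1 p) f1" and "\<phi>2 = extension G2 (upset G2 q) f2"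
  have H: "\<phi>1 \<in> H_ex G1" "\<phi>2 \<in> H_ex G2"
    unfolding \<phi>1_def \<phi>2_def using ex nz p q
    by (auto intro!: A.determined_by_imp(3) A.determined_by_extension B.determined_by_imp(3) B.determined_by_extension
        simp: zero_less_iff_neq_zero)
  have "\<phi> v = tilt G1 G2 w1 w2 v * (\<phi>1 (fst v) * \<phi>2 (snd v))" if v: "v \<in> verts P" for v
  proof -
    have "\<phi> v = extension P U \<phi> v" using d v by (auto simp: determined_by_def up)
    also have "\<dots> = extension P U (\<lambda>v. tilt G1 G2 w1 w2 v * (f1 (fst v) * f2 (snd v))) v"
    proof (rule extension_cong)
      fix u assume "u \<in> U"
      then show "\<phi> u = tilt G1 G2 w1 w2 u * (f1 (fst u) * f2 (snd u))"
        using tilt_inverse[OF w(1,2), of G1 G2 u "\<phi> u"] Feq[of u] by (simp add: F_def)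
    qed
    also have "\<dots> = tilt G1 G2 w1 w2 v * (\<phi>1 (fst v) * \<phi>2 (snd v))"
      unfolding U_def \<phi>1_def \<phi>2_def
      using ex by (intro extension_product[OF U12 w _ _ v]) (auto simp: extremal_on_def)
    finally show ?thesis .
  qed
  then have "prod_form G1 G2 \<phi> w1 w2 \<phi>1 \<phi>2"
    using H w by (auto simp: prod_form_def tilt_def mult.assoc)
  then show ?thesis by blast
qed

text \<open>Vanishing of \<open>step2\<close> kills \<open>\<phi>\<close> on the up-set except over
  \<open>q\<close>. The remaining section is extremal because any competitor to it lifts by
  \<open>over\<close> to a competitor to \<open>\<phi>\<close>.\<close>

lemma left_form_if_determined:
  assumes d: "determined_by P \<phi> (p, q)"
    and 2: "\<And>v. v \<in> upset P (p, q) \<Longrightarrow> step2 G2 \<phi> v = 0"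
  shows "\<exists>\<phi>1. left_form G1 G2 \<phi> \<phi>1 q"
proof -
  have p: "p \<in> verts G1" and q: "q \<in> verts G2" using d by (auto simp: determined_by_def)
  define U where "U = upset G1 p \<times> upset G2 q"
  have up: "upset P (p, q) = U" unfolding U_def by (rule upset_prod[OF p q])
  have U12: "upclosed G1 (upset G1 p)" "upclosed G2 (upset G2 q)" using upclosed_upset[OF p] upclosed_upset[OF q] by simp_all
  have U: "upclosed P U" unfolding U_def by (rule upclosed_prod[OF U12])
  have ex: "extremal_on P U \<phi>" using d by (auto simp: determined_by_def up)
  define f where "f = (\<lambda>l. \<phi> (l, q))"
  have zero: "\<phi> (l, m) = 0" if l: "l \<in> upset G1 p" and m: "m \<in> upset G2 q" "m \<noteq> q" for l m
  proof -
    have "(edge G2)\<^sup>*\<^sup>* q m" using m by (simp add: upset_def)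
    \<comment> \<open>The last edge of a path from \<open>q\<close> to \<open>m\<close>: its
      positive multiplicity makes the value at \<open>m\<close> a term of a vanishing sum at
      \<open>m0\<close>.\<close>
    then obtain m0 where m0: "m0 \<in> upset G2 q" "edge G2 m0 m"
      using m(2) by (cases rule: rtranclp.cases) (auto simp: upset_def)
    have "ennreal (kappa G2 m0 m) * \<phi> (l, m) \<le> step2 G2 \<phi> (l, m0)"
      using B.step_ge[OF m0(2), of "\<lambda>m. \<phi> (l, m)"] by (simp add: step2_def)
    also have "\<dots> = 0" using 2 l m0 by (simp add: up U_def)
    finally show ?thesis using B.kappa_pos[OF m0(2)] by (simp add: ennreal_eq_0_iff)
  qed
  have eq: "\<phi> v = over f q v" if "v \<in> U" for v
    using that zero by (auto simp: U_def over_def f_def)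
  have "extremal_on G1 (upset G1 p) f"
    unfolding extremal_on_def
  proof (intro conjI allI impI)
    show "harmonic_on G1 (upset G1 p) f"
      unfolding harmonic_on_def
    proof
      fix l assume l: "l \<in> upset G1 p"
      then have lq: "(l, q) \<in> U" by (simp add: U_def)
      then have "step1 G1 \<phi> (l, q) = \<phi> (l, q)"
        using step_prod[of "(l, q)" \<phi>] 2 ex upclosed_subset[OF U]
        by (auto simp: up extremal_on_def harmonic_on_def)
      then show "step G1 f l = f l" by (simp add: step1_def f_def)
    qed
    show "\<forall>l\<in>upset G1 p. f l < \<infinity>" using ex by (auto simp: extremal_on_def U_def f_def)
    fix g assume g: "harmonic_on G1 (upset G1 p) g \<and> (\<forall>l\<in>upset G1 p. g l \<le> f l)"
    have "harmonic_on P U (over g q)"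
      unfolding U_def using g by (intro over_harmonic_on[OF U12(1) q]) auto
    moreover have "\<forall>v\<in>U. over g q v \<le> \<phi> v"
      using g by (auto simp: eq) (auto simp: over_def U_def)
    ultimately obtain c where c: "c \<ge> 0" "\<And>v. v \<in> U \<Longrightarrow> over g q v = ennreal c * \<phi> v"
      using ex unfolding extremal_on_def by meson
    have "g l = ennreal c * f l" if "l \<in> upset G1 p" for l
      using c(2)[of "(l, q)"] that by (simp add: U_def over_def f_def)
    with c(1) show "\<exists>c\<ge>0. \<forall>l\<in>upset G1 p. g l = ennreal c * f l" by blast
  qed
  note exf = this
  have "0 < f p" using determined_by_point(2)[OF d] by (simp add: f_def zero_less_iff_neq_zero)
  then have "extension G1 (upset G1 p) f \<in> H_ex G1"
    using A.determined_by_imp(3)[OF A.determined_by_extension[OF p _ exf]] by blast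
  moreover have "\<phi> v = spread (extension G1 (upset G1 p) f) q v" if v: "v \<in> verts P" for v
  proof -
    have "\<phi> v = extension P U \<phi> v" using d v by (auto simp: determined_by_def up)
    also have "\<dots> = extension P U (over f q) v" by (rule extension_cong) (rule eq)
    also have "\<dots> = spread (extension G1 (upset G1 p) f) q v"
      unfolding U_def using exf by (intro extension_over[OF U12(1) q _ v]) (auto simp: extremal_on_def)
    finally show ?thesis .
  qed
  ultimately show ?thesis using q by (auto simp: left_form_iff)
qed

lemma right_form_swap:
  "right_form G1 G2 \<phi> q \<phi>2 \<longleftrightarrow> left_form G2 G1 (\<lambda>v. \<phi> (prod.swap v)) \<phi>2 q"
  by (auto simp: right_form_def left_form_def)

lemma H_ex_prod_cases:
  assumes "\<phi> \<in> H_ex P"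
  shows "(\<exists>w1 w2 \<phi>1 \<phi>2. prod_form G1 G2 \<phi> w1 w2 \<phi>1 \<phi>2) \<or> (\<exists>\<phi>1 \<nu>2. left_form G1 G2 \<phi> \<phi>1 \<nu>2) \<or>
    (\<exists>\<nu>1 \<phi>2. right_form G1 G2 \<phi> \<nu>1 \<phi>2)"
proof -
  interpret S: graph_pair G2 G1 by unfold_locales
  obtain p q where d: "determined_by P \<phi> (p, q)"
    using P.H_ex_determined_by[OF assms] by (metis prod.exhaust)
  then have v: "p \<in> verts G1" "q \<in> verts G2" by (auto simp: determined_by_def)
  obtain w1 w2 where w: "0 \<le> w1" "0 \<le> w2" "w1 + w2 = 1"
    and 1: "\<And>v. v \<in> upset P (p, q) \<Longrightarrow> step1 G1 \<phi> v = ennreal w1 * \<phi> v"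
    and 2: "\<And>v. v \<in> upset P (p, q) \<Longrightarrow> step2 G2 \<phi> v = ennreal w2 * \<phi> v"
    using determined_eigen[OF d] by blast
  consider "0 < w1" "0 < w2" | "w2 = 0" | "w1 = 0" using w by linarith
  then show ?thesis
  proof cases
    case 1
    then show ?thesis using prod_form_if_determined[OF d _ _ w(3)] \<open>\<And>v. v \<in> upset P (p, q) \<Longrightarrow> step1 G1 \<phi> v = _\<close> 2 by blast
  next
    case 2
    then show ?thesis
      using left_form_if_determined[OF d] \<open>\<And>v. v \<in> upset P (p, q) \<Longrightarrow> step2 G2 \<phi> v = _\<close> by auto
  next
    case 3
    have "\<exists>\<phi>2. left_form G2 G1 (\<lambda>v. \<phi> (prod.swap v)) \<phi>2 p"
    proof (rule S.left_form_if_determined[OF determined_by_swap[OF d]])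
      fix u assume "u \<in> upset S.P (q, p)"
      then have "prod.swap u \<in> upset P (p, q)" using v by (auto simp: upset_prod)
      then show "step2 G1 (\<lambda>v. \<phi> (prod.swap v)) u = 0" using 1 3 by (simp add: step2_swap)
    qed
    then show ?thesis by (auto simp: right_form_swap)
  qed
qed

lemma determined_by_right_form:
  assumes "right_form G1 G2 \<phi> p \<phi>2"
  shows "\<exists>q. determined_by P \<phi> (p, q)"
proof -
  interpret S: graph_pair G2 G1 by unfold_locales
  obtain q where "determined_by S.P (\<lambda>v. \<phi> (prod.swap v)) (q, p)"
    using S.determined_by_left_form assms unfolding right_form_swap by blast
  then show ?thesis using S.determined_by_swap by fastforce
qed

section \<open>Mutual exclusion of the three forms and uniqueness of the factors\<close>

lemma prod_form_point:
  assumes "prod_form G1 G2 \<phi> w1 w2 \<phi>1 \<phi>2"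
  shows "\<exists>v\<in>verts P. \<phi> v \<noteq> 0 \<and> \<phi> v \<noteq> top"
proof -
  obtain v where "determined_by P \<phi> v" using determined_by_prod_form[OF assms] by blast
  from determined_by_point[OF this] show ?thesis by (intro bexI conjI)
qed

text \<open>The weights are eigenvalues that can be read off from \<open>\<phi>\<close> itself; this
  separates the product form from the other two and makes the weights unique.\<close>

lemma prod_form_step:
  assumes "prod_form G1 G2 \<phi> w1 w2 \<phi>1 \<phi>2" "v \<in> verts P"
  shows "step1 G1 \<phi> v = ennreal w1 * \<phi> v" "step2 G2 \<phi> v = ennreal w2 * \<phi> v"
proof -
  let ?f = "\<lambda>v. tilt G1 G2 w1 w2 v * (\<phi>1 (fst v) * \<phi>2 (snd v))"
  have w: "0 < w1" "0 < w2" and eq: "\<And>v. v \<in> verts P \<Longrightarrow> \<phi> v = ?f v"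
    and H: "\<phi>1 \<in> H_ex G1" "\<phi>2 \<in> H_ex G2"
    using assms(1) by (auto simp: prod_form_def tilt_def mult.assoc)
  have h: "harmonic_on G1 (verts G1) \<phi>1" "harmonic_on G2 (verts G2) \<phi>2"
    using A.H_ex_harmonic[OF H(1)] B.H_ex_harmonic[OF H(2)] by (simp_all add: harmonic_iff)
  have "step1 G1 \<phi> v = step1 G1 ?f v"
    by (rule step1_cong, rule eq) (use assms(2) in \<open>auto simp: edge_def\<close>)
  moreover have "step2 G2 \<phi> v = step2 G2 ?f v"
    by (rule step2_cong, rule eq) (use assms(2) in \<open>auto simp: edge_def\<close>)
  ultimately show "step1 G1 \<phi> v = ennreal w1 * \<phi> v" "step2 G2 \<phi> v = ennreal w2 * \<phi> v"
    using product_eigen[OF w h, of v] assms(2) eq[OF assms(2)] by simp_all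
qed

lemma left_form_support:
  assumes "left_form G1 G2 \<phi> \<phi>1 \<nu>" "v \<in> verts P" "\<phi> v \<noteq> 0" "\<phi> v \<noteq> top"
  shows "snd v = \<nu>"
proof -
  have "\<phi> v = spread \<phi>1 \<nu> v" using assms(1,2) by (auto simp: left_form_iff)
  then show ?thesis
    using assms(3,4) by (auto simp: spread_def ennreal_top_mult split: if_splits)
qed

text \<open>A finite nonzero value occurs only over \<open>\<nu>\<close>, and beyond
  \<open>\<nu>\<close> the function is zero.\<close>

lemma left_form_step2:
  assumes "left_form G1 G2 \<phi> \<phi>1 \<nu>" "v \<in> verts P" "\<phi> v \<noteq> 0" "\<phi> v \<noteq> top"
  shows "step2 G2 \<phi> v = 0"
proof -
  have "step2 G2 \<phi> v = step2 G2 (spread \<phi>1 \<nu>) v"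
    using assms(1,2) by (intro step2_cong) (auto simp: left_form_iff edge_def)
  also have "\<dots> = 0"
    using left_form_support[OF assms] step2_spread_q[of \<nu> \<nu> \<phi>1 "fst v"] B.below_grade[of \<nu> \<nu>]
    by (cases v) auto
  finally show ?thesis .
qed

lemma not_prod_left:
  assumes "prod_form G1 G2 \<phi> w1 w2 \<phi>1 \<phi>2" shows "\<not> left_form G1 G2 \<phi> \<phi>1' \<nu>"
proof
  assume left: "left_form G1 G2 \<phi> \<phi>1' \<nu>"
  obtain v where v: "v \<in> verts P" "\<phi> v \<noteq> 0" "\<phi> v \<noteq> top" using prod_form_point[OF assms] by blast
  have "ennreal w2 * \<phi> v = 0"
    using prod_form_step(2)[OF assms v(1)] left_form_step2[OF left v] by simp
  then show False using v assms by (auto simp: prod_form_def ennreal_eq_0_iff)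
qed

lemma prod_form_swap:
  assumes "prod_form G1 G2 \<phi> w1 w2 \<phi>1 \<phi>2"
  shows "prod_form G2 G1 (\<lambda>v. \<phi> (prod.swap v)) w2 w1 \<phi>2 \<phi>1"
  using assms by (auto simp: prod_form_def ac_simps)

lemma not_prod_right:
  assumes "prod_form G1 G2 \<phi> w1 w2 \<phi>1 \<phi>2" shows "\<not> right_form G1 G2 \<phi> \<nu> \<phi>2'"
proof -
  interpret S: graph_pair G2 G1 by unfold_locales
  show ?thesis unfolding right_form_swap by (rule S.not_prod_left[OF prod_form_swap[OF assms]])
qed

text \<open>At a base point both partial steps would vanish, although their sum is the nonzero value
  of \<open>\<phi>\<close>.\<close>

lemma not_left_right:
  assumes "left_form G1 G2 \<phi> \<phi>1 \<nu>2" shows "\<not> right_form G1 G2 \<phi> \<nu>1 \<phi>2"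
proof
  interpret S: graph_pair G2 G1 by unfold_locales
  assume "right_form G1 G2 \<phi> \<nu>1 \<phi>2"
  then have right: "left_form G2 G1 (\<lambda>v. \<phi> (prod.swap v)) \<phi>2 \<nu>1" by (simp add: right_form_swap)
  obtain v where "determined_by P \<phi> v" using determined_by_left_form[OF assms] by blast
  note v = determined_by_point[OF this]
  have "step1 G1 \<phi> v = 0"
    using S.left_form_step2[OF right, of "prod.swap v"] v by (auto simp: step2_swap)
  moreover have "harmonic_on P (verts P) \<phi>"
    using \<open>determined_by P \<phi> v\<close> P.determined_by_imp(1) by (auto simp: regular_def harmonic_iff)
  ultimately show False
    using step_prod[OF v(1), of \<phi>] left_form_step2[OF assms v] v by (auto simp: harmonic_on_def)
qed

lemma prod_form_unique_weights:
  assumes f: "prod_form G1 G2 \<phi> w1 w2 \<phi>1 \<phi>2" and f': "prod_form G1 G2 \<phi> w1' w2' \<phi>1' \<phi>2'"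
  shows "w1' = w1" "w2' = w2"
proof -
  obtain v where v: "v \<in> verts P" "\<phi> v \<noteq> 0" "\<phi> v \<noteq> top" using prod_form_point[OF f] by blast
  have "\<phi> v * ennreal w1 = \<phi> v * ennreal w1'" "\<phi> v * ennreal w2 = \<phi> v * ennreal w2'"
    using prod_form_step[OF f v(1)] prod_form_step[OF f' v(1)] by (simp_all add: mult.commute)
  then show "w1' = w1" "w2' = w2"
    using v f f' by (auto simp: ennreal_mult_cancel_left prod_form_def)
qed

text \<open>Cancelling the tilt leaves two factorizations of one function, compared at a fixed
  \<open>q\<close> where \<open>\<phi>2\<close> is positive and finite. Then
  \<open>\<phi>2' q\<close> is so too, since a product strictly between 0 and \<open>top\<close> has
  both factors there. The second factor is treated by exchange.\<close>

lemma prod_form_unique: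
  assumes f: "prod_form G1 G2 \<phi> w1 w2 \<phi>1 \<phi>2" and f': "prod_form G1 G2 \<phi> w1' w2' \<phi>1' \<phi>2'"
  shows "\<exists>c::real. 0 < c \<and> (\<forall>l\<in>verts G1. \<phi>1' l = ennreal c * \<phi>1 l)"
proof -
  note w = prod_form_unique_weights[OF f f']
  have eq: "\<phi>1' l * \<phi>2' m = \<phi>1 l * \<phi>2 m" if "l \<in> verts G1" "m \<in> verts G2" for l m
  proof -
    have wp: "0 < w1" "0 < w2" using f by (auto simp: prod_form_def)
    have "tilt G1 G2 w1 w2 (l, m) * (\<phi>1' l * \<phi>2' m) = tilt G1 G2 w1 w2 (l, m) * (\<phi>1 l * \<phi>2 m)"
      using f f' that w by (auto simp: prod_form_def tilt_def mult.assoc)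
    then show ?thesis using tilt_pos_finite[OF wp, of G1 G2 "(l, m)"] by (simp add: ennreal_mult_cancel_left)
  qed
  obtain p where "determined_by G1 \<phi>1 p"
    using f A.H_ex_determined_by by (metis prod_form_def)
  note p = determined_by_point[OF this]
  obtain q where "determined_by G2 \<phi>2 q"
    using f B.H_ex_determined_by by (metis prod_form_def)
  note q = determined_by_point[OF this]
  have "\<phi>1' p * \<phi>2' q \<noteq> 0" "\<phi>1' p * \<phi>2' q \<noteq> top"
    unfolding eq[OF p(1) q(1)] using p q by (auto simp: ennreal_mult_eq_top_iff)
  then have q': "\<phi>2' q \<noteq> 0" "\<phi>2' q \<noteq> top" by (auto simp: ennreal_mult_eq_top_iff)
  have "\<forall>l\<in>verts G1. \<phi>1' l = ennreal (enn2real (\<phi>2 q) / enn2real (\<phi>2' q)) * \<phi>1 l"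
    using q q' eq[OF _ q(1)] by (auto intro!: ennreal_proportional)
  moreover have "0 < enn2real (\<phi>2 q) / enn2real (\<phi>2' q)"
    using q q' by (simp add: enn2real_positive_iff zero_less_iff_neq_zero less_top[symmetric])
  ultimately show ?thesis by blast
qed

end

theorem theorem1p1:
  fixes G1 :: "'a ggraph" and G2 :: "'b ggraph"
  assumes "graded_graph G1" and "graded_graph G2"
  shows
    "(\<forall>\<phi> \<in> H_ex (ggraph_prod G1 G2).
        let case1 = (\<exists>w1 w2 \<phi>1 \<phi>2. prod_form G1 G2 \<phi> w1 w2 \<phi>1 \<phi>2);
            case2 = (\<exists>\<phi>1 \<nu>2. left_form G1 G2 \<phi> \<phi>1 \<nu>2);
            case3 = (\<exists>\<nu>1 \<phi>2. right_form G1 G2 \<phi> \<nu>1 \<phi>2)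
        in (case1 \<or> case2 \<or> case3) \<and>
           \<not> (case1 \<and> case2) \<and> \<not> (case1 \<and> case3) \<and> \<not> (case2 \<and> case3) \<and>
           (\<forall>w1 w2 \<phi>1 \<phi>2 w1' w2' \<phi>1' \<phi>2'.
              prod_form G1 G2 \<phi> w1 w2 \<phi>1 \<phi>2 \<and> prod_form G1 G2 \<phi> w1' w2' \<phi>1' \<phi>2' \<longrightarrow>
                (\<exists>c::real. 0 < c \<and> (\<forall>l\<in>verts G1. \<phi>1' l = ennreal c * \<phi>1 l)) \<and>
                (\<exists>c::real. 0 < c \<and> (\<forall>m\<in>verts G2. \<phi>2' m = ennreal c * \<phi>2 m)))) \<and>
     (\<forall>\<phi>. harmonic (ggraph_prod G1 G2) \<phi> \<and>
          ((\<exists>w1 w2 \<phi>1 \<phi>2. prod_form G1 G2 \<phi> w1 w2 \<phi>1 \<phi>2) \<or>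
           (\<exists>\<phi>1 \<nu>2. left_form G1 G2 \<phi> \<phi>1 \<nu>2) \<or>
           (\<exists>\<nu>1 \<phi>2. right_form G1 G2 \<phi> \<nu>1 \<phi>2)) \<longrightarrow>
        (finite_harmonic (ggraph_prod G1 G2) \<phi> \<or> semifinite_harmonic (ggraph_prod G1 G2) \<phi>) \<and>
        indecomposable (ggraph_prod G1 G2) \<phi>)"
proof -
  interpret graph_pair G1 G2 using assms by (simp add: graph_pair_def)
  interpret S: graph_pair G2 G1 by unfold_locales
  show ?thesis
  proof (intro conjI ballI allI impI)
    fix \<phi> assume "\<phi> \<in> H_ex P"
    note cases = H_ex_prod_cases[OF this]
    show "let case1 = (\<exists>w1 w2 \<phi>1 \<phi>2. prod_form G1 G2 \<phi> w1 w2 \<phi>1 \<phi>2);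
            case2 = (\<exists>\<phi>1 \<nu>2. left_form G1 G2 \<phi> \<phi>1 \<nu>2);
            case3 = (\<exists>\<nu>1 \<phi>2. right_form G1 G2 \<phi> \<nu>1 \<phi>2)
        in (case1 \<or> case2 \<or> case3) \<and>
           \<not> (case1 \<and> case2) \<and> \<not> (case1 \<and> case3) \<and> \<not> (case2 \<and> case3) \<and>
           (\<forall>w1 w2 \<phi>1 \<phi>2 w1' w2' \<phi>1' \<phi>2'.
              prod_form G1 G2 \<phi> w1 w2 \<phi>1 \<phi>2 \<and> prod_form G1 G2 \<phi> w1' w2' \<phi>1' \<phi>2' \<longrightarrow>
                (\<exists>c::real. 0 < c \<and> (\<forall>l\<in>verts G1. \<phi>1' l = ennreal c * \<phi>1 l)) \<and>
                (\<exists>c::real. 0 < c \<and> (\<forall>m\<in>verts G2. \<phi>2' m = ennreal c * \<phi>2 m)))"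
      unfolding Let_def
      by (intro conjI cases notI allI impI; elim conjE exE)
         (erule (1) not_prod_left[THEN notE] not_prod_right[THEN notE] not_left_right[THEN notE]
            prod_form_unique S.prod_form_unique[OF prod_form_swap prod_form_swap])+
  next
    fix \<phi> assume "harmonic P \<phi> \<and> ((\<exists>w1 w2 \<phi>1 \<phi>2. prod_form G1 G2 \<phi> w1 w2 \<phi>1 \<phi>2) \<or>
      (\<exists>\<phi>1 \<nu>2. left_form G1 G2 \<phi> \<phi>1 \<nu>2) \<or> (\<exists>\<nu>1 \<phi>2. right_form G1 G2 \<phi> \<nu>1 \<phi>2))"
    \<comment> \<open>Each form supplies a base point, and \<open>determined_by\<close> implies the
      rest.\<close>
    then have "\<exists>v. determined_by P \<phi> v"
      using determined_by_prod_form determined_by_left_form determined_by_right_form by blast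
    then obtain v where "determined_by P \<phi> v" by blast
    note * = P.determined_by_imp[OF this]
    show "finite_harmonic P \<phi> \<or> semifinite_harmonic P \<phi>" using *(1) by (simp add: P.regular_iff)
    show "indecomposable P \<phi>" by (rule *(2))
  qed
qed

end
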